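(* An infinite non-abelian metacyclic group $G$ is a cut-group if, and only if, it is isomorphic to one of the following groups: (i) $\langle a,b \mid b^n=1,\ ba=a^{-1}b\rangle$ with $n\in\{0,2,4,6,8,12\}$; (ii) $\langle a,b \mid a^m=1,\ ba=a^rb\rangle$ with $m\ge 3$, $1\neq r\in U(m)$ and $U(m)=\langle -1,r\rangle$.
   Context: A group $G$ is metacyclic if it has a cyclic normal subgroup $N$ with $G/N$ cyclic. $U(m)=\{j : 1\le j\le m,\ \gcd(j,m)=1\}$, regarded as the group of units modulo $m$; $\langle -1,r\rangle$ is the subgroup of it generated by the classes of $-1$ and $r$. For $n=0$ the relation $b^n=1$ is vacuous ($b$ has infinite order). For a group $G$, $\mathcal{U}(\mathbb{Z}[G])$ is the group of units of the integral group ring $\mathbb{Z}[G]$ and $\mathcal{Z}(\cdot)$ denotes the center of a group. $G$ is called a cut-group if $\mathcal{Z}(\mathcal{U}(\mathbb{Z}[G]))=\pm\mathcal{Z}(G)$. *)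

theory Defs
  imports "HOL-Algebra.Algebra" "HOL-Number_Theory.Number_Theory"
begin

section \<open>Metacyclic groups and centers\<close>

definition metacyclic :: "('a, 'b) monoid_scheme \<Rightarrow> bool" where
  "metacyclic G \<longleftrightarrow>
     (\<exists>N. N \<lhd> G \<and> cyclic_group (G\<lparr>carrier := N\<rparr>) \<and> cyclic_group (G Mod N))"

definition center :: "('a, 'b) monoid_scheme \<Rightarrow> 'a set" where
  "center G = {z \<in> carrier G. \<forall>x \<in> carrier G. z \<otimes>\<^bsub>G\<^esub> x = x \<otimes>\<^bsub>G\<^esub> z}"


section \<open>The integral group ring and cut-groups\<close>

text \<open>
  The additive group is \<^const>\<open>free_Abelian_group\<close> on the carrier of \<open>G\<close>; the product is the
  bilinear extension of the product of \<open>G\<close>, and \<open>g\<close> is identified with \<open>frag_of g\<close>.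
\<close>

definition group_ring :: "('a, 'b) monoid_scheme \<Rightarrow> ('a \<Rightarrow>\<^sub>0 int) ring" where
  "group_ring G =
     \<lparr>carrier = carrier (free_Abelian_group (carrier G)),
      monoid.mult = (\<lambda>p q. frag_extend (\<lambda>g. frag_extend (\<lambda>h. frag_of (g \<otimes>\<^bsub>G\<^esub> h)) q) p),
      one = frag_of \<one>\<^bsub>G\<^esub>,
      ring.zero = 0,
      ring.add = (+)\<rparr>"

definition cut_group :: "('a, 'b) monoid_scheme \<Rightarrow> bool" where
  "cut_group G \<longleftrightarrow>
     center (units_of (group_ring G)) = frag_of ` center G \<union> (\<lambda>g. - frag_of g) ` center G"


section \<open>Groups given by generators and relations\<close>

text \<open>
  The letter \<open>(x, True)\<close> stands for the generator \<open>x\<close> and \<open>(x, False)\<close> for its inverse. Every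
  element of the type \<open>'x\<close> is a generator, and a pair \<open>(u, v)\<close> of words is the relation \<open>u = v\<close>.
\<close>

type_synonym 'x group_word = "('x \<times> bool) list"

inductive_set relation_cong ::
    "('x group_word \<times> 'x group_word) set \<Rightarrow> ('x group_word \<times> 'x group_word) set"
  for R where
    rel: "(u, v) \<in> R \<Longrightarrow> (u, v) \<in> relation_cong R"
  | cancel: "([(x, e), (x, \<not> e)], []) \<in> relation_cong R"
  | refl: "(u, u) \<in> relation_cong R"
  | sym: "(u, v) \<in> relation_cong R \<Longrightarrow> (v, u) \<in> relation_cong R"
  | trans: "(u, v) \<in> relation_cong R \<Longrightarrow> (v, w) \<in> relation_cong R \<Longrightarrow> (u, w) \<in> relation_cong R"
  | append: "(u, u') \<in> relation_cong R \<Longrightarrow> (v, v') \<in> relation_cong R \<Longrightarrow>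
      (u @ v, u' @ v') \<in> relation_cong R"

definition presented_group ::
    "('x group_word \<times> 'x group_word) set \<Rightarrow> 'x group_word set monoid" where
  "presented_group R =
     \<lparr>carrier = UNIV // relation_cong R,
      monoid.mult = (\<lambda>A B. \<Union>u\<in>A. \<Union>v\<in>B. relation_cong R `` {u @ v}),
      one = relation_cong R `` {[]}\<rparr>"

datatype gen = Gen_a | Gen_b

abbreviation letter_a :: "gen \<times> bool" where "letter_a \<equiv> (Gen_a, True)"
abbreviation letter_a_inv :: "gen \<times> bool" where "letter_a_inv \<equiv> (Gen_a, False)"
abbreviation letter_b :: "gen \<times> bool" where "letter_b \<equiv> (Gen_b, True)"

text \<open>\<open>\<langle>a, b | b\<^sup>n = 1, ba = a\<^sup>-\<^sup>1b\<rangle>\<close>; for \<open>n = 0\<close> the first relation is \<open>[] = []\<close>.\<close>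

definition infinite_kernel_group :: "nat \<Rightarrow> gen group_word set monoid" where
  "infinite_kernel_group n = presented_group
     {(replicate n letter_b, []),
      ([letter_b, letter_a], [letter_a_inv, letter_b])}"

text \<open>\<open>\<langle>a, b | a\<^sup>m = 1, ba = a\<^sup>rb\<rangle>\<close>.\<close>

definition finite_kernel_group :: "nat \<Rightarrow> nat \<Rightarrow> gen group_word set monoid" where
  "finite_kernel_group m r = presented_group
     {(replicate m letter_a, []),
      ([letter_b, letter_a], replicate r letter_a @ [letter_b])}"


section \<open>Well-definedness\<close>

lemma keys_frag_extend_subset:
  assumes "\<And>x. x \<in> Poly_Mapping.keys c \<Longrightarrow> Poly_Mapping.keys (f x) \<subseteq> S"
  shows "Poly_Mapping.keys (frag_extend f c) \<subseteq> S"
  using keys_frag_extend[of f c] assms by blast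

lemma frag_extend_add_fun:
  "frag_extend (\<lambda>x. f x + g x) c = frag_extend f c + frag_extend g c"
  by (simp add: frag_extend_def frag_cmul_distrib2 sum.distrib)

lemma ring_group_ring:
  assumes "group G"
  shows "ring (group_ring G)"
proof -
  interpret group G by fact
  define m where "m = (\<lambda>p q. frag_extend (\<lambda>g. frag_extend (\<lambda>h. frag_of (g \<otimes>\<^bsub>G\<^esub> h)) q) p)"
  have m_closed: "Poly_Mapping.keys (m p q) \<subseteq> carrier G"
    if "Poly_Mapping.keys p \<subseteq> carrier G" "Poly_Mapping.keys q \<subseteq> carrier G" for p q
    unfolding m_def using that by (intro keys_frag_extend_subset) auto
  have m_addl: "m (p + p') q = m p q + m p' q" for p p' q
    by (simp add: m_def frag_extend_add)
  have m_addr: "m p (q + q') = m p q + m p q'" for p q q'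
    by (simp add: m_def frag_extend_add frag_extend_add_fun)
  have m_diffl: "m (p - p') q = m p q - m p' q" for p p' q
    by (simp add: m_def frag_extend_diff)
  have m_diffr: "m p (q - q') = m p q - m p q'" for p q q'
    using m_addr[of p "q - q'" q'] by (simp add: algebra_simps)
  have m_zerol: "m 0 q = 0" and m_zeror: "m p 0 = 0" for p q
    using m_addl[of 0 0 q] m_addr[of p 0 0] by simp_all
  have m_of: "m (frag_of g) (frag_of h) = frag_of (g \<otimes>\<^bsub>G\<^esub> h)" for g h
    by (simp add: m_def)
  note lin = m_addl m_addr m_diffl m_diffr m_zerol m_zeror m_of
  have assoc1: "m (m (frag_of x) (frag_of y)) r = m (frag_of x) (m (frag_of y) r)"
    if "x \<in> carrier G" "y \<in> carrier G" "Poly_Mapping.keys r \<subseteq> carrier G" for x y r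
    using that(3) by (induct r rule: free_Abelian_group_induct[consumes 1])
      (use that in \<open>auto simp: lin m_assoc\<close>)
  have assoc2: "m (m (frag_of x) q) r = m (frag_of x) (m q r)"
    if "x \<in> carrier G" "Poly_Mapping.keys q \<subseteq> carrier G" "Poly_Mapping.keys r \<subseteq> carrier G" for x q r
    using that(2) by (induct q rule: free_Abelian_group_induct[consumes 1])
      (use that assoc1 in \<open>auto simp: lin\<close>)
  have assoc: "m (m p q) r = m p (m q r)"
    if "Poly_Mapping.keys p \<subseteq> carrier G" "Poly_Mapping.keys q \<subseteq> carrier G"
      "Poly_Mapping.keys r \<subseteq> carrier G" for p q r
    using that(1) by (induct p rule: free_Abelian_group_induct[consumes 1])
      (use that assoc2 in \<open>auto simp: lin\<close>)
  have onel: "m (frag_of \<one>\<^bsub>G\<^esub>) p = p" if "Poly_Mapping.keys p \<subseteq> carrier G" for p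
    using that by (induct p rule: free_Abelian_group_induct[consumes 1])
      (auto simp: lin)
  have oner: "m p (frag_of \<one>\<^bsub>G\<^esub>) = p" if "Poly_Mapping.keys p \<subseteq> carrier G" for p
    using that by (induct p rule: free_Abelian_group_induct[consumes 1])
      (auto simp: lin)
  have R: "group_ring G = \<lparr>carrier = {c. Poly_Mapping.keys c \<subseteq> carrier G},
      monoid.mult = m, one = frag_of \<one>\<^bsub>G\<^esub>, ring.zero = 0, ring.add = (+)\<rparr>"
    by (simp add: group_ring_def m_def free_Abelian_group_def)
  have add_closed: "Poly_Mapping.keys (p + q) \<subseteq> carrier G"
    if "Poly_Mapping.keys p \<subseteq> carrier G" "Poly_Mapping.keys q \<subseteq> carrier G"
    for p q :: "'a \<Rightarrow>\<^sub>0 int"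
    using that keys_add[of p q] by blast
  show ?thesis
  proof (rule ringI)
    show "abelian_group (group_ring G)"
    proof (rule abelian_groupI)
      fix x assume "x \<in> carrier (group_ring G)"
      then show "\<exists>y\<in>carrier (group_ring G). y \<oplus>\<^bsub>group_ring G\<^esub> x = \<zero>\<^bsub>group_ring G\<^esub>"
        by (intro bexI[of _ "- x"]) (simp_all add: R)
    qed (simp_all add: R add_closed ac_simps)
    show "monoid (group_ring G)"
      by (rule monoidI) (simp_all add: R onel oner assoc m_closed)
  qed (simp_all add: R lin)
qed

lemma equiv_relation_cong: "equiv UNIV (relation_cong R)"
  by (rule equivI)
    (auto simp: refl_on_def sym_def trans_def intro: relation_cong.refl relation_cong.sym
      relation_cong.trans)

lemma mult_presented_group:
  "relation_cong R `` {u} \<otimes>\<^bsub>presented_group R\<^esub> relation_cong R `` {v} = relation_cong R `` {u @ v}"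
proof -
  have "(\<lambda>u v. relation_cong R `` {u @ v}) respects2 relation_cong R"
    by (rule congruent2I', rule equiv_class_eq[OF equiv_relation_cong])
       (rule relation_cong.append)
  then show ?thesis
    unfolding presented_group_def
    by (simp add: UN_equiv_class2[OF equiv_relation_cong equiv_relation_cong])
qed

lemma relation_cong_inverse:
  "(map (\<lambda>(x, e). (x, \<not> e)) (rev u) @ u, []) \<in> relation_cong R"
proof (induction u)
  case Nil
  show ?case by (simp add: relation_cong.refl)
next
  case (Cons l u)
  obtain x e where l: "l = (x, e)" by (cases l)
  let ?i = "map (\<lambda>(x, e). (x, \<not> e)) (rev u)"
  have "([(x, \<not> e), (x, \<not> \<not> e)] @ u, [] @ u) \<in> relation_cong R"
    by (intro relation_cong.append relation_cong.cancel relation_cong.refl)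
  then have "(?i @ [(x, \<not> e), (x, e)] @ u, ?i @ u) \<in> relation_cong R"
    by (intro relation_cong.append relation_cong.refl) simp
  with Cons.IH show ?case
    by (auto simp: l intro: relation_cong.trans)
qed

lemma group_presented_group: "group (presented_group R)"
proof (rule groupI)
  have car: "carrier (presented_group R) = range (\<lambda>u. relation_cong R `` {u})"
    by (auto simp: presented_group_def quotient_def)
  have one: "\<one>\<^bsub>presented_group R\<^esub> = relation_cong R `` {[]}"
    by (simp add: presented_group_def)
  note simps = car one mult_presented_group
  show "x \<otimes>\<^bsub>presented_group R\<^esub> y \<in> carrier (presented_group R)"
    if "x \<in> carrier (presented_group R)" "y \<in> carrier (presented_group R)" for x y
    using that by (auto simp: simps)
  show "\<one>\<^bsub>presented_group R\<^esub> \<in> carrier (presented_group R)"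
    by (simp add: simps)
  show "x \<otimes>\<^bsub>presented_group R\<^esub> y \<otimes>\<^bsub>presented_group R\<^esub> z =
      x \<otimes>\<^bsub>presented_group R\<^esub> (y \<otimes>\<^bsub>presented_group R\<^esub> z)"
    if "x \<in> carrier (presented_group R)" "y \<in> carrier (presented_group R)"
      "z \<in> carrier (presented_group R)" for x y z
    using that by (auto simp: simps)
  show "\<one>\<^bsub>presented_group R\<^esub> \<otimes>\<^bsub>presented_group R\<^esub> x = x"
    if "x \<in> carrier (presented_group R)" for x
    using that by (auto simp only: simps append_Nil)
  show "\<exists>y\<in>carrier (presented_group R). y \<otimes>\<^bsub>presented_group R\<^esub> x = \<one>\<^bsub>presented_group R\<^esub>"
    if x: "x \<in> carrier (presented_group R)" for x
  proof -
    obtain u where "x = relation_cong R `` {u}" using x by (auto simp: car)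
    then show ?thesis
      by (intro bexI[of _ "relation_cong R `` {map (\<lambda>(x, e). (x, \<not> e)) (rev u)}"])
        (simp_all only: simps equiv_class_eq[OF equiv_relation_cong relation_cong_inverse], simp)
  qed
qed

end

theory Submission
  imports Defs "HOL-Analysis.Analysis"
begin

text \<open>
  An infinite non-abelian metacyclic group consists of the elements \<open>a\<^sup>k b\<^sup>j\<close>, where either \<open>a\<close>
  has infinite order and is inverted by \<open>b\<close>, or \<open>a\<close> has finite order \<open>m\<close>, \<open>b\<close> is of infinite
  order modulo \<open>\<langle>a\<rangle>\<close> and \<open>ba = a\<^sup>r b\<close>. Applying the characters of the finite cyclic factor turns
  central units into units of a Laurent polynomial ring, which are monomials. This reduces the
  theorem to the units of \<open>\<int>[C\<^sub>m]\<close> that are invariant under \<open>x \<mapsto> x\<^sup>r\<close>, where \<open>r = 1\<close> and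
  \<open>m = n / 2\<close> in the first case.

  If \<open>-1\<close> and \<open>r\<close> generate \<open>U(m)\<close>, then for an invariant unit \<open>u\<close> all characters take rational,
  hence integral, values on \<open>u u\<^sup>*\<close>, so \<open>u u\<^sup>* = 1\<close> and \<open>u\<close> is trivial. Otherwise a
  nontrivial invariant unit is found as in Dirichlet's unit theorem: simultaneous approximation
  yields infinitely many invariant elements of bounded norm, and two of them that are congruent
  modulo a suitable integer have a unit as quotient.
\<close>

text \<open>No Galois theory of cyclotomic fields enters. An element is kept as its values at all
  characters at once, so a Galois automorphism is the substitution t -> u t, and two facts carry the
  load: a value that no such substitution changes is an integer, and the value 0 at s forces the
  value 0 at t s for every unit t. Keeping all characters also meets the main obstacle on the unit
  side: a unit of Z[zeta] need not come from Z[C_m], because its values at the non-faithful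
  characters must fit. The constructed unit takes the value 1 there. The maps from G to a Laurent
  polynomial ring are in general not homomorphisms, since G is not abelian; they read off the
  exponents of a^k b^j and are multiplicative only against central elements. In the first family b^2
  is central of order k = n / 2, so the condition becomes U(k) = {1, -1}, that is k in {1, 2, 3, 4,
  6}; this is the origin of 2, 4, 6, 8, 12. For n = 0 there is no torsion and Laurent polynomials
  with integer coefficients suffice.\<close>

hide_const (open) Divisibility.prime

lemmas cong_mod_def = unique_euclidean_semiring_class.cong_def

alias lookup = Poly_Mapping.lookup
alias keys = Poly_Mapping.keys
alias single = Poly_Mapping.single

section \<open>Units of integral group rings of cyclic groups\<close>

definition zeta :: "nat \<Rightarrow> complex" where
  "zeta m = cis (2 * pi / m)"

lemma zeta_pow_eq_1_iff:
  assumes "m > 0"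
  shows "zeta m ^ k = 1 \<longleftrightarrow> m dvd k"
proof -
  have "zeta m ^ k = exp (2 * of_real pi * \<i> * of_nat k / of_nat m)"
    by (simp add: zeta_def cis_conv_exp exp_of_nat_mult[symmetric] algebra_simps)
  then show ?thesis
    using complex_root_unity_eq_1[of m k] assms by simp
qed

lemma zeta_pow_order: "m > 0 \<Longrightarrow> zeta m ^ m = 1"
  by (simp add: zeta_pow_eq_1_iff)

lemma zeta_nonzero [simp]: "zeta m \<noteq> 0"
  by (simp add: zeta_def)

lemma norm_zeta [simp]: "norm (zeta m) = 1"
  by (simp add: zeta_def)

lemma zeta_pow_cong:
  assumes "m > 0" "[k = l] (mod m)"
  shows "zeta m ^ k = zeta m ^ l"
proof -
  have "zeta m ^ k = zeta m ^ (k mod m)" for k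
    by (metis assms(1) div_mult_mod_eq mult.commute mult_1 power_add power_mult power_one zeta_pow_order)
  then show ?thesis
    by (metis assms(2) cong_mod_def)
qed

lemma sum_zeta:
  assumes "m > 0"
  shows "(\<Sum>t<m. zeta m ^ (k * t)) = (if m dvd k then of_nat m else 0)"
proof (cases "m dvd k")
  case True
  then have "zeta m ^ k = 1" using assms by (simp add: zeta_pow_eq_1_iff)
  then show ?thesis using True by (simp add: power_mult)
next
  case False
  then have ne: "zeta m ^ k \<noteq> 1" using assms by (simp add: zeta_pow_eq_1_iff)
  have "(zeta m ^ k) ^ m = 1"
    using zeta_pow_eq_1_iff[OF assms, of "k * m"] by (simp add: power_mult)
  then show ?thesis
    using False geometric_sum[OF ne, of m] by (simp add: power_mult)
qed

text \<open>Indices are natural numbers, so \<open>(m - 1) * t\<close> plays the role of -t; complex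
  conjugation of a value thereby becomes a substitution of the index.\<close>

lemma cnj_zeta_pow:
  assumes "m > 0"
  shows "zeta m ^ (k * ((m - 1) * t)) = cnj (zeta m ^ (k * t))"
proof -
  have "cnj (zeta m ^ (k * t)) * zeta m ^ (k * t) = 1"
    using complex_norm_square[of "zeta m ^ (k * t)"] by (simp add: norm_power mult.commute)
  moreover have "zeta m ^ (k * ((m - 1) * t)) * zeta m ^ (k * t) = zeta m ^ (m * (k * t))"
    using assms by (subst power_add[symmetric]) (cases m, auto simp: algebra_simps)
  moreover have "zeta m ^ (m * (k * t)) = 1"
    using assms by (simp add: zeta_pow_eq_1_iff)
  ultimately show ?thesis
    by (metis mult_cancel_right zeta_nonzero power_not_zero)
qed

lemma sum_mult_residues:
  fixes g :: "nat \<Rightarrow> 'b :: comm_monoid_add"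
  assumes "m > 0" "coprime u m" "\<And>k l. [k = l] (mod m) \<Longrightarrow> g k = g l"
  shows "(\<Sum>t<m. g (u * t)) = (\<Sum>t<m. g t)"
proof -
  have "inj_on (\<lambda>t. u * t mod m) {..<m}"
  proof (rule inj_onI)
    fix x y assume xy: "x \<in> {..<m}" "y \<in> {..<m}" "u * x mod m = u * y mod m"
    then have "[x = y] (mod m)"
      using cong_mult_lcancel_nat[of u m x y] assms(2)
      by (simp add: cong_mod_def)
    with xy show "x = y" by (simp add: cong_mod_def)
  qed
  moreover have "(\<lambda>t. u * t mod m) ` {..<m} \<subseteq> {..<m}"
    using assms(1) by auto
  ultimately have "bij_betw (\<lambda>t. u * t mod m) {..<m} {..<m}"
    by (simp add: bij_betw_def endo_inj_surj)
  then have "(\<Sum>t<m. g (u * t mod m)) = (\<Sum>t<m. g t)"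
    by (rule sum.reindex_bij_betw)
  moreover have "g (u * t mod m) = g (u * t)" for t
    by (rule assms(3)) (simp add: cong_mod_def)
  ultimately show ?thesis by simp
qed

text \<open>
  The integral group ring of a cyclic group of order \<open>m\<close>, seen through the Fourier transform:
  an element is represented by the values of all characters on it, so that the product is
  pointwise and the automorphism \<open>x \<mapsto> x\<^sup>u\<close> of the group becomes \<open>t \<mapsto> u t\<close>.
\<close>

inductive_set cyc :: "nat \<Rightarrow> (nat \<Rightarrow> complex) set" for m where
  mono: "(\<lambda>t. zeta m ^ (k * t)) \<in> cyc m"
| diff: "F \<in> cyc m \<Longrightarrow> G \<in> cyc m \<Longrightarrow> (\<lambda>t. F t - G t) \<in> cyc m"

lemma cyc_0: "(\<lambda>t. 0) \<in> cyc m"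
  using cyc.diff[OF cyc.mono[of m 0] cyc.mono[of m 0]] by simp

lemma cyc_1: "(\<lambda>t. 1) \<in> cyc m"
  using cyc.mono[of m 0] by simp

lemma cyc_minus: "F \<in> cyc m \<Longrightarrow> (\<lambda>t. - F t) \<in> cyc m"
  using cyc.diff[OF cyc_0] by fastforce

lemma cyc_add: "F \<in> cyc m \<Longrightarrow> G \<in> cyc m \<Longrightarrow> (\<lambda>t. F t + G t) \<in> cyc m"
  using cyc.diff[OF _ cyc_minus] by fastforce

lemma cyc_mult:
  assumes "F \<in> cyc m" "G \<in> cyc m"
  shows "(\<lambda>t. F t * G t) \<in> cyc m"
  using assms(1)
proof induction
  case (mono k)
  show ?case
    using assms(2)
  proof induction
    case (mono l)
    show ?case using cyc.mono[of m "k + l"] by (simp add: power_add distrib_right)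
  next
    case (diff F G)
    then show ?case using cyc.diff[OF diff.IH] by (simp add: right_diff_distrib)
  qed
next
  case (diff F G)
  then show ?case using cyc.diff[OF diff.IH] by (simp add: left_diff_distrib)
qed

lemma cyc_of_nat: "(\<lambda>t. of_nat n) \<in> cyc m"
  by (induction n) (use cyc_0 cyc_1 cyc_add in \<open>auto intro: cyc_add cyc_1\<close>)

lemma cyc_of_int: "(\<lambda>t. of_int n) \<in> cyc m"
  using cyc_of_nat cyc_minus by (cases n rule: int_cases2) fastforce+

lemma cyc_sum:
  assumes "\<And>i. i \<in> I \<Longrightarrow> F i \<in> cyc m"
  shows "(\<lambda>t. \<Sum>i\<in>I. F i t) \<in> cyc m"
  using assms by (induction I rule: infinite_finite_induct) (auto intro: cyc_0 cyc_add)

lemma cyc_prod: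
  assumes "\<And>i. i \<in> I \<Longrightarrow> F i \<in> cyc m"
  shows "(\<lambda>t. \<Prod>i\<in>I. F i t) \<in> cyc m"
  using assms by (induction I rule: infinite_finite_induct) (auto intro: cyc_1 cyc_mult)

lemma cyc_power: "F \<in> cyc m \<Longrightarrow> (\<lambda>t. F t ^ n) \<in> cyc m"
  by (induction n) (auto intro: cyc_1 cyc_mult)

lemma cyc_scale:
  assumes "F \<in> cyc m"
  shows "(\<lambda>t. F (s * t)) \<in> cyc m"
  using assms
proof induction
  case (mono k)
  show ?case using cyc.mono[of m "k * s"] by (simp add: ac_simps)
qed (rule cyc.diff)

lemma cyc_cong:
  assumes "m > 0" "F \<in> cyc m" "[t = s] (mod m)"
  shows "F t = F s"
  using assms(2)
proof induction
  case (mono k)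
  show ?case using assms(1,3) by (intro zeta_pow_cong cong_mult cong_refl)
qed simp

lemma cyc_mod: "m > 0 \<Longrightarrow> F \<in> cyc m \<Longrightarrow> F (t mod m) = F t"
  by (rule cyc_cong) (auto simp: cong_mod_def)

lemma cyc_cnj:
  assumes "m > 0" "F \<in> cyc m"
  shows "F ((m - 1) * t) = cnj (F t)"
  using assms(2) by induction (use cnj_zeta_pow[OF assms(1)] in simp_all)

lemma cyc_coeffs:
  assumes "m > 0" "F \<in> cyc m"
  obtains c :: "nat \<Rightarrow> int" where "\<And>t. F t = (\<Sum>k<m. of_int (c k) * zeta m ^ (k * t))"
proof -
  have "\<exists>c. \<forall>t. F t = (\<Sum>k<m. of_int (c k) * zeta m ^ (k * t))"
    using assms(2)
  proof induction
    case (mono l)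
    have "zeta m ^ (l * t) = (\<Sum>k<m. of_int (if k = l mod m then 1 else 0) * zeta m ^ (k * t))"
      for t
    proof -
      have "(\<Sum>k<m. of_int (if k = l mod m then 1 else 0) * zeta m ^ (k * t)) =
          (\<Sum>k<m. if k = l mod m then zeta m ^ (k * t) else 0)"
        by (rule sum.cong) auto
      also have "\<dots> = zeta m ^ (l mod m * t)"
        using assms(1) by simp
      also have "\<dots> = zeta m ^ (l * t)"
        by (rule zeta_pow_cong[OF assms(1)]) (simp add: cong_mod_def mod_mult_left_eq)
      finally show ?thesis by simp
    qed
    then show ?case
      by (intro exI[of _ "\<lambda>k. if k = l mod m then 1 else 0"] allI) blast
  next
    case (diff F G)
    then obtain c d where "\<forall>t. F t = (\<Sum>k<m. of_int (c k) * zeta m ^ (k * t))"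
      "\<forall>t. G t = (\<Sum>k<m. of_int (d k) * zeta m ^ (k * t))" by blast
    then show ?case
      by (intro exI[of _ "\<lambda>k. c k - d k"]) (simp add: sum_subtractf left_diff_distrib)
  qed
  then show ?thesis using that by blast
qed

lemma cyc_of_coeffs: "(\<lambda>t. \<Sum>k\<in>K. of_int (c k) * zeta m ^ (f k * t)) \<in> cyc m"
  by (intro cyc_sum cyc_mult cyc_of_int cyc.mono)

lemma dvd_pos_lt_double_iff:
  fixes n m :: nat
  assumes "0 < n" "n < 2 * m"
  shows "m dvd n \<longleftrightarrow> n = m"
proof
  assume "m dvd n"
  then obtain q where q: "n = m * q" ..
  with assms have "m * q < m * 2" "q \<noteq> 0" by auto
  then have "q = 1" by simp
  with q show "n = m" by simp
qed simp

text \<open>The factor \<open>zeta m ^ ((m - l) * t)\<close> is the conjugate of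
  \<open>zeta m ^ (l * t)\<close>. Orthogonality keeps the k for which m divides
  \<open>k + (m - l)\<close>; this number lies between 1 and 2 m - 1, so it must be m, and k =
  l.\<close>

lemma fourier_inversion:
  assumes "m > 0" "\<And>t. F t = (\<Sum>k<m. c k * zeta m ^ (k * t))" "l < m"
  shows "(\<Sum>t<m. F t * zeta m ^ ((m - l) * t)) = of_nat m * c l"
proof -
  have "(\<Sum>t<m. F t * zeta m ^ ((m - l) * t)) =
      (\<Sum>t<m. \<Sum>k<m. c k * zeta m ^ ((k + (m - l)) * t))"
    by (simp add: assms(2) sum_distrib_right power_add distrib_right mult.assoc)
  also have "\<dots> = (\<Sum>k<m. c k * (\<Sum>t<m. zeta m ^ ((k + (m - l)) * t)))"
    by (subst sum.swap) (simp add: sum_distrib_left)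
  also have "\<dots> = (\<Sum>k<m. if k = l then of_nat m * c k else 0)"
  proof (rule sum.cong)
    fix k assume "k \<in> {..<m}"
    then have "m dvd k + (m - l) \<longleftrightarrow> k = l"
      using assms(3) dvd_pos_lt_double_iff[of "k + (m - l)" m] by auto
    then show "c k * (\<Sum>t<m. zeta m ^ ((k + (m - l)) * t)) =
        (if k = l then of_nat m * c k else 0)"
      by (simp add: sum_zeta[OF assms(1)])
  qed simp
  also have "\<dots> = of_nat m * c l" using assms(3) by simp
  finally show ?thesis .
qed

section \<open>Integrality and conjugation of character values\<close>

lemma cyc_sum_Ints:
  assumes "m > 0" "F \<in> cyc m"
  shows "(\<Sum>t<m. F t) \<in> \<int>"
  using assms(2) by induction (use sum_zeta[OF assms(1)] in \<open>auto simp: sum_subtractf\<close>)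

text \<open>The case n = 1 makes x rational. With x = a / b in lowest terms every power of b divides
  c, which leaves only b = 1.\<close>

lemma Ints_if_powers_bounded_denominator:
  fixes x :: complex and c :: nat
  assumes "c > 0" "\<And>n. of_nat c * x ^ n \<in> \<int>"
  shows "x \<in> \<int>"
proof -
  obtain d where d: "of_nat c * x = of_int d"
    using assms(2)[of 1] by (auto elim: Ints_cases)
  have x: "x = of_rat (Fract d (int c))"
    using d assms(1) by (simp add: of_rat_rat field_simps)
  obtain a b where ab: "quotient_of (Fract d (int c)) = (a, b)" by (cases "quotient_of (Fract d (int c))")
  then have b: "b > 0" "coprime a b" and q: "Fract d (int c) = Fract a b"
    using quotient_of_denom_pos quotient_of_coprime quotient_of_div[OF ab]
    by (auto simp: Fract_of_int_quotient)
  have xab: "x = of_int a / of_int b"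
    using b by (simp add: x q of_rat_rat)
  have dvd: "b ^ n dvd int c" for n
  proof -
    obtain k where "of_nat c * x ^ n = of_int k"
      using assms(2)[of n] by (auto elim: Ints_cases)
    then have "of_nat c * of_int (a ^ n) = (of_int (k * b ^ n) :: complex)"
      using b by (simp add: xab field_simps power_divide)
    then have "int c * a ^ n = k * b ^ n"
      by (metis of_int_eq_iff of_int_mult of_int_of_nat_eq)
    then have "b ^ n dvd int c * a ^ n" by simp
    moreover have "coprime (b ^ n) (a ^ n)" using b by (simp add: coprime_commute)
    ultimately show ?thesis by (simp add: coprime_dvd_mult_left_iff)
  qed
  have "b = 1"
  proof (rule ccontr)
    assume "b \<noteq> 1"
    \<comment> \<open>The exponent c is already large enough for a contradiction, as c < 2 ^
      c.\<close>
    then have "2 ^ c \<le> b ^ c" using b by (intro power_mono) auto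
    moreover have "b ^ c \<le> int c" using dvd[of c] assms(1) by (intro zdvd_imp_le) auto
    moreover have "int c < 2 ^ c"
      using of_nat_less_two_power[of c, where ?'a = int] by simp
    ultimately show False by simp
  qed
  then show ?thesis by (simp add: xab)
qed

text \<open>A multiple of the idempotent that cuts out the faithful characters.\<close>

lemma cyc_faithful_idempotent:
  assumes "m > 0"
  obtains e and M :: nat where "e \<in> cyc m" "M > 0" "\<And>t. e t = (if coprime t m then of_nat M else 0)"
proof -
  \<comment> \<open>\<open>g p\<close> is the sum of the elements of the subgroup of order p. A
    character t takes the value p on it if p divides t, and 0 otherwise, so the factor
    \<open>p - g p\<close> vanishes exactly at the characters with p dividing t. At the remaining
    characters the product is the radical of m, which becomes \<open>M\<close>.\<close>
  define g where "g p t = (\<Sum>j<p. zeta m ^ ((m div p * j) * t))" for p t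
  define e where "e t = (\<Prod>p\<in>prime_factors m. of_nat p - g p t)" for t
  have g: "g p t = (if p dvd t then of_nat p else 0)" if p: "p \<in> prime_factors m" for p t
  proof -
    have "p dvd m" "p > 0" using p by (auto simp: in_prime_factors_iff prime_gt_0_nat)
    then have mp: "m = m div p * p" "m div p > 0" using assms by (auto simp: div_greater_zero_iff intro: dvd_imp_le)
    let ?w = "zeta m ^ (m div p * t)"
    have gw: "g p t = (\<Sum>j<p. ?w ^ j)"
      by (simp add: g_def power_mult[symmetric] ac_simps)
    have "?w = 1 \<longleftrightarrow> p dvd t"
      using mp by (subst zeta_pow_eq_1_iff[OF assms]) (metis dvd_mult_cancel_left mult.commute nat_mult_dvd_cancel_disj not_gr0)
    moreover have "?w ^ p = 1"
      using zeta_pow_eq_1_iff[OF assms, of "m div p * t * p"] mp(1)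
      by (metis dvd_def mult.commute mult.left_commute power_mult)
    ultimately show ?thesis
      using geometric_sum[of ?w p] by (auto simp: gw)
  qed
  have "e \<in> cyc m"
    unfolding e_def g_def
    by (intro cyc_prod cyc.diff cyc_of_nat cyc_sum cyc.mono)
  moreover have "e t = (if coprime t m then of_nat (\<Prod>p\<in>prime_factors m. p) else 0)" for t
  proof (cases "coprime t m")
    case True
    then have g0: "g p t = 0" if "p \<in> prime_factors m" for p
      using g[OF that] that by (metis coprime_common_divisor_nat not_prime_1 in_prime_factors_iff)
    have "e t = (\<Prod>p\<in>prime_factors m. of_nat p)"
      unfolding e_def by (rule prod.cong) (simp_all add: g0)
    with True show ?thesis by simp
  next
    case False
    then obtain p where p: "prime p" "p dvd t" "p dvd m"
      by (metis coprime_iff_gcd_eq_1 gcd_dvd1 gcd_dvd2 prime_factor_nat dvd_trans)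
    then have "p \<in> prime_factors m" using assms by (simp add: in_prime_factors_iff)
    then have "e t = 0"
      unfolding e_def by (intro prod_zero) (auto simp: g p intro!: bexI[of _ p])
    with False show ?thesis by simp
  qed
  moreover have "(\<Prod>p\<in>prime_factors m. p) > 0"
    by (intro prod_pos) (auto simp: in_prime_factors_iff prime_gt_0_nat)
  ultimately show ?thesis using that by blast
qed

text \<open>
  A value fixed by all Galois automorphisms is rational, since its trace is; its powers have the
  same bounded denominator, so it is an integer.
\<close>

lemma cyc_invariant_Ints:
  assumes "m > 0" "F \<in> cyc m" "\<And>u. coprime u m \<Longrightarrow> F (u * s) = F s"
  shows "F s \<in> \<int>"
proof -
  obtain e and M :: nat where e: "e \<in> cyc m" "M > 0" "\<And>t. e t = (if coprime t m then of_nat M else 0)"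
    using cyc_faithful_idempotent[OF assms(1)] by blast
  let ?U = "{u \<in> {..<m}. coprime u m}"
  \<comment> \<open>For m = 1 the only residue is 0, and it counts as a unit.\<close>
  have "(if m = 1 then 0 else 1) \<in> ?U" using assms(1) by auto
  then have "card ?U > 0" by (subst card_gt_0_iff) auto
  have "of_nat (M * card ?U) * F s ^ n \<in> \<int>" for n
  proof -
    \<comment> \<open>The weight \<open>e\<close> restricts a sum over all characters to the unit
      indices, where invariance makes the summand constant; this sum is the trace up to the factor
      \<open>M\<close>.\<close>
    have "(\<lambda>t. F (s * t)) \<in> cyc m" by (rule cyc_scale[OF assms(2)])
    then have "(\<lambda>t. e t * F (s * t) ^ n) \<in> cyc m"
      by (intro cyc_mult cyc_power e(1))
    then have "(\<Sum>t<m. e t * F (s * t) ^ n) \<in> \<int>" by (rule cyc_sum_Ints[OF assms(1)])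
    also have "(\<Sum>t<m. e t * F (s * t) ^ n) = (\<Sum>t<m. if coprime t m then of_nat M * F s ^ n else 0)"
      by (rule sum.cong) (auto simp: e(3) mult.commute[of s] assms(3))
    also have "\<dots> = of_nat (M * card ?U) * F s ^ n"
      by (simp add: sum.inter_filter[symmetric] mult.commute)
    finally show ?thesis .
  qed
  moreover have "M * card ?U > 0"
    using \<open>card ?U > 0\<close> e(2) by (intro mult_pos_pos)
  ultimately show ?thesis
    by (rule Ints_if_powers_bounded_denominator[rotated])
qed

text \<open>The Frobenius congruence in Z[C_m]: the substitution g -> g^p agrees with the p-th power
  modulo p. Monomials satisfy it exactly, and in the p-th power of a difference the inner binomial
  coefficients are divisible by p.\<close>

lemma cyc_frobenius:
  assumes "prime p" "F \<in> cyc m"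
  obtains G where "G \<in> cyc m" "\<And>t. F (p * t) = F t ^ p + of_nat p * G t"
proof -
  have p0: "p > 0" using assms(1) by (simp add: prime_gt_0_nat)
  have "\<exists>G\<in>cyc m. \<forall>t. F (p * t) = F t ^ p + of_nat p * G t"
    using assms(2)
  proof induction
    case (mono k)
    show ?case
      by (intro bexI[of _ "\<lambda>t. 0"] cyc_0) (simp add: power_mult[symmetric] ac_simps)
  next
    case (diff F G)
    then obtain F' G' where F': "F' \<in> cyc m" "\<And>t. F (p * t) = F t ^ p + of_nat p * F' t"
      and G': "G' \<in> cyc m" "\<And>t. G (p * t) = G t ^ p + of_nat p * G' t" by blast
    define d where "d k = (p choose k) div p" for k
    have d: "of_nat (p choose k) = (of_nat p * of_nat (d k) :: complex)" if "k \<in> {1..<p}" for k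
    proof -
      have "p dvd (p choose k)" using that assms(1) by (intro dvd_choose_prime) auto
      then have "p choose k = p * d k" by (simp add: d_def)
      then show ?thesis by (metis of_nat_mult)
    qed
    define s where "s = (\<lambda>t. \<Sum>k\<in>{1..<p}. of_nat (d k) * F t ^ k * (- G t) ^ (p - k))"
    \<comment> \<open>The sign \<open>(-1) ^ p\<close> is -1 up to a multiple of p: the sum with 1
      is 2 for p = 2 and 0 for odd p.\<close>
    obtain q :: int where q: "(-1) ^ p + 1 = int p * q"
    proof (cases "p = 2")
      case True
      then show ?thesis using that[of 1] by simp
    next
      case False
      then have "odd p" using assms(1) prime_odd_nat prime_ge_2_nat by (metis le_neq_implies_less)
      then show ?thesis using that[of 0] by simp
    qed
    have q': "(- G t) ^ p = - (G t ^ p) + of_nat p * (of_int q * G t ^ p)" for t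
    proof -
      have "(-1) ^ p + 1 = (of_int ((-1) ^ p + 1) :: complex)" by simp
      also have "\<dots> = of_nat p * of_int q" by (simp only: q) simp
      finally have "(-1) ^ p = of_nat p * of_int q - (1 :: complex)" by (simp add: algebra_simps)
      then have "(- G t) ^ p = (of_nat p * of_int q - 1) * G t ^ p" by (subst power_minus) (simp only:)
      then show ?thesis by (simp add: algebra_simps)
    qed
    have "(F t - G t) ^ p = F t ^ p - G t ^ p + of_nat p * (s t + of_int q * G t ^ p)" for t
    proof -
      have "(F t - G t) ^ p = (\<Sum>k\<le>p. of_nat (p choose k) * F t ^ k * (- G t) ^ (p - k))"
        using binomial_ring[of "F t" "- G t" p] by simp
      also have "{..p} = insert 0 (insert p {1..<p})" using p0 by auto
      also have "(\<Sum>k\<in>\<dots>. of_nat (p choose k) * F t ^ k * (- G t) ^ (p - k)) =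
          (- G t) ^ p + F t ^ p + (\<Sum>k\<in>{1..<p}. of_nat (p choose k) * F t ^ k * (- G t) ^ (p - k))"
        using p0 by simp
      also have "(\<Sum>k\<in>{1..<p}. of_nat (p choose k) * F t ^ k * (- G t) ^ (p - k)) = of_nat p * s t"
        unfolding s_def sum_distrib_left by (rule sum.cong) (auto simp: d mult.assoc)
      finally show ?thesis by (simp add: q' algebra_simps)
    qed
    then have "F (p * t) - G (p * t) = (F t - G t) ^ p +
        of_nat p * (F' t - G' t - (s t + of_int q * G t ^ p))" for t
      by (simp add: F'(2) G'(2) algebra_simps)
    moreover have "(\<lambda>t. F' t - G' t - (s t + of_int q * G t ^ p)) \<in> cyc m"
      unfolding s_def
      by (intro cyc.diff cyc_add cyc_sum cyc_mult cyc_power cyc_of_nat cyc_of_int cyc_minus F' G' diff.hyps)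
    ultimately show ?case by (intro bexI[rotated] allI)
  qed
  then show ?thesis using that by blast
qed

text \<open>A rational linear functional that is nonzero at \<open>\<alpha>\<close> has a common denominator on the
  finitely generated module in question.\<close>

lemma cyc_finitely_many_divisors:
  assumes "m > 0" "\<alpha> \<noteq> 0"
  obtains c :: nat where "c > 0" "\<And>n G. G \<in> cyc m \<Longrightarrow> \<alpha> = of_nat n * G 1 \<Longrightarrow> n \<le> c"
proof -
  interpret V: vector_space_pair "\<lambda>(q::rat) (z::complex). of_rat q * z" "\<lambda>(q::rat) (z::rat). q * z"
    by unfold_locales (simp_all add: algebra_simps of_rat_add of_rat_mult)
  \<comment> \<open>The complex numbers are regarded as a rational vector space, and the functional
    is normalized to 1 at \<alpha>. Then n times \<open>l (G 1)\<close> is 1, and clearing the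
    denominators of \<open>l\<close> on the powers of zeta by c shows that n divides c.\<close>
  have "V.vs1.independent {\<alpha>}" using assms(2) by simp
  then obtain l where l: "Vector_Spaces.linear (\<lambda>(q::rat) (z::complex). of_rat q * z) (*) l" "l \<alpha> = 1"
    using V.linear_independent_extend[of "{\<alpha>}" "\<lambda>_. 1"] by auto
  interpret l: Vector_Spaces.linear "\<lambda>(q::rat) (z::complex). of_rat q * z" "(*)" l by (rule l(1))
  define den where "den k = nat (snd (quotient_of (l (zeta m ^ k))))" for k
  define c where "c = (\<Prod>k<m. den k)"
  have den: "den k > 0" "of_nat (den k) * l (zeta m ^ k) \<in> \<int>" for k
  proof -
    obtain a b where ab: "quotient_of (l (zeta m ^ k)) = (a, b)" by (cases "quotient_of (l (zeta m ^ k))")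
    then have b: "b > 0" and q: "l (zeta m ^ k) = of_int a / of_int b"
      using quotient_of_denom_pos quotient_of_div by auto
    have "den k = nat b" by (simp add: den_def ab)
    then show "den k > 0" "of_nat (den k) * l (zeta m ^ k) \<in> \<int>" using b by (simp_all add: q)
  qed
  have c: "of_nat c * l (zeta m ^ k) \<in> \<int>" if "k < m" for k
  proof -
    have "c = den k * (\<Prod>k\<in>{..<m}-{k}. den k)"
      using that unfolding c_def by (intro prod.remove) auto
    then have "of_nat c * l (zeta m ^ k) = of_nat (\<Prod>k\<in>{..<m}-{k}. den k) * (of_nat (den k) * l (zeta m ^ k))"
      by simp
    then show ?thesis using den(2)[of k] by (metis Ints_mult Ints_of_nat)
  qed
  have "c > 0" unfolding c_def using den(1) by (intro prod_pos) auto
  moreover have "n \<le> c" if G: "G \<in> cyc m" "\<alpha> = of_nat n * G 1" for n G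
  proof -
    obtain d :: "nat \<Rightarrow> int" where d: "\<And>t. G t = (\<Sum>k<m. of_int (d k) * zeta m ^ (k * t))"
      using cyc_coeffs[OF assms(1) G(1)] by blast
    have "\<alpha> = of_rat (of_nat n) * G 1" using G(2) by simp
    then have "1 = of_nat n * l (G 1)"
      using l.scale[of "of_nat n" "G 1"] l(2) by simp
    moreover have "l (G 1) = (\<Sum>k<m. of_int (d k) * l (zeta m ^ k))"
    proof -
      have "G 1 = (\<Sum>k<m. of_rat (of_int (d k)) * zeta m ^ k)" using d[of 1] by simp
      then show ?thesis by (simp only: l.sum l.scale)
    qed
    ultimately have "of_nat c = of_nat n * (of_nat c * (\<Sum>k<m. of_int (d k) * l (zeta m ^ k)))"
      by (metis mult.left_commute mult.right_neutral)
    then have "of_nat c = of_nat n * (\<Sum>k<m. of_int (d k) * (of_nat c * l (zeta m ^ k)))"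
      by (simp add: sum_distrib_left mult.left_commute)
    moreover have "(\<Sum>k<m. of_int (d k) * (of_nat c * l (zeta m ^ k))) \<in> \<int>"
      by (intro Ints_sum Ints_mult[OF Ints_of_int] c) simp
    then obtain z where "(\<Sum>k<m. of_int (d k) * (of_nat c * l (zeta m ^ k))) = of_int z"
      by (rule Ints_cases)
    ultimately have "of_nat c = of_nat n * (of_int z :: rat)"
      by (simp only:)
    then have "int c = int n * z"
      by (metis of_int_eq_iff of_int_mult of_int_of_nat_eq)
    then have "int n dvd int c" by simp
    then show ?thesis using \<open>c > 0\<close> by (simp add: dvd_imp_le)
  qed
  ultimately show ?thesis using that by blast
qed

text \<open>Every prime up to A divides exactly one of the two summands of the witness: t itself, or
  m times the product of the primes that do not divide t. This takes the place of Dirichlet's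
  theorem on primes in progressions, since conjugation by t can be done one large prime factor at a
  time.\<close>

lemma cong_with_large_prime_factors:
  fixes m t A :: nat
  assumes "m > 0" "coprime t m"
  obtains k where "[k = t] (mod m)" "k > 0" "\<And>p. prime p \<Longrightarrow> p dvd k \<Longrightarrow> p > A"
proof -
  let ?P = "{p \<in> {..A}. prime p \<and> \<not> p dvd t}"
  let ?k = "t + m * \<Prod>?P"
  have "p > A" if p: "prime p" "p dvd ?k" for p
  proof (rule ccontr)
    assume "\<not> p > A"
    show False
    proof (cases "p dvd t")
      case True
      then have "p dvd m * \<Prod>?P" using p(2) by (simp add: dvd_add_right_iff)
      moreover have "\<not> p dvd m"
        using True assms(2) p(1) by (metis coprime_common_divisor_nat not_prime_1)
      ultimately have "p dvd \<Prod>?P" using p(1) by (simp add: prime_dvd_mult_iff)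
      then obtain q where "q \<in> ?P" "p dvd q" using p(1) by (auto simp: prime_dvd_prod_iff)
      then show False using True p(1) primes_dvd_imp_eq by blast
    next
      case False
      then have "p \<in> ?P" using p(1) \<open>\<not> p > A\<close> by auto
      then have "p dvd \<Prod>?P" by (intro dvd_prodI) auto
      then show False using False p(2) by (simp add: dvd_add_left_iff)
    qed
  qed
  moreover have "\<Prod>?P > 0" by (intro prod_pos) (auto simp: prime_gt_0_nat)
  then have "?k > 0" using assms(1) by simp
  moreover have "[?k = t] (mod m)" by (simp add: cong_mod_def)
  ultimately show ?thesis by (intro that[of ?k])
qed

text \<open>
  Landau's proof that the primitive roots of unity are conjugate. If \<open>F s = 0\<close> then \<open>p\<close> divides
  \<open>F (p s)\<close>, hence \<open>F (p s) = 0\<close> for all large primes \<open>p\<close>.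
\<close>

lemma cyc_conjugate_zero:
  assumes "m > 0" "F \<in> cyc m" "F s = 0" "coprime t m"
  shows "F (t * s) = 0"
proof -
  have "\<exists>c. \<forall>n G. F t \<noteq> 0 \<longrightarrow> G \<in> cyc m \<longrightarrow> F t = of_nat n * G 1 \<longrightarrow> n \<le> c" for t
    using cyc_finitely_many_divisors[OF assms(1), of "F t"] by metis
  then obtain c where c: "\<And>t n G. F t \<noteq> 0 \<Longrightarrow> G \<in> cyc m \<Longrightarrow> F t = of_nat n * G 1 \<Longrightarrow> n \<le> c t"
    by metis
  \<comment> \<open>F is periodic, so finitely many bounds \<open>c t\<close> have to be beaten: for
    a prime p > A no nonzero value of F is p times a value at 1 of an element of the ring.\<close>
  define A where "A = (\<Sum>t<m. c t)"
  have step: "F (p * t) = 0" if step: "prime p" "p > A" "F t = 0" for p t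
  proof (rule ccontr)
    assume nz: "F (p * t) \<noteq> 0"
    define t' where "t' = p * t mod m"
    obtain G where G: "G \<in> cyc m" "\<And>j. F (t * (p * j)) = F (t * j) ^ p + of_nat p * G j"
      using cyc_frobenius[OF step(1) cyc_scale[OF assms(2), of t]] by blast
    have t': "F t' = F (p * t)" unfolding t'_def by (rule cyc_mod[OF assms(1,2)])
    have "F t' = of_nat p * G 1"
      using G(2)[of 1] step(1,3) t' by (simp add: prime_gt_0_nat power_0_left mult.commute)
    then have "p \<le> c t'" using c[of t' G p] nz t' G(1) by simp
    also have "\<dots> \<le> A"
      unfolding A_def using assms(1) by (intro member_le_sum) (auto simp: t'_def)
    finally show False using that(2) by simp
  qed
  obtain k where k: "[k = t] (mod m)" "k > 0" "\<And>p. prime p \<Longrightarrow> p dvd k \<Longrightarrow> p > A"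
    using cong_with_large_prime_factors[OF assms(1,4)] by blast
  have "F (k * s) = 0"
    using k(2,3)
  proof (induction k rule: prime_divisors_induct)
    case zero
    then show ?case by simp
  next
    case (unit x)
    then show ?case using assms(3) by simp
  next
    case (factor p x)
    then have "F (x * s) = 0" "p > A" "prime p" by auto
    from step[OF this(3,2,1)] have "F (p * (x * s)) = 0" .
    then show ?case by (simp add: mult.assoc)
  qed
  moreover have "F (k * s) = F (t * s)"
    using k(1) by (intro cyc_cong[OF assms(1,2)] cong_mult cong_refl)
  ultimately show ?thesis by simp
qed

text \<open>The condition that -1 and r generate U(m), with \<open>m - 1\<close> for -1; for r
  coprime to m the negative powers of r are among the others by Euler's theorem. Ranging over all
  natural numbers u instead of residues makes m = 1 an ordinary case.\<close>

definition units_generated :: "nat \<Rightarrow> nat \<Rightarrow> bool" where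
  "units_generated m r \<longleftrightarrow>
     (\<forall>u. coprime u m \<longrightarrow> (\<exists>i. [u = r ^ i] (mod m) \<or> [u = (m - 1) * r ^ i] (mod m)))"

lemma scale_power_invariant:
  fixes F :: "nat \<Rightarrow> 'b"
  assumes "\<And>t. F (r * t) = F t"
  shows "F (r ^ i * t) = F t"
proof (induction i)
  case (Suc i)
  have "F (r ^ Suc i * t) = F (r * (r ^ i * t))" by (simp add: mult.assoc)
  then show ?case using assms Suc by simp
qed simp

text \<open>
  For an invariant unit \<open>F\<close> the values \<open>|F t|\<^sup>2\<close> are fixed by all Galois automorphisms, hence
  integers dividing \<open>1\<close>; by Parseval's identity only one coefficient is nonzero.
\<close>

lemma cyc_norm_Ints:
  assumes "m > 0" "F \<in> cyc m" "\<And>t. F (r * t) = F t" "units_generated m r"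
  shows "of_real ((cmod (F t))\<^sup>2) \<in> (\<int> :: complex set)"
proof -
  define V where "V = (\<lambda>t. F t * F ((m - 1) * t))"
  have V: "V t = of_real ((cmod (F t))\<^sup>2)" for t
    unfolding V_def cyc_cnj[OF assms(1,2)] by (simp only: complex_norm_square)
  have "V \<in> cyc m" unfolding V_def by (rule cyc_mult[OF assms(2) cyc_scale[OF assms(2)]])
  moreover have "V (u * t) = V t" if u: "coprime u m" for u t
  proof -
    obtain i where "[u = r ^ i] (mod m) \<or> [u = (m - 1) * r ^ i] (mod m)"
      using u assms(4) unfolding units_generated_def by blast
    then have "F (u * t) = F t \<or> F (u * t) = cnj (F t)"
    proof
      assume "[u = r ^ i] (mod m)"
      then have "F (u * t) = F (r ^ i * t)"
        by (intro cyc_cong[OF assms(1,2)] cong_mult cong_refl)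
      then show ?thesis using scale_power_invariant[of F r, OF assms(3)] by simp
    next
      assume "[u = (m - 1) * r ^ i] (mod m)"
      then have "F (u * t) = F ((m - 1) * r ^ i * t)"
        by (intro cyc_cong[OF assms(1,2)] cong_mult cong_refl)
      also have "\<dots> = cnj (F (r ^ i * t))"
        using cyc_cnj[OF assms(1,2), of "r ^ i * t"] by (simp add: mult.assoc)
      finally show ?thesis using scale_power_invariant[of F r, OF assms(3)] by simp
    qed
    then show ?thesis by (auto simp: V)
  qed
  ultimately have "V t \<in> \<int>" by (intro cyc_invariant_Ints[OF assms(1)])
  then show ?thesis by (simp add: V)
qed

lemma cyc_norm_1_trivial:
  assumes "m > 0" "F \<in> cyc m" "\<And>t. cmod (F t) = 1"
  obtains k where "(\<forall>t. F t = zeta m ^ (k * t)) \<or> (\<forall>t. F t = - (zeta m ^ (k * t)))"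
proof -
  obtain c :: "nat \<Rightarrow> int" where c: "\<And>t. F t = (\<Sum>k<m. of_int (c k) * zeta m ^ (k * t))"
    using cyc_coeffs[OF assms(1,2)] by blast
  have cnj: "cnj (zeta m ^ (k * t)) = zeta m ^ ((m - k) * t)" if "k < m" for k t
  proof -
    have "zeta m ^ (k * t) * zeta m ^ ((m - k) * t) = zeta m ^ (m * t)"
      using that by (simp add: power_add[symmetric] distrib_right[symmetric])
    also have "\<dots> = 1" using zeta_pow_eq_1_iff[OF assms(1), of "m * t"] by simp
    finally have "zeta m ^ (k * t) * zeta m ^ ((m - k) * t) = zeta m ^ (k * t) * cnj (zeta m ^ (k * t))"
      using complex_norm_square[of "zeta m ^ (k * t)"] by (simp add: norm_power)
    then show ?thesis by simp
  qed
  have "of_nat m = (\<Sum>t<m. F t * cnj (F t))"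
    using assms(3) by (simp add: complex_norm_square[symmetric])
  also have "\<dots> = (\<Sum>t<m. \<Sum>k<m. of_int (c k) * (F t * zeta m ^ ((m - k) * t)))"
  proof (rule sum.cong)
    fix t
    have "cnj (F t) = (\<Sum>k<m. of_int (c k) * zeta m ^ ((m - k) * t))"
      unfolding c cnj_sum by (rule sum.cong) (auto simp: cnj simp del: complex_cnj_power)
    then show "F t * cnj (F t) = (\<Sum>k<m. of_int (c k) * (F t * zeta m ^ ((m - k) * t)))"
      by (simp add: sum_distrib_left mult.left_commute)
  qed simp
  also have "\<dots> = (\<Sum>k<m. of_int (c k) * (\<Sum>t<m. F t * zeta m ^ ((m - k) * t)))"
    by (subst sum.swap) (simp add: sum_distrib_left)
  also have "\<dots> = (\<Sum>k<m. of_int (c k) * (of_nat m * of_int (c k)))"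
    by (rule sum.cong) (auto simp: fourier_inversion[where c = "\<lambda>k. of_int (c k)", OF assms(1) c])
  also have "\<dots> = of_nat m * of_int (\<Sum>k<m. (c k)\<^sup>2)"
    by (simp add: sum_distrib_left power2_eq_square mult.left_commute)
  finally have "of_int (\<Sum>k<m. (c k)\<^sup>2) = (1 :: complex)" using assms(1) by simp
  then have sum1: "(\<Sum>k<m. (c k)\<^sup>2) = 1" by (metis of_int_eq_1_iff)
  then obtain k where k: "k < m" "c k \<noteq> 0"
    by (metis (no_types, lifting) lessThan_iff power_zero_numeral sum.neutral zero_neq_one)
  have split: "(\<Sum>j<m. (c j)\<^sup>2) = (c k)\<^sup>2 + (\<Sum>j\<in>{..<m}-{k}. (c j)\<^sup>2)"
    using k(1) by (intro sum.remove) auto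
  have "(c k)\<^sup>2 > 0" using k(2) by simp
  moreover have "(\<Sum>j\<in>{..<m}-{k}. (c j)\<^sup>2) \<ge> 0" by (intro sum_nonneg) simp
  ultimately have "(c k)\<^sup>2 = 1" "(\<Sum>j\<in>{..<m}-{k}. (c j)\<^sup>2) = 0" using sum1 split by linarith+
  then have ck: "c k = 1 \<or> c k = -1" and z: "\<And>j. j < m \<Longrightarrow> j \<noteq> k \<Longrightarrow> c j = 0"
    by (auto simp: power2_eq_1_iff sum_nonneg_eq_0_iff)
  have "F t = of_int (c k) * zeta m ^ (k * t)" for t
  proof -
    have "F t = (\<Sum>j<m. if j = k then of_int (c k) * zeta m ^ (k * t) else 0)"
      unfolding c using z by (intro sum.cong) auto
    then show ?thesis using k(1) by simp
  qed
  with ck that[of k] show ?thesis by auto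
qed

lemma cyc_trivial_units:
  assumes "m > 0" "units_generated m r" "F \<in> cyc m" "G \<in> cyc m"
    and FG: "\<And>t. F t * G t = 1" and inv: "\<And>t. F (r * t) = F t"
  obtains k where "(\<forall>t. F t = zeta m ^ (k * t)) \<or> (\<forall>t. F t = - (zeta m ^ (k * t)))"
proof (rule cyc_norm_1_trivial[OF assms(1,3)])
  fix t
  have "G (r * t) = G t" for t
    using FG[of t] FG[of "r * t"] inv[of t] by (metis mult_cancel_left mult_zero_left zero_neq_one)
  then obtain a b :: int where "of_real ((cmod (F t))\<^sup>2) = (of_int a :: complex)"
    "of_real ((cmod (G t))\<^sup>2) = (of_int b :: complex)"
    using cyc_norm_Ints[OF assms(1,3) inv assms(2), of t] cyc_norm_Ints[OF assms(1,4) _ assms(2), of t]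
    by (metis Ints_cases)
  then have ab: "(cmod (F t))\<^sup>2 = of_int a" "(cmod (G t))\<^sup>2 = of_int b"
    by (metis of_real_eq_iff of_real_of_int_eq)+
  have "cmod (F t) * cmod (G t) = 1" using FG[of t] by (metis norm_mult norm_one)
  then have "of_int a * of_int b = (1 :: real)"
    unfolding ab[symmetric] power_mult_distrib[symmetric] by simp
  then have "a * b = 1" by (metis of_int_eq_1_iff of_int_mult)
  moreover have "a \<ge> 0" using ab(1) by (metis of_int_0_le_iff zero_le_power2)
  ultimately have "a = 1" using zmult_eq_1_iff by force
  then show "cmod (F t) = 1" using ab(1) by (simp add: power2_eq_1_iff) (metis norm_ge_zero not_one_le_zero neg_0_le_iff_le)
qed (use that in blast)

section \<open>A nontrivial invariant unit when -1 and r do not generate U(m)\<close>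

lemma prod_mult_units:
  fixes g :: "nat \<Rightarrow> 'b :: comm_monoid_mult"
  assumes "m > 0" "coprime u m" "\<And>k l. [k = l] (mod m) \<Longrightarrow> g k = g l"
    and "finite H" "H \<subseteq> {..<m}" "\<And>h. h \<in> H \<Longrightarrow> u * h mod m \<in> H"
  shows "(\<Prod>h\<in>H. g (u * h)) = (\<Prod>h\<in>H. g h)"
proof -
  have "inj_on (\<lambda>h. u * h mod m) H"
  proof (rule inj_onI)
    fix x y assume xy: "x \<in> H" "y \<in> H" "u * x mod m = u * y mod m"
    then have "[x = y] (mod m)"
      using cong_mult_lcancel_nat[of u m x y] assms(2)
      by (simp add: cong_mod_def)
    moreover have "x < m" "y < m" using xy(1,2) assms(5) by auto
    ultimately show "x = y" by (simp add: cong_mod_def)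
  qed
  moreover have "(\<lambda>h. u * h mod m) ` H \<subseteq> H" using assms(6) by auto
  ultimately have "bij_betw (\<lambda>h. u * h mod m) H H"
    using endo_inj_surj[OF assms(4)] by (simp add: bij_betw_def)
  then have "(\<Prod>h\<in>H. g (u * h mod m)) = (\<Prod>h\<in>H. g h)"
    by (rule prod.reindex_bij_betw)
  moreover have "g (u * h mod m) = g (u * h)" for h
    by (rule assms(3)) (simp add: cong_mod_def)
  ultimately show ?thesis by simp
qed

text \<open>Residues below m are taken instead of \<open>totatives m\<close>, so that reduction
  modulo m stays inside the set also for m = 1, where it is {0}.\<close>

definition unit_residues :: "nat \<Rightarrow> nat set" where
  "unit_residues m = {u \<in> {..<m}. coprime u m}"

lemma finite_unit_residues [simp]: "finite (unit_residues m)"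
  by (simp add: unit_residues_def)

lemma mod_in_unit_residues: "m > 0 \<Longrightarrow> coprime u m \<Longrightarrow> u mod m \<in> unit_residues m"
  by (simp add: unit_residues_def)

lemma prod_unit_residues:
  fixes F :: "nat \<Rightarrow> complex"
  assumes "m > 0" "F \<in> cyc m" "coprime t m"
  shows "(\<Prod>u\<in>unit_residues m. F (u * t)) = (\<Prod>u\<in>unit_residues m. F u)"
proof -
  have "(\<Prod>u\<in>unit_residues m. F (t * u)) = (\<Prod>u\<in>unit_residues m. F u)"
    using assms(3) by (intro prod_mult_units[OF assms(1,3)] cyc_cong[OF assms(1,2)])
      (auto simp: unit_residues_def assms(1))
  then show ?thesis by (simp add: mult.commute)
qed

text \<open>The norm of the algebraic integer \<open>F 1\<close> is the value at 1 of t -> product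
  of all \<open>F (u * t)\<close>, an element of the ring whose value at 1 no conjugation
  changes.\<close>

lemma cyc_full_norm_Ints:
  assumes "m > 0" "F \<in> cyc m"
  shows "(\<Prod>u\<in>unit_residues m. F u) \<in> \<int>"
proof -
  have "(\<lambda>t. \<Prod>u\<in>unit_residues m. F (u * t)) \<in> cyc m"
    by (intro cyc_prod cyc_scale[OF assms(2)])
  then have "(\<lambda>t. \<Prod>u\<in>unit_residues m. F (u * t)) 1 \<in> \<int>"
    by (rule cyc_invariant_Ints[OF assms(1)]) (simp add: prod_unit_residues[OF assms])
  then show ?thesis by simp
qed

lemma modular_inverse_exists:
  fixes u m :: nat
  assumes "coprime u m"
  obtains v where "coprime v m" "[v * u = 1] (mod m)"
proof -
  obtain v where v: "[u * v = 1] (mod m)" using cong_solve_coprime_nat[OF assms] by auto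
  then have "coprime (u * v) m" using cong_imp_coprime[OF cong_sym[OF v]] by simp
  then have "coprime v m" by simp
  with v that[of v] show ?thesis by (simp add: mult.commute)
qed

text \<open>\<open>H\<close> holds the residues of the subgroup generated by -1 and r. The sum of
  zeta^h over \<open>H\<close> may fail to separate i from 1, as it can vanish (m = 16, r = 7). The
  polynomial \<open>P\<close> with the roots zeta^h does separate, and its value at a suitable
  natural number n is the element sought; \<open>Q\<close> is its conjugate by i.\<close>

lemma not_generated_separating_element:
  assumes m: "m > 0" and r: "coprime r m" and "\<not> units_generated m r"
  obtains \<theta> i where "\<theta> \<in> cyc m" "\<And>t. \<theta> (r * t) = \<theta> t" "\<And>t. \<theta> ((m - 1) * t) = \<theta> t"
    "coprime i m" "\<theta> i \<noteq> \<theta> 1"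
proof -
  let ?inH = "\<lambda>h. \<exists>j. [h = r ^ j] (mod m) \<or> [h = (m - 1) * r ^ j] (mod m)"
  obtain i where i: "coprime i m" "\<not> ?inH i"
    using assms(3) by (auto simp: units_generated_def)
  have inH_cong: "?inH h \<longleftrightarrow> ?inH h'" if "[h = h'] (mod m)" for h h'
    using that by (meson cong_sym cong_trans)
  define H where "H = {h \<in> {..<m}. ?inH h}"
  have fin: "finite H" "H \<subseteq> {..<m}" by (auto simp: H_def)
  have cong_1: "[m - 1 + 1 = 0] (mod m)" using m by (simp add: cong_0_iff)
  have sq: "[(m - 1) * (m - 1) = 1] (mod m)"
  proof -
    have "(m - 1) * (m - 1) = m * (m - 1) - (m - 1)" by (simp add: diff_mult_distrib)
    also have "[\<dots> = 1] (mod m)"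
    proof (cases "m = 1")
      case False
      then have "m * (m - 1) - (m - 1) = 1 + m * (m - 2)"
        using m by (cases m; cases "m - 1") (auto simp: algebra_simps)
      moreover have "[1 + m * (m - 2) = 1 + 0] (mod m)"
        by (intro cong_add cong_refl) (simp add: cong_0_iff)
      ultimately show ?thesis by simp
    qed simp
    finally show ?thesis .
  qed
  then have "coprime ((m - 1) * (m - 1)) m" using cong_imp_coprime[OF cong_sym[OF sq]] by simp
  then have cm1: "coprime (m - 1) m" by simp
  have H_r: "r * h mod m \<in> H" if "h \<in> H" for h
  proof -
    from that obtain j where "[h = r ^ j] (mod m) \<or> [h = (m - 1) * r ^ j] (mod m)"
      by (auto simp: H_def)
    then have "[r * h = r ^ Suc j] (mod m) \<or> [r * h = (m - 1) * r ^ Suc j] (mod m)"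
      using cong_mult[OF cong_refl[of r m], of h "r ^ j"]
        cong_mult[OF cong_refl[of r m], of h "(m - 1) * r ^ j"] by (auto simp: ac_simps)
    then have "?inH (r * h)" by blast
    then have "?inH (r * h mod m)" using inH_cong[of "r * h mod m" "r * h"] by simp
    then show ?thesis using m by (simp add: H_def)
  qed
  have H_m: "(m - 1) * h mod m \<in> H" if "h \<in> H" for h
  proof -
    from that obtain j where j: "[h = r ^ j] (mod m) \<or> [h = (m - 1) * r ^ j] (mod m)"
      by (auto simp: H_def)
    have "[(m - 1) * ((m - 1) * r ^ j) = r ^ j] (mod m)"
      using cong_mult[OF sq cong_refl[of "r ^ j"]] by (simp add: mult.assoc)
    then have "[(m - 1) * h = (m - 1) * r ^ j] (mod m) \<or> [(m - 1) * h = r ^ j] (mod m)"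
      using j by (meson cong_mult cong_refl cong_trans)
    then have "?inH ((m - 1) * h)" by blast
    then have "?inH ((m - 1) * h mod m)" using inH_cong[of "(m - 1) * h mod m" "(m - 1) * h"] by simp
    then show ?thesis using m by (simp add: H_def)
  qed
  define P where "P = (\<Prod>h\<in>H. [:- (zeta m ^ h), 1:])"
  define Q where "Q = (\<Prod>h\<in>H. [:- (zeta m ^ (h * i)), 1:])"
  have "?inH 1" by (intro exI[of _ 0]) simp
  then have "?inH (1 mod m)" using inH_cong[of "1 mod m" 1] by simp
  then have "1 mod m \<in> H" using m by (simp add: H_def)
  moreover have "zeta m ^ (1 mod m) = zeta m ^ 1"
    by (rule zeta_pow_cong[OF m]) (simp add: cong_mod_def)
  ultimately have "poly P (zeta m) = 0"
    unfolding P_def poly_prod by (intro prod_zero fin bexI[of _ "1 mod m"]) auto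
  moreover have "poly Q (zeta m) \<noteq> 0"
  proof
    assume "poly Q (zeta m) = 0"
    then obtain h where h: "h \<in> H" "zeta m ^ (h * i) = zeta m"
      using fin(1) by (auto simp: Q_def poly_prod)
    obtain j where j: "[h = r ^ j] (mod m) \<or> [h = (m - 1) * r ^ j] (mod m)"
      using h(1) by (auto simp: H_def)
    have "zeta m ^ (h * i + (m - 1)) = zeta m ^ Suc (m - 1)"
      by (simp only: power_add power_Suc h(2))
    also have "\<dots> = 1" using m zeta_pow_order[OF m] by simp
    finally have "zeta m ^ (h * i + (m - 1)) = 1" .
    then have "[h * i + (m - 1) = 0] (mod m)"
      by (simp add: zeta_pow_eq_1_iff[OF m] cong_0_iff)
    then have "[h * i + (m - 1) + 1 = 0 + 1] (mod m)" by (intro cong_add cong_refl)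
    then have hi: "[h * i = 1] (mod m)"
      using m by (simp add: cong_mod_def)
    \<comment> \<open>An inverse of \<open>r ^ j\<close> modulo m, by Euler's theorem. Solving
      \<open>h * i = 1\<close> for i with its help would put i into the subgroup.\<close>
    obtain r' where r': "r' = r ^ (j * (totient m - 1))" by blast
    have "totient m > 0" using m by simp
    then have "j + j * (totient m - 1) = totient m * j" by (cases "totient m") auto
    then have "r ^ j * r' = (r ^ totient m) ^ j"
      by (simp only: r' power_add[symmetric] power_mult[symmetric])
    moreover have "[(r ^ totient m) ^ j = 1 ^ j] (mod m)"
      using euler_theorem[OF r] by (intro cong_pow)
    ultimately have rr: "[r ^ j * r' = 1] (mod m)" by simp
    have "?inH i"
    proof (cases "[h = r ^ j] (mod m)")
      case True
      then have "[r ^ j * i = 1] (mod m)"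
        using hi by (meson cong_mult cong_refl cong_sym cong_trans)
      then have "[r ^ j * i * r' = 1 * r'] (mod m)" by (intro cong_mult cong_refl)
      moreover have "[r ^ j * r' * i = 1 * i] (mod m)" using rr by (intro cong_mult cong_refl)
      ultimately have "[i = r'] (mod m)"
        by (metis (no_types, lifting) cong_sym cong_trans mult.assoc mult.commute mult_1)
      then show ?thesis unfolding r' by blast
    next
      case False
      then have "[h = (m - 1) * r ^ j] (mod m)" using j by blast
      then have "[(m - 1) * r ^ j * i = 1] (mod m)"
        using hi by (meson cong_mult cong_refl cong_sym cong_trans)
      then have "[(m - 1) * r ^ j * i * ((m - 1) * r') = 1 * ((m - 1) * r')] (mod m)"
        by (intro cong_mult cong_refl)
      moreover have "[(m - 1) * (m - 1) * (r ^ j * r') * i = 1 * 1 * i] (mod m)"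
        using sq rr by (intro cong_mult cong_refl)
      moreover have "(m - 1) * r ^ j * i * ((m - 1) * r') = (m - 1) * (m - 1) * (r ^ j * r') * i"
        by (simp only: ac_simps)
      ultimately have "[i = (m - 1) * r'] (mod m)"
        by (metis (no_types, lifting) cong_sym cong_trans mult_1)
      then show ?thesis unfolding r' by blast
    qed
    with i(2) show False by blast
  qed
  \<comment> \<open>Two different polynomials agree at finitely many points only, so some natural
    number tells them apart.\<close>
  ultimately have "P - Q \<noteq> 0" by auto
  then have "finite {x. poly (P - Q) x = 0}" by (rule poly_roots_finite)
  moreover have "infinite (range (of_nat :: nat \<Rightarrow> complex))"
    by (rule range_inj_infinite) (simp add: inj_of_nat)
  ultimately obtain n :: nat where n: "poly (P - Q) (of_nat n) \<noteq> 0"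
    by (metis (mono_tags, lifting) finite_subset image_subsetI mem_Collect_eq)
  define \<theta> where "\<theta> = (\<lambda>t. \<Prod>h\<in>H. of_nat n - zeta m ^ (h * t))"
  have inv: "\<theta> (s * t) = \<theta> t" if "coprime s m" "\<And>h. h \<in> H \<Longrightarrow> s * h mod m \<in> H" for s t
  proof -
    have "(\<Prod>h\<in>H. of_nat n - zeta m ^ ((s * h) * t)) = (\<Prod>h\<in>H. of_nat n - zeta m ^ (h * t))"
      by (rule prod_mult_units[OF m that(1) _ fin that(2), where g = "\<lambda>h. of_nat n - zeta m ^ (h * t)"])
         (auto intro!: zeta_pow_cong[OF m] cong_mult)
    then show ?thesis by (simp add: \<theta>_def ac_simps)
  qed
  show ?thesis
  proof (rule that)
    show "\<theta> \<in> cyc m" unfolding \<theta>_def by (intro cyc_prod cyc.diff cyc_of_nat cyc.mono)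
    show "\<theta> (r * t) = \<theta> t" for t by (rule inv[OF r H_r])
    show "\<theta> ((m - 1) * t) = \<theta> t" for t by (rule inv[OF cm1 H_m])
    show "coprime i m" by (rule i)
    have "\<theta> 1 = poly P (of_nat n)" "\<theta> i = poly Q (of_nat n)"
      by (simp_all add: \<theta>_def P_def Q_def poly_prod)
    then show "\<theta> i \<noteq> \<theta> 1" using n by auto
  qed
qed

text \<open>Multiplication by a unit t with t v = w maps one fibre injectively into the other,
  because the relation \<open>\<theta> u = \<theta> v\<close> survives conjugation by
  \<open>cyc_conjugate_zero\<close>. Equal fibres are what balances large and small conjugates in
  the norm estimate.\<close>

lemma cyc_equal_fibres:
  assumes m: "m > 0" and \<theta>: "\<theta> \<in> cyc m" and vw: "v \<in> unit_residues m" "w \<in> unit_residues m"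
  shows "card {u \<in> unit_residues m. \<theta> u = \<theta> v} \<le> card {u \<in> unit_residues m. \<theta> u = \<theta> w}"
proof -
  have cop: "coprime v m" "coprime w m" using vw by (auto simp: unit_residues_def)
  obtain v' where v': "coprime v' m" "[v' * v = 1] (mod m)"
    using modular_inverse_exists[OF cop(1)] by blast
  define t where "t = w * v'"
  have t: "coprime t m" using v'(1) cop(2) by (simp add: t_def)
  have "[t * v = w * 1] (mod m)"
    unfolding t_def mult.assoc using v'(2) by (intro cong_mult cong_refl)
  then have tv: "\<theta> (t * v) = \<theta> w" using cyc_cong[OF m \<theta>] by simp
  show ?thesis
  proof (rule card_inj_on_le)
    show "inj_on (\<lambda>u. t * u mod m) {u \<in> unit_residues m. \<theta> u = \<theta> v}"
    proof (rule inj_onI)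
      fix x y assume xy: "x \<in> {u \<in> unit_residues m. \<theta> u = \<theta> v}" "y \<in> {u \<in> unit_residues m. \<theta> u = \<theta> v}"
        "t * x mod m = t * y mod m"
      then have "[x = y] (mod m)"
        using cong_mult_lcancel_nat[of t m x y] t
        by (simp add: cong_mod_def)
      with xy(1,2) show "x = y" by (simp add: cong_mod_def unit_residues_def)
    qed
    show "(\<lambda>u. t * u mod m) ` {u \<in> unit_residues m. \<theta> u = \<theta> v} \<subseteq> {u \<in> unit_residues m. \<theta> u = \<theta> w}"
    proof safe
      fix u assume u: "u \<in> unit_residues m" "\<theta> u = \<theta> v"
      have "(\<lambda>s. \<theta> (u * s) - \<theta> (v * s)) \<in> cyc m"
        by (rule cyc.diff[OF cyc_scale[OF \<theta>] cyc_scale[OF \<theta>]])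
      then have "(\<lambda>s. \<theta> (u * s) - \<theta> (v * s)) (t * 1) = 0"
        by (rule cyc_conjugate_zero[OF m _ _ t]) (simp add: u(2))
      then have "\<theta> (t * u) = \<theta> w" using tv by (simp add: mult.commute)
      then show "\<theta> (t * u mod m) = \<theta> w" by (simp add: cyc_mod[OF m \<theta>])
      show "t * u mod m \<in> unit_residues m"
        using u(1) t by (intro mod_in_unit_residues[OF m]) (simp add: unit_residues_def)
    qed
  qed simp
qed

lemma cyc_unit_residues_zero:
  assumes m: "m > 0" and F: "F \<in> cyc m" and uv: "u \<in> unit_residues m" "v \<in> unit_residues m" and 0: "F u = 0"
  shows "F v = 0"
proof -
  have cop: "coprime u m" "coprime v m" using uv by (auto simp: unit_residues_def)
  obtain u' where u': "coprime u' m" "[u' * u = 1] (mod m)"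
    using modular_inverse_exists[OF cop(1)] by blast
  have "F ((v * u') * u) = 0"
    using cop u'(1) by (intro cyc_conjugate_zero[OF m F 0]) simp
  moreover have "[(v * u') * u = v * 1] (mod m)"
    unfolding mult.assoc using u'(2) by (intro cong_mult cong_refl)
  ultimately show ?thesis using cyc_cong[OF m F] by simp
qed

text \<open>
  Integer polynomials in \<open>\<theta>\<close> that are close to a multiple of the real polynomial vanishing at all
  conjugates of \<open>\<theta>\<close> except \<open>\<theta> i\<close>: all their conjugates but one are small, and the norm is bounded.
\<close>

lemma cyc_small_elements:
  assumes m: "m > 0" and \<theta>: "\<theta> \<in> cyc m" "\<And>t. \<theta> (r * t) = \<theta> t" "\<And>t. \<theta> ((m - 1) * t) = \<theta> t"
    and i: "i \<in> unit_residues m" "\<theta> i \<noteq> \<theta> 1" and m1: "m > 1"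
  obtains C where "\<And>\<epsilon>. \<epsilon> > 0 \<Longrightarrow> \<exists>F\<in>cyc m. (\<forall>t. F (r * t) = F t) \<and> (\<forall>u\<in>unit_residues m. F u \<noteq> 0) \<and>
      cmod (\<Prod>u\<in>unit_residues m. F u) \<le> C \<and> cmod (F 1) < \<epsilon>"
proof -
  let ?U = "unit_residues m"
  have one: "1 \<in> ?U" using m1 by (simp add: unit_residues_def)
  \<comment> \<open>Invariance under -1 makes all conjugates of \<theta> real, so real approximation
    can be applied to them.\<close>
  define f where "f u = Re (\<theta> u)" for u
  have real: "\<theta> u = of_real (f u)" for u
  proof -
    have "cnj (\<theta> u) = \<theta> u" using cyc_cnj[OF m \<theta>(1), of u] \<theta>(3)[of u] by simp
    then show ?thesis by (simp add: f_def complex_eq_iff)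
  qed
  have f_eq: "f u = f v \<longleftrightarrow> \<theta> u = \<theta> v" for u v by (simp add: real)
  define x0 where "x0 = f i"
  \<comment> \<open>The conjugates to be made small: all except \<open>\<theta> i\<close>. Since
    \<open>\<theta> 1\<close> is among them, the value at 1 will be small.\<close>
  define Xs where "Xs = f ` ?U - {x0}"
  have finX: "finite Xs" by (simp add: Xs_def)
  have x0: "x0 \<in> f ` ?U" using i(1) by (simp add: x0_def)
  have X1: "f 1 \<in> Xs" using one i(2) by (auto simp: Xs_def x0_def f_eq)
  define n where "n = card Xs"
  have n: "n > 0" using X1 finX by (auto simp: n_def card_gt_0_iff)
  have cardX: "card (f ` ?U) = Suc n"
    using card.remove[of "f ` ?U" x0] x0 by (simp add: n_def Xs_def)
  define h where "h = card {u \<in> ?U. f u = x0}"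
  have h: "card {u \<in> ?U. f u = x} = h" if "x \<in> f ` ?U" for x
  proof -
    from that obtain v where v: "v \<in> ?U" "x = f v" by blast
    show ?thesis
      unfolding h_def x0_def v(2) f_eq
      using cyc_equal_fibres[OF m \<theta>(1) v(1) i(1)] cyc_equal_fibres[OF m \<theta>(1) i(1) v(1)] by simp
  qed
  have cardU: "card ?U = Suc n * h"
  proof -
    have "card ?U = (\<Sum>y\<in>f ` ?U. card {u \<in> ?U. f u = y})"
      using sum.image_gen[of ?U "\<lambda>_. 1 :: nat" f] by simp
    also have "\<dots> = (\<Sum>y\<in>f ` ?U. h)" by (rule sum.cong) (auto simp: h)
    finally show ?thesis by (simp add: cardX)
  qed
  define A where "A = {u \<in> ?U. f u = x0}"
  have A: "finite A" "A \<subseteq> ?U" "card A = h" by (auto simp: A_def h_def)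
  have cardA': "card (?U - A) = n * h"
    using A cardU by (subst card_Diff_subset) auto
  define P0 where "P0 = (\<Prod>x\<in>Xs. [:- x, 1:])"
  have deg: "degree P0 = n"
    unfolding P0_def n_def by (subst degree_prod_eq_sum_degree) auto
  have lead: "coeff P0 n = 1"
    using lead_coeff_prod[of "\<lambda>x. [:- x, 1:]" Xs] unfolding P0_def[symmetric] deg by simp
  have P0_zero: "poly P0 x = 0" if "x \<in> Xs" for x
    using that finX by (auto simp: P0_def poly_prod)
  define B where "B = Max (insert 1 ((\<lambda>u. \<bar>f u\<bar>) ` ?U))"
  have B: "1 \<le> B" "\<And>u. u \<in> ?U \<Longrightarrow> \<bar>f u\<bar> \<le> B" by (auto simp: B_def intro!: Max_ge)
  \<comment> \<open>The first term bounds the error made by rounding coefficients, the second is the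
    size of \<open>P0\<close> at the exceptional conjugate, and the last ensures K >= 1.\<close>
  define K where "K = real n * B ^ n + \<bar>poly P0 x0\<bar> + 1"
  have K: "K \<ge> 1" using B(1) by (simp add: K_def)
  show ?thesis
  proof (rule that)
    fix \<epsilon> :: real assume \<epsilon>: "\<epsilon> > 0"
    obtain N :: nat where N: "N > K / \<epsilon>" using reals_Archimedean2 by blast
    have N0: "N > 0" using N K \<epsilon> by (metis divide_pos_pos gr0I less_le_trans not_less_iff_gr_or_eq of_nat_0 zero_less_one)
    \<comment> \<open>Simultaneous approximation of the coefficients of \<open>P0\<close>: q times
      \<open>P0\<close> is close to an integer polynomial, with an error of 1 / N per coefficient
      and at the price of q <= N ^ n only.\<close>
    obtain q p where q: "0 < q" "q \<le> int (N ^ n)"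
      and p: "\<And>j. j < n \<Longrightarrow> \<bar>of_int q * coeff P0 j - of_int (p j)\<bar> < 1 / N"
      using Dirichlet_approx_simult[OF N0, where n = n and \<theta> = "coeff P0"] by blast
    define y where "y x = of_int q * x ^ n + (\<Sum>j<n. of_int (p j) * x ^ j)" for x :: real
    define F where "F t = of_int q * \<theta> t ^ n + (\<Sum>j<n. of_int (p j) * \<theta> t ^ j)" for t
    have F: "F \<in> cyc m"
      unfolding F_def by (intro cyc_add cyc_sum cyc_mult cyc_of_int cyc_power \<theta>(1))
    have Fr: "F (r * t) = F t" for t by (simp add: F_def \<theta>(2))
    have Fy: "F u = of_real (y (f u))" for u by (simp add: F_def y_def real)
    have P0_sum: "poly P0 x = x ^ n + (\<Sum>j<n. coeff P0 j * x ^ j)" for x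
    proof -
      have "poly P0 x = (\<Sum>j\<le>n. coeff P0 j * x ^ j)" by (simp add: poly_altdef deg)
      also have "{..n} = insert n {..<n}" by auto
      finally show ?thesis by (simp add: lead)
    qed
    have approx: "\<bar>y (f u) - of_int q * poly P0 (f u)\<bar> \<le> real n * B ^ n / N" if u: "u \<in> ?U" for u
    proof -
      have "y (f u) - of_int q * poly P0 (f u) = (\<Sum>j<n. (of_int (p j) - of_int q * coeff P0 j) * f u ^ j)"
        by (simp add: y_def P0_sum algebra_simps sum_distrib_left sum_subtractf)
      also have "\<bar>\<dots>\<bar> \<le> (\<Sum>j<n. \<bar>(of_int (p j) - of_int q * coeff P0 j) * f u ^ j\<bar>)" by (rule sum_abs)
      also have "\<dots> \<le> (\<Sum>j<n. 1 / N * B ^ n)"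
      proof (rule sum_mono)
        fix j assume j: "j \<in> {..<n}"
        have "\<bar>f u ^ j\<bar> \<le> B ^ j" unfolding power_abs using B(2)[OF u] by (intro power_mono) auto
        also have "\<dots> \<le> B ^ n" using j B(1) by (intro power_increasing) auto
        finally have "\<bar>f u ^ j\<bar> \<le> B ^ n" .
        moreover have "\<bar>of_int (p j) - of_int q * coeff P0 j\<bar> \<le> 1 / N"
          using p[of j] j by (simp add: abs_minus_commute)
        ultimately show "\<bar>(of_int (p j) - of_int q * coeff P0 j) * f u ^ j\<bar> \<le> 1 / N * B ^ n"
          unfolding abs_mult by (intro mult_mono) auto
      qed
      finally show ?thesis by simp
    qed
    have small: "cmod (F u) \<le> K / N" if u: "u \<in> ?U - A" for u
    proof -
      have "f u \<in> Xs" using u by (auto simp: Xs_def A_def)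
      then have "\<bar>y (f u)\<bar> \<le> real n * B ^ n / N" using approx[of u] u P0_zero by simp
      also have "\<dots> \<le> K / N" using N0 by (intro divide_right_mono) (auto simp: K_def)
      finally show ?thesis by (simp add: Fy)
    qed
    have large: "cmod (F u) \<le> K * N ^ n" if u: "u \<in> A" for u
    proof -
      have uU: "u \<in> ?U" and fu: "f u = x0" using u by (auto simp: A_def)
      have "\<bar>y x0\<bar> \<le> real n * B ^ n / N + of_int q * \<bar>poly P0 x0\<bar>"
      proof -
        have "\<bar>of_int q * poly P0 x0\<bar> = of_int q * \<bar>poly P0 x0\<bar>" using q(1) by (simp add: abs_mult)
        then show ?thesis using approx[OF uU] unfolding fu by linarith
      qed
      also have "\<dots> \<le> real n * B ^ n * N ^ n + N ^ n * \<bar>poly P0 x0\<bar>"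
      proof (rule add_mono)
        have "1 / N \<le> (1::real)" using N0 by simp
        also have "1 \<le> real N ^ n" using N0 by (simp add: one_le_power)
        finally have "real n * B ^ n * (1 / N) \<le> real n * B ^ n * N ^ n"
          using B(1) by (intro mult_left_mono) auto
        then show "real n * B ^ n / N \<le> real n * B ^ n * N ^ n" by simp
        have "of_int q \<le> real N ^ n" using q(2) by (metis of_int_le_iff of_int_of_nat_eq of_nat_power)
        then show "of_int q * \<bar>poly P0 x0\<bar> \<le> N ^ n * \<bar>poly P0 x0\<bar>" by (simp add: mult_right_mono)
      qed
      also have "\<dots> \<le> K * N ^ n" using N0 by (simp add: K_def algebra_simps)
      finally show ?thesis by (simp add: Fy fu)
    qed
    \<comment> \<open>Here h values are at most K N^n and n h values at most K / N, so all powers of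
      N cancel and the bound does not depend on \<epsilon>.\<close>
    have "cmod (\<Prod>u\<in>?U. F u) = (\<Prod>u\<in>A. cmod (F u)) * (\<Prod>u\<in>?U - A. cmod (F u))"
      using prod.subset_diff[OF A(2), of "\<lambda>u. cmod (F u)"] by (simp add: prod_norm[symmetric] mult.commute)
    also have "\<dots> \<le> (\<Prod>u\<in>A. K * N ^ n) * (\<Prod>u\<in>?U - A. K / N)"
      using small large K by (intro mult_mono prod_mono prod_nonneg) auto
    also have "\<dots> = K ^ card ?U"
      using N0 A(3) cardA' cardU by (simp add: power_mult_distrib power_divide power_mult[symmetric] power_add)
    finally have bound: "cmod (\<Prod>u\<in>?U. F u) \<le> K ^ card ?U" .
    have nz: "F u \<noteq> 0" if u: "u \<in> ?U" for u
    proof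
      assume "F u = 0"
      then have all0: "y (f v) = 0" if "v \<in> ?U" for v
        using cyc_unit_residues_zero[OF m F u that] by (simp add: Fy)
      \<comment> \<open>One vanishing conjugate makes all vanish, and then a polynomial of degree at
        most n with leading coefficient q > 0 would have the n + 1 different conjugates of \<theta>
        as roots.\<close>
      define Y where "Y = monom (of_int q) n + (\<Sum>j<n. monom (of_int (p j) :: real) j)"
      have "coeff Y n = of_int q" by (simp add: Y_def coeff_sum)
      then have "Y \<noteq> 0" using q(1) by auto
      moreover have "degree Y \<le> n"
        unfolding Y_def by (intro degree_add_le degree_sum_le) (auto simp: degree_monom_le intro: order_trans[OF degree_monom_le])
      moreover have "poly Y x = y x" for x by (simp add: Y_def y_def poly_sum poly_monom)
      then have "f ` ?U \<subseteq> {x. poly Y x = 0}" using all0 by auto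
      then have "card (f ` ?U) \<le> card {x. poly Y x = 0}"
        using poly_roots_finite[OF \<open>Y \<noteq> 0\<close>] by (intro card_mono)
      moreover have "card {x. poly Y x = 0} \<le> degree Y" by (rule card_poly_roots_bound[OF \<open>Y \<noteq> 0\<close>])
      ultimately show False using cardX by linarith
    qed
    have "1 \<in> ?U - A" using one i(2) by (auto simp: A_def x0_def f_eq)
    then have "cmod (F 1) \<le> K / N" by (rule small)
    also have "\<dots> < \<epsilon>" using N \<epsilon> N0 by (simp add: field_simps)
    finally show "\<exists>F\<in>cyc m. (\<forall>t. F (r * t) = F t) \<and> (\<forall>u\<in>?U. F u \<noteq> 0) \<and>
        cmod (\<Prod>u\<in>?U. F u) \<le> K ^ card ?U \<and> cmod (F 1) < \<epsilon>"
      using F Fr nz bound by blast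
  qed
qed

text \<open>
  Two elements of equal norm \<open>n\<close> that are congruent modulo \<open>M n\<close> have a quotient that is a unit
  congruent to \<open>1\<close> modulo \<open>M\<close>; being \<open>1\<close> at the non-faithful characters, it is again in the ring.
\<close>

lemma cyc_unit_of_congruent_pair:
  assumes m: "m > 1" and r: "coprime r m"
    and f: "f \<in> cyc m" "\<And>t. f (r * t) = f t" "\<And>u. u \<in> unit_residues m \<Longrightarrow> f u \<noteq> 0"
    and g: "g \<in> cyc m" "\<And>t. g (r * t) = g t" "\<And>u. u \<in> unit_residues m \<Longrightarrow> g u \<noteq> 0"
    and w: "w \<in> cyc m" "\<And>t. w (r * t) = w t"
    and norm: "(\<Prod>u\<in>unit_residues m. f u) = of_int n" "(\<Prod>u\<in>unit_residues m. g u) = of_int n"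
    and e: "e \<in> cyc m" "\<And>t. e t = (if coprime t m then of_int M else 0)"
    and fg: "\<And>t. f t - g t = of_int (M * n) * w t"
  obtains F G where "F \<in> cyc m" "G \<in> cyc m" "\<And>t. F t * G t = 1" "\<And>t. F (r * t) = F t"
    "F 1 = f 1 / g 1"
proof -
  let ?U = "unit_residues m"
  have m0: "m > 0" using m by simp
  have one: "1 \<in> ?U" using m by (simp add: unit_residues_def)
  \<comment> \<open>The product of the other conjugates. At unit indices it acts as the norm divided
    by H, but it is visibly an element of the ring.\<close>
  define cof where "cof H t = (\<Prod>u\<in>?U - {1}. H (u * t))" for H :: "nat \<Rightarrow> complex" and t
  have cof: "cof H \<in> cyc m" "\<And>t. coprime t m \<Longrightarrow> cof H t * H t = (\<Prod>u\<in>?U. H u)" if H: "H \<in> cyc m" for H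
  proof -
    show "cof H \<in> cyc m" unfolding cof_def[abs_def] by (intro cyc_prod cyc_scale[OF H])
    fix t assume "coprime t m"
    then have "(\<Prod>u\<in>?U. H u) = (\<Prod>u\<in>?U. H (u * t))" using prod_unit_residues[OF m0 H] by simp
    also have "\<dots> = H (1 * t) * (\<Prod>u\<in>?U - {1}. H (u * t))"
      by (rule prod.remove[OF finite_unit_residues one])
    finally show "cof H t * H t = (\<Prod>u\<in>?U. H u)" by (simp add: cof_def mult.commute)
  qed
  have cof_r: "cof H (r * t) = cof H t" if "\<And>t. H (r * t) = H t" for H t
    unfolding cof_def by (rule prod.cong[OF HOL.refl]) (metis mult.left_commute that)
  have nz: "H t \<noteq> 0" if H: "H \<in> cyc m" "\<And>u. u \<in> ?U \<Longrightarrow> H u \<noteq> 0" and t: "coprime t m" for H t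
    using H(2)[OF mod_in_unit_residues[OF m0 t]] cyc_mod[OF m0 H(1), of t] by simp
  \<comment> \<open>At unit indices f / g = 1 + M n w / g = 1 + M w \<open>cof g\<close>, because g
    times \<open>cof g\<close> is the norm n. Replacing M by \<open>e\<close> changes nothing there
    and gives the value 1 at all other indices; \<open>G\<close> arises in the same way from g /
    f.\<close>
  define F where "F t = 1 + e t * (w t * cof g t)" for t
  define G where "G t = 1 - e t * (w t * cof f t)" for t
  have Ff: "F t * g t = f t" if t: "coprime t m" for t
  proof -
    have "F t * g t = g t + of_int M * (w t * (cof g t * g t))"
      using t by (simp add: F_def e algebra_simps)
    also have "\<dots> = g t + (f t - g t)" using cof(2)[OF g(1) t] norm(2) fg[of t] by (simp add: mult_ac)
    finally show ?thesis by simp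
  qed
  have Gg: "G t * f t = g t" if t: "coprime t m" for t
  proof -
    have "G t * f t = f t - of_int M * (w t * (cof f t * f t))"
      using t by (simp add: G_def e algebra_simps)
    also have "\<dots> = f t - (f t - g t)" using cof(2)[OF f(1) t] norm(1) fg[of t] by (simp add: mult_ac)
    finally show ?thesis by simp
  qed
  show ?thesis
  proof (rule that)
    show "F \<in> cyc m" unfolding F_def[abs_def] by (intro cyc_add cyc_1 cyc_mult e(1) w(1) cof(1) g(1))
    show "G \<in> cyc m" unfolding G_def[abs_def] by (intro cyc.diff cyc_1 cyc_mult e(1) w(1) cof(1) f(1))
    show "F t * G t = 1" for t
    proof (cases "coprime t m")
      case True
      have "F t * G t * (f t * g t) = f t * g t"
        using Ff[OF True] Gg[OF True] by (metis mult.assoc mult.left_commute)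
      then show ?thesis using nz[OF f(1) f(3) True] nz[OF g(1) g(3) True] by simp
    next
      case False
      then show ?thesis by (simp add: F_def G_def e)
    qed
    show "F (r * t) = F t" for t
      using r by (simp add: F_def e w(2) cof_r[of g, OF g(2)])
    show "F 1 = f 1 / g 1"
      using Ff[of 1] nz[OF g(1) g(3), of 1] by (simp add: field_simps)
  qed
qed

lemma cyc_nontrivial_unit:
  assumes m: "m > 0" and r: "coprime r m" and ng: "\<not> units_generated m r"
  obtains F G where "F \<in> cyc m" "G \<in> cyc m" "\<And>t. F t * G t = 1" "\<And>t. F (r * t) = F t" "cmod (F 1) \<noteq> 1"
proof -
  let ?U = "unit_residues m"
  have "m \<noteq> 1"
  proof
    assume "m = 1"
    then have "units_generated m r" by (simp add: units_generated_def)
    with ng show False by blast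
  qed
  with m have m1: "m > 1" by simp
  obtain \<theta> i where \<theta>: "\<theta> \<in> cyc m" "\<And>t. \<theta> (r * t) = \<theta> t" "\<And>t. \<theta> ((m - 1) * t) = \<theta> t"
    and i: "coprime i m" "\<theta> i \<noteq> \<theta> 1"
    using not_generated_separating_element[OF m r ng] by metis
  have i': "i mod m \<in> ?U" "\<theta> (i mod m) \<noteq> \<theta> 1"
    using mod_in_unit_residues[OF m i(1)] cyc_mod[OF m \<theta>(1), of i] i(2) by auto
  define good where "good C F \<longleftrightarrow> F \<in> cyc m \<and> (\<forall>t. F (r * t) = F t) \<and> (\<forall>u\<in>?U. F u \<noteq> 0) \<and>
      cmod (\<Prod>u\<in>?U. F u) \<le> C" for C F
  obtain C where C: "\<And>\<epsilon>. \<epsilon> > 0 \<Longrightarrow> \<exists>F. good C F \<and> cmod (F 1) < \<epsilon>"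
    using cyc_small_elements[OF m \<theta> i' m1] unfolding good_def by metis
  \<comment> \<open>The elements are sorted by their absolute value at 1, so that two different ones
    yield a quotient of absolute value other than 1, which no trivial unit has. \<open>V\<close> is
    infinite since its positive members become arbitrarily small.\<close>
  define V where "V = {cmod (F 1) | F. good C F}"
  have one: "1 \<in> ?U" using m1 by (simp add: unit_residues_def)
  have "infinite V"
  proof
    assume fin: "finite V"
    have ne: "V \<noteq> {}" using C[of 1] by (auto simp: V_def)
    have "Min V \<in> V" using fin ne by (rule Min_in)
    then have "Min V > 0" using one by (auto simp: V_def good_def)
    then obtain F where "good C F" "cmod (F 1) < Min V" using C by blast
    then have "cmod (F 1) \<in> V" by (auto simp: V_def)
    then have "Min V \<le> cmod (F 1)" using fin by simp
    with \<open>cmod (F 1) < Min V\<close> show False by simp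
  qed
  have "\<forall>v\<in>V. \<exists>F. good C F \<and> cmod (F 1) = v" by (auto simp: V_def)
  then obtain \<Phi> where \<Phi>: "\<And>v. v \<in> V \<Longrightarrow> good C (\<Phi> v)" "\<And>v. v \<in> V \<Longrightarrow> cmod (\<Phi> v 1) = v"
    by metis
  have "\<exists>c. \<forall>t. \<Phi> v t = (\<Sum>k<m. of_int (c k) * zeta m ^ (k * t))" if v: "v \<in> V" for v
  proof -
    have "\<Phi> v \<in> cyc m" using \<Phi>(1)[OF v] by (simp add: good_def)
    then show ?thesis by (metis cyc_coeffs[OF m])
  qed
  then obtain c :: "real \<Rightarrow> nat \<Rightarrow> int" where c: "\<And>v t. v \<in> V \<Longrightarrow> \<Phi> v t = (\<Sum>k<m. of_int (c v k) * zeta m ^ (k * t))"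
    by metis
  obtain e and M :: nat where e: "e \<in> cyc m" "M > 0" "\<And>t. e t = (if coprime t m then of_nat M else 0)"
    using cyc_faithful_idempotent[OF m] by blast
  define D where "D = nat \<lceil>C\<rceil>"
  \<comment> \<open>A norm n with |n| <= D divides D!, so one modulus works for all norms: a
    congruence modulo \<open>L\<close> implies one modulo M n.\<close>
  define L where "L = int M * fact D"
  have L: "L > 0" using e(2) by (simp add: L_def)
  define nrm where "nrm v = (\<Prod>u\<in>?U. \<Phi> v u)" for v
  have nrm: "\<exists>n. nrm v = of_int n \<and> n \<noteq> 0 \<and> \<bar>n\<bar> \<le> int D" if v: "v \<in> V" for v
  proof -
    have g: "good C (\<Phi> v)" by (rule \<Phi>(1)[OF v])
    then have "nrm v \<in> \<int>" unfolding nrm_def by (intro cyc_full_norm_Ints[OF m]) (simp add: good_def)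
    then obtain n where n: "nrm v = of_int n" by (rule Ints_cases)
    have "nrm v \<noteq> 0" using g by (simp add: nrm_def good_def)
    moreover have "cmod (nrm v) \<le> C" using g by (simp add: nrm_def good_def)
    then have "\<bar>of_int n\<bar> \<le> C" by (simp add: n)
    then have "\<bar>n\<bar> \<le> \<lceil>C\<rceil>" by linarith
    then have "\<bar>n\<bar> \<le> int D" unfolding D_def by linarith
    ultimately show ?thesis using n by (intro exI[of _ n]) auto
  qed
  \<comment> \<open>The pigeonhole data: the norm and the coefficients modulo \<open>L\<close> take
    finitely many values.\<close>
  define key where "key v = (nrm v, restrict (\<lambda>k. c v k mod L) {..<m})" for v
  have "key ` V \<subseteq> (of_int ` {- int D..int D}) \<times> (PiE {..<m} (\<lambda>_. {0..<L}))"
  proof (rule image_subsetI)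
    fix v assume "v \<in> V"
    then obtain n where "nrm v = of_int n" "\<bar>n\<bar> \<le> int D" using nrm by blast
    then have "nrm v \<in> of_int ` {- int D..int D}" by (auto intro!: imageI simp: abs_le_iff)
    then show "key v \<in> (of_int ` {- int D..int D}) \<times> (PiE {..<m} (\<lambda>_. {0..<L}))"
      using L by (auto simp: key_def PiE_iff)
  qed
  moreover have "finite \<dots>" by (intro finite_cartesian_product finite_imageI finite_PiE) auto
  ultimately have "finite (key ` V)" by (rule finite_subset)
  then obtain v where v: "v \<in> V" "infinite {a \<in> V. key a = key v}"
    using pigeonhole_infinite[OF \<open>infinite V\<close>] by blast
  have "\<not> {a \<in> V. key a = key v} \<subseteq> {v}" using v(2) by (metis finite.emptyI finite_insert finite_subset)
  then obtain w where w: "w \<in> V" "key w = key v" "w \<noteq> v" by blast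
  obtain n where n: "nrm v = of_int n" "n \<noteq> 0" "\<bar>n\<bar> \<le> int D" using nrm[OF v(1)] by blast
  have "n dvd fact D"
  proof -
    have "nat \<bar>n\<bar> dvd fact D" using n(2,3) by (intro dvd_fact) auto
    then have "int (nat \<bar>n\<bar>) dvd int (fact D)" by (simp only: int_dvd_int_iff)
    then show ?thesis by simp
  qed
  then obtain l where l: "fact D = n * l" ..
  have cdiv: "c v k - c w k = L * ((c v k - c w k) div L)" if k: "k < m" for k
  proof -
    have "restrict (\<lambda>k. c v k mod L) {..<m} k = restrict (\<lambda>k. c w k mod L) {..<m} k"
      using w(2) by (simp add: key_def)
    then have "c v k mod L = c w k mod L" using k by simp
    then have "L dvd c v k - c w k" by (simp add: mod_eq_dvd_iff)
    then show ?thesis by simp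
  qed
  define d where "d t = of_int l * (\<Sum>k<m. of_int ((c v k - c w k) div L) * zeta m ^ (k * t))" for t
  have diff: "\<Phi> v t - \<Phi> w t = of_int (int M * n) * d t" for t
  proof -
    have "\<Phi> v t - \<Phi> w t = (\<Sum>k<m. of_int (c v k - c w k) * zeta m ^ (k * t))"
      by (simp add: c v(1) w(1) sum_subtractf left_diff_distrib)
    also have "\<dots> = (\<Sum>k<m. of_int (L * ((c v k - c w k) div L)) * zeta m ^ (k * t))"
      using cdiv by (intro sum.cong) auto
    also have "\<dots> = of_int L * (\<Sum>k<m. of_int ((c v k - c w k) div L) * zeta m ^ (k * t))"
      by (simp add: sum_distrib_left mult.assoc)
    also have "of_int L = (of_int (int M * n) * of_int l :: complex)"
    proof -
      have "L = int M * n * l" by (simp add: L_def l)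
      then show ?thesis by simp
    qed
    finally show ?thesis by (simp add: d_def mult.assoc)
  qed
  have gv: "good C (\<Phi> v)" and gw: "good C (\<Phi> w)" using \<Phi>(1) v(1) w(1) by auto
  have d_cyc: "d \<in> cyc m" unfolding d_def[abs_def] by (intro cyc_mult cyc_of_int cyc_of_coeffs)
  have "of_int (int M * n) * d (r * t) = of_int (int M * n) * d t" for t
  proof -
    have "\<Phi> v (r * t) - \<Phi> w (r * t) = \<Phi> v t - \<Phi> w t" using gv gw by (simp add: good_def)
    then show ?thesis unfolding diff .
  qed
  then have d_r: "d (r * t) = d t" for t using e(2) n(2) by simp
  obtain F G where FG: "F \<in> cyc m" "G \<in> cyc m" "\<And>t. F t * G t = 1" "\<And>t. F (r * t) = F t"
    "F 1 = \<Phi> v 1 / \<Phi> w 1"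
  proof (rule cyc_unit_of_congruent_pair[OF m1 r, of "\<Phi> v" "\<Phi> w" d n e "int M"])
    show "prod (\<Phi> v) ?U = of_int n" using n(1) by (simp add: nrm_def)
    show "prod (\<Phi> w) ?U = of_int n" using n(1) w(2) by (simp add: nrm_def key_def)
  qed (use gv gw d_cyc d_r e diff in \<open>auto simp: good_def\<close>)
  have "cmod (F 1) = v / w" unfolding FG(5) norm_divide \<Phi>(2)[OF v(1)] \<Phi>(2)[OF w(1)] ..
  moreover have "w \<noteq> 0" using \<Phi>(2)[OF w(1)] gw one by (auto simp: good_def)
  ultimately have "cmod (F 1) \<noteq> 1" using w(3) by auto
  with FG that show ?thesis by blast
qed

text \<open>The sum over all characters is m times the coefficient at the identity. This
  divisibility later excludes nontrivial idempotents.\<close>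

lemma cyc_sum_dvd:
  assumes "m > 0" "F \<in> cyc m"
  obtains k :: int where "(\<Sum>t<m. F t) = of_nat m * of_int k"
proof -
  have "\<exists>k::int. (\<Sum>t<m. F t) = of_nat m * of_int k"
    using assms(2)
  proof induction
    case (mono k)
    show ?case by (intro exI[of _ "if m dvd k then 1 else 0"]) (simp add: sum_zeta[OF assms(1)])
  next
    case (diff F G)
    then obtain k l :: int where "(\<Sum>t<m. F t) = of_nat m * of_int k" "(\<Sum>t<m. G t) = of_nat m * of_int l"
      by blast
    then show ?case
      by (intro exI[of _ "k - l"]) (simp add: sum_subtractf right_diff_distrib)
  qed
  then show ?thesis using that by blast
qed

text \<open>In an ordered group the product of the two highest terms cannot cancel, nor can that of
  the two lowest. Both must sit in degree 0, which forces highest and lowest degree to coincide in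
  each factor.\<close>

lemma poly_mapping_mult_eq_1:
  fixes p q :: "'a :: linordered_ab_group_add \<Rightarrow>\<^sub>0 'b :: idom"
  assumes "p * q = 1"
  obtains k c c' where "p = single k c" "q = single (- k) c'" "c * c' = 1"
proof -
  have ne: "keys p \<noteq> {}" "keys q \<noteq> {}" using assms by auto
  have expand: "r = (\<Sum>k\<in>keys r. single k (lookup r k))"
    for r :: "'a \<Rightarrow>\<^sub>0 'b"
    by (rule poly_mapping_eqI)
       (auto simp: lookup_sum lookup_single when_def in_keys_iff)
  have prod: "p * q = (\<Sum>k\<in>keys p. \<Sum>l\<in>keys q.
      single (k + l) (lookup p k * lookup q l))"
    by (subst (1) expand[of p], subst (1) expand[of q]) (simp add: sum_product mult_single)
  have extreme: "a + b = 0"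
    if ab: "a \<in> keys p" "b \<in> keys q"
      and uniq: "\<And>k l. k \<in> keys p \<Longrightarrow> l \<in> keys q \<Longrightarrow> k + l = a + b \<Longrightarrow> k = a \<and> l = b"
    for a b
  proof -
    have "lookup (p * q) (a + b) = (\<Sum>k\<in>keys p. \<Sum>l\<in>keys q.
        if k = a then (if l = b then lookup p a * lookup q b else 0) else 0)"
      unfolding prod lookup_sum
      by (intro sum.cong HOL.refl) (use uniq in \<open>auto simp: lookup_single when_def\<close>)
    also have "\<dots> = (\<Sum>k\<in>keys p. if k = a then
        (\<Sum>l\<in>keys q. if l = b then lookup p a * lookup q b else 0) else 0)"
      by (intro sum.cong) auto
    also have "\<dots> = lookup p a * lookup q b"
      using ab by simp
    finally have "lookup (p * q) (a + b) \<noteq> 0" using ab by (simp add: in_keys_iff)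
    then show ?thesis by (simp add: assms lookup_one when_def split: if_splits)
  qed
  let ?P = "keys p" and ?Q = "keys q"
  have max: "Max ?P + Max ?Q = 0"
  proof (rule extreme)
    fix k l assume kl: "k \<in> ?P" "l \<in> ?Q" "k + l = Max ?P + Max ?Q"
    then have "k \<le> Max ?P" "l \<le> Max ?Q" by simp_all
    with kl(3) show "k = Max ?P \<and> l = Max ?Q"
      by (metis add_le_less_mono add_left_cancel add_less_le_mono less_irrefl order_le_less)
  qed (use ne in auto)
  have min: "Min ?P + Min ?Q = 0"
  proof (rule extreme)
    fix k l assume kl: "k \<in> ?P" "l \<in> ?Q" "k + l = Min ?P + Min ?Q"
    then have "Min ?P \<le> k" "Min ?Q \<le> l" by simp_all
    with kl(3) show "k = Min ?P \<and> l = Min ?Q"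
      by (metis add_le_less_mono add_left_cancel add_less_le_mono less_irrefl order_le_less)
  qed (use ne in auto)
  have le: "Min ?P \<le> Max ?P" "Min ?Q \<le> Max ?Q" using ne by simp_all
  then have eq: "Min ?P = Max ?P" "Min ?Q = Max ?Q"
    using max min by (metis add_le_less_mono add_less_le_mono less_irrefl order_le_less)+
  have P: "?P = {Max ?P}"
  proof (rule equalityI)
    show "?P \<subseteq> {Max ?P}" using eq(1) by (metis Max.coboundedI Min.coboundedI finite_keys insertCI order_antisym subsetI)
  qed (use ne in auto)
  have Q: "?Q = {- Max ?P}"
  proof -
    have "?Q = {Max ?Q}"
    proof (rule equalityI)
      show "?Q \<subseteq> {Max ?Q}" using eq(2) by (metis Max.coboundedI Min.coboundedI finite_keys insertCI order_antisym subsetI)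
    qed (use ne in auto)
    moreover have "Max ?Q = - Max ?P" using max by (simp add: add_eq_0_iff)
    ultimately show ?thesis by simp
  qed
  define k where "k = Max ?P"
  have p: "p = single k (lookup p k)"
    by (subst expand, subst P) (simp add: k_def)
  have q: "q = single (- k) (lookup q (- k))"
    by (subst expand, subst Q) (simp add: k_def)
  have "lookup p k * lookup q (- k) = lookup (p * q) 0"
    by (subst (2) p, subst (2) q) (simp add: mult_single)
  also have "\<dots> = 1" by (simp add: assms)
  finally show ?thesis using that[OF p q] by simp
qed

section \<open>Central units of integral group rings\<close>

lemma carrier_group_ring: "carrier (group_ring G) = {c. keys c \<subseteq> carrier G}"
  by (simp add: group_ring_def free_Abelian_group_def)

lemma one_group_ring: "\<one>\<^bsub>group_ring G\<^esub> = frag_of \<one>\<^bsub>G\<^esub>"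
  by (simp add: group_ring_def)

abbreviation group_ring_mult ::
    "('a, 'b) monoid_scheme \<Rightarrow> ('a \<Rightarrow>\<^sub>0 int) \<Rightarrow> ('a \<Rightarrow>\<^sub>0 int) \<Rightarrow> 'a \<Rightarrow>\<^sub>0 int" (infixl "\<star>\<index>" 70)
  where "group_ring_mult G p q \<equiv> p \<otimes>\<^bsub>group_ring G\<^esub> q"

context
  fixes G :: "('a, 'b) monoid_scheme" (structure)
begin

lemma group_ring_mult_of: "frag_of g \<star> frag_of h = frag_of (g \<otimes>\<^bsub>G\<^esub> h)"
  by (simp add: group_ring_def)

lemma group_ring_mult_diff_left:
  "(p - p') \<star> q = p \<star> q - p' \<star> q"
  by (simp add: group_ring_def frag_extend_diff)

lemma group_ring_mult_diff_right:
  "p \<star> (q - q') = p \<star> q - p \<star> q'"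
proof -
  have "p \<star> (x + y) = p \<star> x + p \<star> y" for x y
    by (simp add: group_ring_def frag_extend_add frag_extend_add_fun)
  from this[of "q - q'" q'] show ?thesis by (simp add: algebra_simps)
qed

lemma group_ring_mult_zero:
  "0 \<star> p = 0" "p \<star> 0 = 0"
  using group_ring_mult_diff_left[where p = 0 and p' = 0] group_ring_mult_diff_right[where q = 0 and q' = 0]
  by (metis diff_self)+

lemma group_ring_mult_minus:
  "(- p) \<star> q = - (p \<star> q)" "p \<star> (- q) = - (p \<star> q)"
  using group_ring_mult_diff_left[where p = 0] group_ring_mult_diff_right[where q = 0]
  by (metis diff_0 group_ring_mult_zero)+

lemma group_ring_mult_sum_left:
  "(\<Sum>i\<in>I. f i) \<star> q = (\<Sum>i\<in>I. f i \<star> q)"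
proof (induction I rule: infinite_finite_induct)
  case (insert i I)
  have "(f i + sum f I) \<star> q = (f i - (- sum f I)) \<star> q" by simp
  also have "\<dots> = f i \<star> q + sum f I \<star> q"
    by (simp only: group_ring_mult_diff_left group_ring_mult_minus) simp
  finally show ?case using insert by simp
qed (simp_all add: group_ring_mult_zero)

lemma group_ring_mult_sum_right:
  "q \<star> (\<Sum>i\<in>I. f i) = (\<Sum>i\<in>I. q \<star> f i)"
proof (induction I rule: infinite_finite_induct)
  case (insert i I)
  have "q \<star> (f i + sum f I) = q \<star> (f i - (- sum f I))" by simp
  also have "\<dots> = q \<star> f i + q \<star> sum f I"
    by (simp only: group_ring_mult_diff_right group_ring_mult_minus) simp
  finally show ?case using insert by simp
qed (simp_all add: group_ring_mult_zero)

lemma group_ring_mult_cmul: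
  "frag_cmul c p \<star> q = frag_cmul c (p \<star> q)"
  "q \<star> frag_cmul c p = frag_cmul c (q \<star> p)"
proof -
  show "frag_cmul c p \<star> q = frag_cmul c (p \<star> q)"
    by (simp add: group_ring_def frag_extend_cmul)
  show "q \<star> frag_cmul c p = frag_cmul c (q \<star> p)"
    by (simp add: group_ring_def frag_extend_cmul)
       (simp add: frag_extend_def frag_cmul_sum mult_ac)
qed

end

text \<open>Unlike \<open>frag_extend\<close>, the values lie in an arbitrary commutative ring;
  Laurent polynomials over the complex numbers or the integers are used.\<close>

definition lin_ext :: "('a \<Rightarrow> 's) \<Rightarrow> ('a \<Rightarrow>\<^sub>0 int) \<Rightarrow> 's :: comm_ring_1" where
  "lin_ext \<alpha> p = (\<Sum>g\<in>keys p. of_int (lookup p g) * \<alpha> g)"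

lemma lin_ext_superset:
  assumes "finite S" "keys p \<subseteq> S"
  shows "lin_ext \<alpha> p = (\<Sum>g\<in>S. of_int (lookup p g) * \<alpha> g)"
  unfolding lin_ext_def using assms by (intro sum.mono_neutral_left) (auto simp: in_keys_iff)

lemma lin_ext_diff: "lin_ext \<alpha> (p - q) = lin_ext \<alpha> p - lin_ext \<alpha> q"
proof -
  let ?S = "keys p \<union> keys q"
  have "lin_ext \<alpha> (p - q) = (\<Sum>g\<in>?S. of_int (lookup (p - q) g) * \<alpha> g)"
    using keys_diff[of p q] by (intro lin_ext_superset) auto
  also have "\<dots> = lin_ext \<alpha> p - lin_ext \<alpha> q"
    using lin_ext_superset[of ?S p \<alpha>] lin_ext_superset[of ?S q \<alpha>]
    by (simp add: lookup_minus left_diff_distrib sum_subtractf)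
  finally show ?thesis .
qed

lemma lin_ext_0 [simp]: "lin_ext \<alpha> 0 = 0"
  by (simp add: lin_ext_def)

lemma lin_ext_minus: "lin_ext \<alpha> (- p) = - lin_ext \<alpha> p"
  using lin_ext_diff[of \<alpha> 0 p] by simp

lemma lin_ext_add: "lin_ext \<alpha> (p + q) = lin_ext \<alpha> p + lin_ext \<alpha> q"
  using lin_ext_diff[of \<alpha> p "- q"] by (simp add: lin_ext_minus)

lemma lin_ext_of [simp]: "lin_ext \<alpha> (frag_of g) = \<alpha> g"
  by (simp add: lin_ext_def)

lemma lin_ext_cmul: "lin_ext \<alpha> (frag_cmul c p) = of_int c * lin_ext \<alpha> p"
  using lin_ext_superset[OF finite_keys keys_cmul, of \<alpha> c p]
  by (simp add: lin_ext_def sum_distrib_left mult.assoc)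

lemma lin_ext_sum: "lin_ext \<alpha> (\<Sum>i\<in>I. f i) = (\<Sum>i\<in>I. lin_ext \<alpha> (f i))"
  by (induction I rule: infinite_finite_induct) (simp_all add: lin_ext_add)

context group
begin

lemma group_ring_commute_all:
  assumes "p \<in> carrier (group_ring G)"
    and "\<And>g. g \<in> carrier G \<Longrightarrow> frag_of g \<star> q = q \<star> frag_of g"
  shows "p \<star> q = q \<star> p"
proof -
  have "keys p \<subseteq> carrier G" using assms(1) by (simp add: carrier_group_ring)
  then show ?thesis
    by (induction p rule: frag_induction)
       (simp_all add: group_ring_mult_zero group_ring_mult_diff_left group_ring_mult_diff_right assms(2))
qed

lemma frag_of_Units:
  assumes "g \<in> carrier G"
  shows "frag_of g \<in> Units (group_ring G)" "- frag_of g \<in> Units (group_ring G)"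
proof -
  have "frag_of (inv g) \<star> frag_of g = \<one>\<^bsub>group_ring G\<^esub>"
    "frag_of g \<star> frag_of (inv g) = \<one>\<^bsub>group_ring G\<^esub>"
    using assms by (simp_all add: group_ring_mult_of one_group_ring)
  note inverse = this
  show "frag_of g \<in> Units (group_ring G)"
    unfolding Units_def using assms inverse
    by (auto simp: carrier_group_ring intro!: exI[of _ "frag_of (inv g)"])
  show "- frag_of g \<in> Units (group_ring G)"
    unfolding Units_def using assms inverse
    by (auto simp: carrier_group_ring group_ring_mult_minus intro!: exI[of _ "- frag_of (inv g)"])
qed

text \<open>Group elements are units and span the ring, so commuting with all units means commuting
  with them. Since g is central in G as soon as \<open>frag_of g\<close> or its negative is a
  central unit, membership of g in the center need not be demanded separately.\<close>

lemma cut_group_iff: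
  "cut_group G \<longleftrightarrow> (\<forall>u\<in>Units (group_ring G).
     (\<forall>g\<in>carrier G. frag_of g \<star> u = u \<star> frag_of g) \<longrightarrow>
     (\<exists>g\<in>carrier G. u = frag_of g \<or> u = - frag_of g))"
  (is "_ \<longleftrightarrow> ?R")
proof -
  let ?Z = "group_ring G"
  have mem: "u \<in> center (units_of ?Z) \<longleftrightarrow>
      u \<in> Units ?Z \<and> (\<forall>g\<in>carrier G. frag_of g \<star> u = u \<star> frag_of g)" for u
  proof
    assume "u \<in> center (units_of ?Z)"
    then show "u \<in> Units ?Z \<and> (\<forall>g\<in>carrier G. frag_of g \<star> u = u \<star> frag_of g)"
      using frag_of_Units(1) by (auto simp: center_def units_of_carrier units_of_mult)
  next
    assume u: "u \<in> Units ?Z \<and> (\<forall>g\<in>carrier G. frag_of g \<star> u = u \<star> frag_of g)"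
    have "p \<star> u = u \<star> p" if "p \<in> Units ?Z" for p
    proof (rule group_ring_commute_all)
      show "p \<in> carrier ?Z" using that by (simp add: Units_def)
    qed (use u in blast)
    with u show "u \<in> center (units_of ?Z)"
      by (auto simp: center_def units_of_carrier units_of_mult)
  qed
  have of_iff: "frag_of g \<in> center (units_of ?Z) \<longleftrightarrow> g \<in> center G"
    and minus_iff: "- frag_of g \<in> center (units_of ?Z) \<longleftrightarrow> g \<in> center G" if "g \<in> carrier G" for g
    unfolding mem using that frag_of_Units[OF that]
    by (auto simp: center_def group_ring_mult_of group_ring_mult_minus frag_of_eq)
  have "center G \<subseteq> carrier G" by (auto simp: center_def)
  then have sub: "frag_of ` center G \<union> (\<lambda>g. - frag_of g) ` center G \<subseteq> center (units_of ?Z)"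
    using of_iff minus_iff by blast
  show ?thesis
  proof
    assume "cut_group G"
    then have "center (units_of ?Z) = frag_of ` center G \<union> (\<lambda>g. - frag_of g) ` center G"
      by (simp add: cut_group_def)
    then show ?R using mem \<open>center G \<subseteq> carrier G\<close> by blast
  next
    assume R: ?R
    have "center (units_of ?Z) \<subseteq> frag_of ` center G \<union> (\<lambda>g. - frag_of g) ` center G"
    proof
      fix u assume u: "u \<in> center (units_of ?Z)"
      then obtain g where "g \<in> carrier G" "u = frag_of g \<or> u = - frag_of g" using R mem by blast
      then show "u \<in> frag_of ` center G \<union> (\<lambda>g. - frag_of g) ` center G"
        using u of_iff minus_iff by blast
    qed
    with sub show "cut_group G" by (auto simp: cut_group_def)
  qed
qed

lemma lookup_frag_of_mult:
  assumes "keys p \<subseteq> carrier G" "g \<in> carrier G" "h \<in> carrier G"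
  shows "lookup (frag_of g \<star> p) (g \<otimes> h) = lookup p h"
    and "lookup (p \<star> frag_of g) (h \<otimes> g) = lookup p h"
  using assms(1)
  by (induction p rule: frag_induction)
     (use assms(2,3) in \<open>auto simp: group_ring_mult_zero group_ring_mult_diff_left
        group_ring_mult_diff_right group_ring_mult_of lookup_minus\<close>)

text \<open>Coefficients of a central element are constant on conjugacy classes; the conjugacy of h
  and h' is written without inverses.\<close>

lemma lookup_conjugate:
  assumes "keys u \<subseteq> carrier G" "g \<in> carrier G" "h \<in> carrier G" "h' \<in> carrier G"
    and "frag_of g \<star> u = u \<star> frag_of g" "g \<otimes> h = h' \<otimes> g"
  shows "lookup u h = lookup u h'"
  using lookup_frag_of_mult(1)[OF assms(1,2,3)] lookup_frag_of_mult(2)[OF assms(1,2,4)] assms(5,6)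
  by simp

text \<open>
  A map of \<open>G\<close> into a commutative ring that is only multiplicative along a factorization
  \<open>g = x y\<close> becomes multiplicative when the second factor is central.
\<close>

lemma lin_ext_mult:
  fixes \<alpha> :: "'a \<Rightarrow> 's :: comm_ring_1"
  assumes "keys p \<subseteq> carrier G" "keys q \<subseteq> carrier G"
    and comm: "\<And>g. g \<in> carrier G \<Longrightarrow> frag_of g \<star> q = q \<star> frag_of g"
    and fact: "\<And>g. g \<in> carrier G \<Longrightarrow> \<exists>x\<in>carrier G. \<exists>y\<in>carrier G. g = x \<otimes> y \<and>
      (\<forall>h\<in>carrier G. \<alpha> (x \<otimes> h) = \<alpha> x * \<alpha> h) \<and> (\<forall>h\<in>carrier G. \<alpha> (h \<otimes> y) = \<alpha> h * \<alpha> y)"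
  shows "lin_ext \<alpha> (p \<star> q) = lin_ext \<alpha> p * lin_ext \<alpha> q"
proof -
  interpret Z: ring "group_ring G" by (rule ring_group_ring) (rule is_group)
  have left: "lin_ext \<alpha> (frag_of x \<star> r) = \<alpha> x * lin_ext \<alpha> r"
    if "\<forall>h\<in>carrier G. \<alpha> (x \<otimes> h) = \<alpha> x * \<alpha> h" "keys r \<subseteq> carrier G" for x r
    using that(2) by (induction r rule: frag_induction)
      (use that(1) in \<open>auto simp: group_ring_mult_zero group_ring_mult_diff_right group_ring_mult_of
        lin_ext_diff right_diff_distrib\<close>)
  have right: "lin_ext \<alpha> (r \<star> frag_of y) = lin_ext \<alpha> r * \<alpha> y"
    if "\<forall>h\<in>carrier G. \<alpha> (h \<otimes> y) = \<alpha> h * \<alpha> y" "keys r \<subseteq> carrier G" for y r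
    using that(2) by (induction r rule: frag_induction)
      (use that(1) in \<open>auto simp: group_ring_mult_zero group_ring_mult_diff_left group_ring_mult_of
        lin_ext_diff left_diff_distrib\<close>)
  have q: "q \<in> carrier (group_ring G)" using assms(2) by (simp add: carrier_group_ring)
  have main: "lin_ext \<alpha> (frag_of g \<star> q) = \<alpha> g * lin_ext \<alpha> q" if g: "g \<in> carrier G" for g
  proof -
    obtain x y where xy: "x \<in> carrier G" "y \<in> carrier G" "g = x \<otimes> y"
      and x: "\<forall>h\<in>carrier G. \<alpha> (x \<otimes> h) = \<alpha> x * \<alpha> h" and y: "\<forall>h\<in>carrier G. \<alpha> (h \<otimes> y) = \<alpha> h * \<alpha> y"
      using fact[OF g] by blast
    have xy': "frag_of x \<in> carrier (group_ring G)" "frag_of y \<in> carrier (group_ring G)"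
      using xy by (simp_all add: carrier_group_ring)
    \<comment> \<open>Centrality of q carries y across to the right end, where it can be split
      off.\<close>
    have "frag_of g \<star> q = frag_of x \<star> (q \<star> frag_of y)"
      using comm[OF xy(2)] Z.m_assoc[OF xy' q] by (simp add: xy(3) group_ring_mult_of[symmetric])
    moreover have "q \<star> frag_of y \<in> carrier (group_ring G)"
      using xy' q by simp
    ultimately have "lin_ext \<alpha> (frag_of g \<star> q) = \<alpha> x * (lin_ext \<alpha> q * \<alpha> y)"
      using left[OF x, of "q \<star> frag_of y"] right[OF y assms(2)]
      by (simp add: carrier_group_ring)
    moreover have "\<alpha> g = \<alpha> x * \<alpha> y" using x xy by blast
    ultimately show ?thesis by (simp add: mult_ac)
  qed
  show ?thesis
    using assms(1) by (induction p rule: frag_induction)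
      (auto simp: main group_ring_mult_zero group_ring_mult_diff_left lin_ext_diff left_diff_distrib)
qed

lemma commute_generated:
  assumes u: "u \<in> carrier (group_ring G)" and ab: "a \<in> carrier G" "b \<in> carrier G"
    and gen: "carrier G = {a [^] (k::int) \<otimes> b [^] (j::int) | k j. True}"
    and comm: "frag_of a \<star> u = u \<star> frag_of a"
      "frag_of b \<star> u = u \<star> frag_of b"
    and g: "g \<in> carrier G"
  shows "frag_of g \<star> u = u \<star> frag_of g"
proof -
  interpret Z: ring "group_ring G" by (rule ring_group_ring) (rule is_group)
  let ?S = "{g \<in> carrier G. frag_of g \<star> u = u \<star> frag_of g}"
  have fc: "frag_of g \<in> carrier (group_ring G)" if "g \<in> carrier G" for g
    using that by (simp add: carrier_group_ring)
  have sub: "subgroup ?S G"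
  proof (rule subgroupI)
    have "\<one> \<in> ?S" using u by (simp add: one_group_ring[symmetric])
    then show "?S \<noteq> {}" by blast
  next
    fix g assume g: "g \<in> ?S"
    then have gi: "frag_of (inv g) \<star> frag_of g = \<one>\<^bsub>group_ring G\<^esub>"
      "frag_of g \<star> frag_of (inv g) = \<one>\<^bsub>group_ring G\<^esub>"
      by (simp_all add: group_ring_mult_of one_group_ring)
    have g': "frag_of g \<in> carrier (group_ring G)" "frag_of (inv g) \<in> carrier (group_ring G)"
      using g fc by simp_all
    have "frag_of (inv g) \<star> u =
        frag_of (inv g) \<star> (u \<star> (frag_of g \<star> frag_of (inv g)))"
      using gi u by simp
    also have "\<dots> = frag_of (inv g) \<star> ((frag_of g \<star> u) \<star> frag_of (inv g))"
      using g g' u by (simp add: Z.m_assoc)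
    also have "\<dots> = u \<star> frag_of (inv g)"
      using g' u gi by (simp add: Z.m_assoc[symmetric])
    finally show "inv g \<in> ?S" using g by simp
  next
    fix g h assume gh: "g \<in> ?S" "h \<in> ?S"
    then have gh': "frag_of g \<in> carrier (group_ring G)" "frag_of h \<in> carrier (group_ring G)"
      using fc by simp_all
    have "frag_of g \<star> frag_of h \<star> u =
        frag_of g \<star> (u \<star> frag_of h)"
      using gh gh' u by (simp add: Z.m_assoc)
    also have "\<dots> = frag_of g \<star> u \<star> frag_of h"
      using gh' u by (simp add: Z.m_assoc)
    also have "\<dots> = u \<star> frag_of g \<star> frag_of h"
      using gh by simp
    also have "\<dots> = u \<star> (frag_of g \<star> frag_of h)"
      using gh' u by (simp add: Z.m_assoc)
    finally have "frag_of g \<star> frag_of h \<star> u =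
        u \<star> (frag_of g \<star> frag_of h)" .
    then show "g \<otimes> h \<in> ?S" using gh by (simp add: group_ring_mult_of)
  qed auto
  have "a \<in> ?S" "b \<in> ?S" using ab comm by auto
  then have "a [^] (k::int) \<otimes> b [^] (j::int) \<in> ?S" for k j
    using sub by (intro subgroup.m_closed[OF sub] subgroup_int_pow_closed)
  then show ?thesis using g gen by auto
qed

end

section \<open>Fourier transform of a graded group ring\<close>

lemma zeta_powi_cong:
  assumes "m > 0" "int m dvd k - l"
  shows "zeta m powi k = zeta m powi l"
proof -
  obtain q where q: "k = l + int m * q" using assms(2) by (metis add.commute diff_add_cancel dvdE)
  have "zeta m powi (int m * q) = (zeta m ^ m) powi q"
    by (simp add: power_int_mult)
  also have "\<dots> = 1" by (simp add: zeta_pow_order[OF assms(1)])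
  finally show ?thesis by (simp add: q power_int_add)
qed

text \<open>Elements are indexed by a degree i in Z and a class l modulo m, and
  \<open>\<alpha> t\<close> applies the t-th character of C_m within each degree. When a has finite
  order, i is the exponent of b and l that of a; in the other family the roles are
  exchanged.\<close>

locale graded_character =
  fixes S :: "'a set" and m :: nat and e :: "int \<Rightarrow> nat \<Rightarrow> 'a" and \<alpha> :: "nat \<Rightarrow> 'a \<Rightarrow> (int \<Rightarrow>\<^sub>0 complex)"
  assumes m_pos: "m > 0"
    and cover: "g \<in> S \<Longrightarrow> \<exists>i l. l < m \<and> g = e i l"
    and inj: "l < m \<Longrightarrow> l' < m \<Longrightarrow> e i l = e i' l' \<Longrightarrow> i = i' \<and> l = l'"
    and \<alpha>_e: "l < m \<Longrightarrow> \<alpha> t (e i l) = single i (zeta m ^ (l * t))"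
begin

definition component :: "('a \<Rightarrow>\<^sub>0 int) \<Rightarrow> int \<Rightarrow> nat \<Rightarrow> complex" where
  "component p i t = (\<Sum>l<m. of_int (lookup p (e i l)) * zeta m ^ (l * t))"

lemma component_cyc: "component p i \<in> cyc m"
  unfolding component_def[abs_def] using cyc_of_coeffs[of _ m "\<lambda>l. l"] by simp

lemma lookup_lin_ext:
  assumes "keys p \<subseteq> S"
  shows "lookup (lin_ext (\<alpha> t) p) i = component p i t"
  using assms
proof (induction p rule: frag_induction)
  case (one g)
  then obtain i' l where g: "l < m" "g = e i' l" using cover by blast
  have "component (frag_of g) i t = (\<Sum>k<m. if k = l then (if i' = i then zeta m ^ (l * t) else 0) else 0)"
    unfolding component_def
    by (rule sum.cong) (use g inj in \<open>auto split: if_splits\<close>)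
  also have "\<dots> = (if i' = i then zeta m ^ (l * t) else 0)" using g(1) by simp
  finally show ?case by (simp add: g \<alpha>_e lookup_single when_def)
qed (simp_all add: component_def lin_ext_diff lookup_minus left_diff_distrib sum_subtractf)

lemma eq_if_components_eq:
  assumes "keys p \<subseteq> S" "keys q \<subseteq> S"
    and "\<And>i t. component p i t = component q i t"
  shows "p = q"
proof (rule poly_mapping_eqI)
  fix g
  show "lookup p g = lookup q g"
  proof (cases "g \<in> S")
    case True
    then obtain i l where g: "l < m" "g = e i l" using cover by blast
    have "of_nat m * of_int (lookup p g) = (\<Sum>t<m. component p i t * zeta m ^ ((m - l) * t))"
      unfolding g(2) by (rule fourier_inversion[OF m_pos _ g(1), symmetric]) (simp add: component_def)
    also have "\<dots> = (\<Sum>t<m. component q i t * zeta m ^ ((m - l) * t))"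
      by (simp add: assms(3))
    also have "\<dots> = of_nat m * of_int (lookup q g)"
      unfolding g(2) by (rule fourier_inversion[OF m_pos _ g(1)]) (simp add: component_def)
    finally show ?thesis using m_pos by simp
  next
    case False
    then show ?thesis using assms(1,2) by (metis in_keys_iff subsetD)
  qed
qed

lemma lin_ext_inject:
  assumes "keys p \<subseteq> S" "keys q \<subseteq> S"
    and "\<And>t. lin_ext (\<alpha> t) p = lin_ext (\<alpha> t) q"
  shows "p = q"
  using assms by (intro eq_if_components_eq) (auto simp: lookup_lin_ext[symmetric])

end

lemma (in group) central_unit_inverse:
  assumes "u \<in> Units (group_ring G)"
    and "\<And>g. g \<in> carrier G \<Longrightarrow> frag_of g \<star> u = u \<star> frag_of g"
  obtains v where "v \<in> carrier (group_ring G)" "u \<star> v = frag_of \<one>"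
    "\<And>g. g \<in> carrier G \<Longrightarrow> frag_of g \<star> v = v \<star> frag_of g"
proof -
  interpret Z: ring "group_ring G" by (rule ring_group_ring) (rule is_group)
  obtain v where v: "v \<in> carrier (group_ring G)" "u \<star> v = \<one>\<^bsub>group_ring G\<^esub>"
    "v \<star> u = \<one>\<^bsub>group_ring G\<^esub>"
    using assms(1) by (auto simp: Units_def)
  have u: "u \<in> carrier (group_ring G)" using assms(1) by (rule Z.Units_closed)
  have "frag_of g \<star> v = v \<star> frag_of g" if g: "g \<in> carrier G" for g
  proof -
    have g': "frag_of g \<in> carrier (group_ring G)" using g by (simp add: carrier_group_ring)
    have "frag_of g \<star> v = (v \<star> u) \<star> (frag_of g \<star> v)"
      using v g' by simp
    also have "\<dots> = v \<star> (u \<star> frag_of g) \<star> v"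
      using v(1) u g' by (simp add: Z.m_assoc)
    also have "\<dots> = v \<star> (frag_of g \<star> u) \<star> v"
      using assms(2)[OF g] by simp
    also have "\<dots> = v \<star> frag_of g \<star> (u \<star> v)"
      using v(1) u g' by (simp add: Z.m_assoc)
    finally show ?thesis using v g' by simp
  qed
  with v that show ?thesis by (simp add: one_group_ring)
qed

section \<open>Normal forms\<close>

lemma (in group) conj_int_pow:
  assumes "a \<in> carrier G" "b \<in> carrier G" "b \<otimes> a = a [^] (r::int) \<otimes> b"
  shows "b \<otimes> a [^] (k::int) = a [^] (r * k) \<otimes> b"
proof -
  have conj: "(\<lambda>x. b \<otimes> x \<otimes> inv b) \<in> hom G G"
  proof (rule homI)
    fix x y assume "x \<in> carrier G" "y \<in> carrier G"
    then show "b \<otimes> (x \<otimes> y) \<otimes> inv b = b \<otimes> x \<otimes> inv b \<otimes> (b \<otimes> y \<otimes> inv b)"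
      using assms(2) by (simp add: m_assoc) (simp add: m_assoc[symmetric])
  qed (use assms(2) in simp)
  interpret h: group_hom G G "\<lambda>x. b \<otimes> x \<otimes> inv b"
    by (rule group_hom.intro) (simp_all add: group_hom_axioms_def conj is_group)
  have "b \<otimes> a \<otimes> inv b = a [^] r" using assms by (simp add: m_assoc)
  then have "b \<otimes> a [^] k \<otimes> inv b = (a [^] r) [^] k"
    using h.hom_int_pow[of a k] assms(1) by simp
  then have "b \<otimes> a [^] k \<otimes> inv b \<otimes> b = a [^] (r * k) \<otimes> b"
    using assms(1) by (simp add: int_pow_pow)
  then show ?thesis using assms by (simp add: m_assoc)
qed

text \<open>Infinite order is encoded by 0, since \<open>0 dvd k\<close> means k = 0. Besides the
  orders m of a and n of b, \<open>trivial_iff\<close> expresses that the two cyclic subgroups meet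
  trivially.\<close>

locale normal_form = group G for G (structure) +
  fixes a b :: 'a and m n :: nat and r :: int
  assumes a_closed [simp]: "a \<in> carrier G" and b_closed [simp]: "b \<in> carrier G"
    and carrier_eq: "carrier G = {a [^] (k::int) \<otimes> b [^] (j::int) | k j. True}"
    and trivial_iff: "a [^] (k::int) \<otimes> b [^] (j::int) = \<one> \<longleftrightarrow> int m dvd k \<and> int n dvd j"
    and rel: "b \<otimes> a = a [^] r \<otimes> b"
begin

lemma eq_iff:
  "a [^] (k::int) \<otimes> b [^] (j::int) = a [^] (k'::int) \<otimes> b [^] (j'::int) \<longleftrightarrow> int m dvd k - k' \<and> int n dvd j - j'"
proof -
  have "a [^] k \<otimes> b [^] j = a [^] k' \<otimes> b [^] j' \<longleftrightarrow>
      a [^] (- k') \<otimes> (a [^] k \<otimes> b [^] j) \<otimes> b [^] (- j') = a [^] (- k') \<otimes> (a [^] k' \<otimes> b [^] j') \<otimes> b [^] (- j')"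
    by simp
  moreover have "a [^] (- k') \<otimes> (a [^] k \<otimes> b [^] j) \<otimes> b [^] (- j') = a [^] (k - k') \<otimes> b [^] (j - j')"
    for k j
  proof -
    have "a [^] (k - k') = a [^] (- k') \<otimes> a [^] k" "b [^] (j - j') = b [^] j \<otimes> b [^] (- j')"
      by (simp_all add: int_pow_mult[symmetric])
    then show ?thesis by (simp add: m_assoc)
  qed
  ultimately show ?thesis using trivial_iff[of "k - k'" "j - j'"] by simp
qed

lemma b_a_pow: "b \<otimes> a [^] (k::int) = a [^] (r * k) \<otimes> b"
  by (rule conj_int_pow[OF a_closed b_closed rel])

text \<open>\<open>A\<close> is applied to the exponent of a and \<open>B\<close> to that of b. The
  exponents picked by \<open>SOME\<close> are determined only modulo m and n, so the value is
  meaningful when \<open>A\<close> and \<open>B\<close> respect these congruences.\<close>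

definition char_of :: "(int \<Rightarrow> 's) \<Rightarrow> (int \<Rightarrow> 's) \<Rightarrow> 'a \<Rightarrow> 's :: comm_ring_1" where
  "char_of A B g = (let (k, j) = (SOME (k, j). g = a [^] (k::int) \<otimes> b [^] (j::int)) in A k * B j)"

lemma char_of_eq:
  assumes "\<And>k l. int m dvd k - l \<Longrightarrow> A k = A l" "\<And>k l. int n dvd k - l \<Longrightarrow> B k = B l"
  shows "char_of A B (a [^] (k::int) \<otimes> b [^] (j::int)) = A k * B j"
proof -
  define kj where "kj = (SOME (k', j'). a [^] k \<otimes> b [^] j = a [^] (k'::int) \<otimes> b [^] (j'::int))"
  have "case kj of (k', j') \<Rightarrow> a [^] k \<otimes> b [^] j = a [^] k' \<otimes> b [^] j'"
    unfolding kj_def by (rule someI[of _ "(k, j)"]) simp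
  then have "int m dvd k - fst kj \<and> int n dvd j - snd kj"
    by (auto simp: eq_iff split: prod.splits)
  then have "A k = A (fst kj)" "B j = B (snd kj)" using assms by blast+
  moreover have "char_of A B (a [^] k \<otimes> b [^] j) = A (fst kj) * B (snd kj)"
    by (simp add: char_of_def kj_def split_def Let_def)
  ultimately show ?thesis by simp
qed

text \<open>Multiplying by a power of a on the left or by a power of b on the right only adds
  exponents, so the splitting of g into these two powers meets the requirement of
  \<open>lin_ext_mult\<close>.\<close>

lemma lin_ext_char_of_mult:
  assumes A: "\<And>k l. int m dvd k - l \<Longrightarrow> A k = A l" "A 0 = 1" "\<And>k l. A (k + l) = A k * A l"
    and B: "\<And>k l. int n dvd k - l \<Longrightarrow> B k = B l" "B 0 = 1" "\<And>k l. B (k + l) = B k * B l"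
    and pq: "p \<in> carrier (group_ring G)" "q \<in> carrier (group_ring G)"
    and comm: "\<And>g. g \<in> carrier G \<Longrightarrow> frag_of g \<star> q = q \<star> frag_of g"
  shows "lin_ext (char_of A B) (p \<star> q) = lin_ext (char_of A B) p * lin_ext (char_of A B) q"
proof (rule lin_ext_mult[OF _ _ comm])
  note eq = char_of_eq[of A B, OF A(1) B(1)]
  fix g assume "g \<in> carrier G"
  then obtain k j :: int where g: "g = a [^] k \<otimes> b [^] j" using carrier_eq by auto
  show "\<exists>x\<in>carrier G. \<exists>y\<in>carrier G. g = x \<otimes> y \<and>
      (\<forall>h\<in>carrier G. char_of A B (x \<otimes> h) = char_of A B x * char_of A B h) \<and>
      (\<forall>h\<in>carrier G. char_of A B (h \<otimes> y) = char_of A B h * char_of A B y)"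
  proof (intro bexI conjI ballI)
    show "g = a [^] k \<otimes> b [^] j" by (rule g)
    have x: "char_of A B (a [^] k) = A k" using eq[of k 0] B(2) by simp
    have y: "char_of A B (b [^] j) = B j" using eq[of 0 j] A(2) by simp
    fix h assume "h \<in> carrier G"
    then obtain k' j' :: int where h: "h = a [^] k' \<otimes> b [^] j'" using carrier_eq by auto
    have "a [^] k \<otimes> h = a [^] (k + k') \<otimes> b [^] j'" by (simp add: h int_pow_mult[symmetric] m_assoc[symmetric])
    then show "char_of A B (a [^] k \<otimes> h) = char_of A B (a [^] k) * char_of A B h"
      by (simp add: x h eq A(3) mult_ac)
    have "h \<otimes> b [^] j = a [^] k' \<otimes> b [^] (j' + j)" by (simp add: h int_pow_mult[symmetric] m_assoc)
    then show "char_of A B (h \<otimes> b [^] j) = char_of A B h * char_of A B (b [^] j)"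
      by (simp add: y h eq B(3) mult_ac)
  qed simp_all
qed (use pq in \<open>simp_all add: carrier_group_ring\<close>)

end

section \<open>The cut property for groups in normal form\<close>

lemma poly_mapping_single_units:
  fixes p q :: "int \<Rightarrow>\<^sub>0 int \<Rightarrow>\<^sub>0 int"
  assumes "p * q = 1"
  obtains k j d where "p = single k (single j d)" "d = 1 \<or> d = -1"
proof -
  obtain k c c' where p: "p = single k c" and c: "c * c' = 1"
    using poly_mapping_mult_eq_1[OF assms] by metis
  obtain j d d' where "c = single j d" and d: "d * d' = 1"
    using poly_mapping_mult_eq_1[OF c] by metis
  moreover have "d = 1 \<or> d = -1" using d by (simp add: zmult_eq_1_iff) blast
  ultimately show ?thesis using that p by blast
qed

context normal_form
begin

lemma group_ring_unit_witness:
  assumes uv: "u \<in> carrier (group_ring G)" "v \<in> carrier (group_ring G)"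
    and comm: "frag_of a \<star> u = u \<star> frag_of a"
      "frag_of b \<star> u = u \<star> frag_of b"
    and prod: "u \<star> v = frag_of \<one>"
    and cut: "cut_group G"
  obtains g where "g \<in> carrier G" "u = frag_of g \<or> u = - frag_of g"
proof -
  have comm: "frag_of g \<star> u = u \<star> frag_of g" if "g \<in> carrier G" for g
    by (rule commute_generated[OF uv(1) a_closed b_closed carrier_eq comm that])
  then have "v \<star> u = u \<star> v"
    by (rule group_ring_commute_all[OF uv(2)])
  then have "u \<in> Units (group_ring G)"
    using uv prod by (auto simp: Units_def one_group_ring)
  then show ?thesis using cut comm that unfolding cut_group_iff by blast
qed

lemma lin_ext_central_inverse:
  assumes A: "\<And>k l. int m dvd k - l \<Longrightarrow> A k = A l" "A 0 = 1" "\<And>k l. A (k + l) = A k * A l"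
    and B: "\<And>k l. int n dvd k - l \<Longrightarrow> B k = B l" "B 0 = 1" "\<And>k l. B (k + l) = B k * B l"
    and uv: "u \<in> carrier (group_ring G)" "v \<in> carrier (group_ring G)" "u \<star> v = frag_of \<one>"
    and comm: "\<And>g. g \<in> carrier G \<Longrightarrow> frag_of g \<star> v = v \<star> frag_of g"
  shows "lin_ext (char_of A B) u * lin_ext (char_of A B) v = 1"
proof -
  have "lin_ext (char_of A B) u * lin_ext (char_of A B) v = lin_ext (char_of A B) (frag_of \<one>)"
    using lin_ext_char_of_mult[OF A B uv(1,2) comm] by (simp add: uv(3))
  also have "\<dots> = 1"
    using char_of_eq[of A B 0 0, OF A(1) B(1)] A(2) B(2) by simp
  finally show ?thesis .
qed

text \<open>Here all coefficients can be read off from one iterated Laurent polynomial over the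
  integers, and the units of that ring are the monomials with coefficient 1 or -1.\<close>

lemma cut_group_torsion_free:
  assumes "m = 0" "n = 0"
  shows "cut_group G"
  unfolding cut_group_iff
proof (intro ballI impI)
  fix u assume u: "u \<in> Units (group_ring G)"
    and comm: "\<forall>g\<in>carrier G. frag_of g \<star> u = u \<star> frag_of g"
  have uc: "u \<in> carrier (group_ring G)" using u by (simp add: Units_def)
  obtain v where v: "v \<in> carrier (group_ring G)" "u \<star> v = frag_of \<one>"
    "\<And>g. g \<in> carrier G \<Longrightarrow> frag_of g \<star> v = v \<star> frag_of g"
    using central_unit_inverse[OF u] comm by blast
  define A :: "int \<Rightarrow> int \<Rightarrow>\<^sub>0 int \<Rightarrow>\<^sub>0 int" where "A k = single k 1" for k
  define B :: "int \<Rightarrow> int \<Rightarrow>\<^sub>0 int \<Rightarrow>\<^sub>0 int" where "B j = single 0 (single j 1)" for j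
  have A: "\<And>k l. int m dvd k - l \<Longrightarrow> A k = A l" "A 0 = 1" "\<And>k l. A (k + l) = A k * A l"
    using assms by (auto simp: A_def mult_single)
  have B: "\<And>k l. int n dvd k - l \<Longrightarrow> B k = B l" "B 0 = 1" "\<And>k l. B (k + l) = B k * B l"
    using assms by (auto simp: B_def mult_single)
  have char: "char_of A B (a [^] (k::int) \<otimes> b [^] (j::int)) = single k (single j 1)"
    for k j by (subst char_of_eq[OF A(1) B(1)]) (auto simp: A_def B_def mult_single)
  have lookup: "lookup (lookup (lin_ext (char_of A B) p) k) j =
      lookup p (a [^] k \<otimes> b [^] j)" if "keys p \<subseteq> carrier G" for p k j
    using that
  proof (induction p rule: frag_induction)
    case (one g)
    then obtain k' j' :: int where g: "g = a [^] k' \<otimes> b [^] j'" using carrier_eq by auto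
    show ?case using eq_iff[of k j k' j'] assms by (auto simp: g char lookup_single when_def)
  qed (simp_all add: lin_ext_diff lookup_minus)
  have "lin_ext (char_of A B) u * lin_ext (char_of A B) v = 1"
    by (rule lin_ext_central_inverse[OF A B uc v])
  then obtain k j d where d: "lin_ext (char_of A B) u = single k (single j d)"
    "d = 1 \<or> d = -1"
    by (rule poly_mapping_single_units)
  have "u = frag_cmul d (frag_of (a [^] k \<otimes> b [^] j))"
  proof (rule poly_mapping_eqI)
    fix g
    have keys: "keys u \<subseteq> carrier G" using uc by (simp add: carrier_group_ring)
    show "lookup u g = lookup (frag_cmul d (frag_of (a [^] k \<otimes> b [^] j))) g"
    proof (cases "g \<in> carrier G")
      case True
      then obtain k' j' :: int where g: "g = a [^] k' \<otimes> b [^] j'" using carrier_eq by auto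
      show ?thesis
        using lookup[OF keys, of k' j'] eq_iff[of k j k' j'] assms
        by (auto simp: g d(1) lookup_single when_def split: if_splits)
    next
      case False
      then have "lookup u g = 0" using keys by (metis in_keys_iff subsetD)
      then show ?thesis using False by auto
    qed
  qed
  then show "\<exists>g\<in>carrier G. u = frag_of g \<or> u = - frag_of g"
    using d(2) by (intro bexI[of _ "a [^] k \<otimes> b [^] j"]) auto
qed

end

lemma of_int_single:
  "of_int z * single i w = single i (of_int z * w)"
  for i :: "'a :: comm_monoid_add" and w :: "'b :: comm_ring_1"
  by (simp add: mult_single flip: single_of_int)

lemma sum_single: "(\<Sum>l\<in>I. single i (f l)) = single i (\<Sum>l\<in>I. f l)"
  by (induction I rule: infinite_finite_induct) (simp_all add: single_add)

lemma graded_units: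
  fixes p q :: "int \<Rightarrow>\<^sub>0 complex"
  assumes "p * q = 1"
  obtains k where "\<And>i. i \<noteq> k \<Longrightarrow> lookup p i = 0" "\<And>i. i \<noteq> k \<Longrightarrow> lookup q (- i) = 0"
    "lookup p k * lookup q (- k) = 1"
proof -
  obtain k c c' where "p = single k c" "q = single (- k) c'" "c * c' = 1"
    using poly_mapping_mult_eq_1[OF assms] by metis
  then show ?thesis using that[of k] by (simp add: lookup_single when_def)
qed

context graded_character
begin

text \<open>
  The degrees of the monomials \<open>lin_ext (\<alpha> t) u\<close> agree, because \<open>\<int>[C\<^sub>m]\<close> has no
  nontrivial idempotents: the sum of the values of an element over all characters is a
  multiple of \<open>m\<close>.
\<close>

lemma unit_homogeneous:
  assumes "keys u \<subseteq> S" "keys v \<subseteq> S"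
    and uv: "\<And>t. lin_ext (\<alpha> t) u * lin_ext (\<alpha> t) v = 1"
  obtains k where "\<And>t. component u k t * component v (- k) t = 1" "\<And>i t. i \<noteq> k \<Longrightarrow> component u i t = 0"
proof -
  have "\<exists>k. (\<forall>i. i \<noteq> k \<longrightarrow> component u i t = 0 \<and> component v (- i) t = 0) \<and>
      component u k t * component v (- k) t = 1" for t
    using graded_units[OF uv[of t]] unfolding lookup_lin_ext[OF assms(1)] lookup_lin_ext[OF assms(2)]
    by metis
  then obtain d where d: "\<And>t i. i \<noteq> d t \<Longrightarrow> component u i t = 0"
    "\<And>t. component u (d t) t * component v (- d t) t = 1"
    by metis
  define k where "k = d 0"
  \<comment> \<open>The indicator of the indices whose degree is k, an idempotent of the ring. Its
    sum counts such indices below m and is a positive multiple of m, so it counts all of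
    them.\<close>
  define E where "E = (\<lambda>t. component u k t * component v (- k) t)"
  have E: "E t = (if d t = k then 1 else 0)" for t
    using d(2)[of t] d(1)[of k t] by (auto simp: E_def)
  have Ec: "E \<in> cyc m" unfolding E_def by (intro cyc_mult component_cyc)
  then obtain z :: int where z: "(\<Sum>t<m. E t) = of_nat m * of_int z"
    by (rule cyc_sum_dvd[OF m_pos])
  let ?T = "{t \<in> {..<m}. d t = k}"
  have "(\<Sum>t<m. E t) = of_nat (card ?T)" by (simp add: E sum.inter_filter[symmetric])
  then have "of_int (int (card ?T)) = (of_int (int m * z) :: complex)" using z by simp
  then have cz: "int (card ?T) = int m * z" by (simp only: of_int_eq_iff)
  have "0 \<in> ?T" using m_pos by (simp add: k_def)
  then have "card ?T > 0" by (subst card_gt_0_iff) auto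
  with cz have "z > 0" by (simp add: zero_less_mult_iff) (metis of_nat_0_less_iff zero_less_mult_iff m_pos of_nat_less_0_iff)
  then have "int m * 1 \<le> int m * z" by (intro mult_left_mono) auto
  then have "card {..<m} \<le> card ?T" using cz by simp
  then have "?T = {..<m}" by (intro card_seteq) auto
  then have "d t = k" if "t < m" for t using that by auto
  then have "E (t mod m) = 1" for t using m_pos by (simp add: E)
  then have E1: "E t = 1" for t using cyc_mod[OF m_pos Ec, of t] by simp
  then have "d t = k" for t using E[of t] by (metis zero_neq_one)
  then show ?thesis using that[of k] E1 d(1) by (simp add: E_def)
qed

end

context normal_form
begin

text \<open>
  An element \<open>F\<close> of the ring \<open>cyc k\<close> is transported to the group ring by means of elements \<open>x l\<close>
  on which the characters take the values \<open>zeta k ^ (l * t)\<close>.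
\<close>

lemma cut_group_imp_units_generated:
  fixes \<psi> :: "nat \<Rightarrow> 'a \<Rightarrow> int \<Rightarrow>\<^sub>0 complex" and x :: "nat \<Rightarrow> 'a" and k s :: nat
  defines "el c \<equiv> (\<Sum>l<k. frag_cmul (c l) (frag_of (x l)))"
  assumes cut: "cut_group G" and k: "k > 0" and s: "coprime s k"
    and x: "\<And>l. x l \<in> carrier G" "\<And>t l. \<psi> t (x l) = single 0 (zeta k ^ (l * t))"
    and one: "\<And>t. \<psi> t \<one> = 1"
    and norm: "\<And>t g. g \<in> carrier G \<Longrightarrow> \<exists>i w. \<psi> t g = single i w \<and> cmod w = 1"
    and mult: "\<And>t p q. p \<in> carrier (group_ring G) \<Longrightarrow> q \<in> carrier (group_ring G) \<Longrightarrow>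
      (\<And>g. g \<in> carrier G \<Longrightarrow> frag_of g \<star> q = q \<star> frag_of g) \<Longrightarrow>
      lin_ext (\<psi> t) (p \<star> q) = lin_ext (\<psi> t) p * lin_ext (\<psi> t) q"
    and inject: "\<And>p q. p \<in> carrier (group_ring G) \<Longrightarrow> q \<in> carrier (group_ring G) \<Longrightarrow>
      (\<And>t. lin_ext (\<psi> t) p = lin_ext (\<psi> t) q) \<Longrightarrow> p = q"
    and comm: "\<And>c g. (\<And>t. lin_ext (\<psi> (s * t)) (el c) = lin_ext (\<psi> t) (el c)) \<Longrightarrow> g = a \<or> g = b \<Longrightarrow>
      frag_of g \<star> el c = el c \<star> frag_of g"
  shows "units_generated k s"
proof (rule ccontr)
  interpret Z: ring "group_ring G" by (rule ring_group_ring) (rule is_group)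
  assume "\<not> units_generated k s"
  then obtain F F' where F: "F \<in> cyc k" "F' \<in> cyc k" "\<And>t. F t * F' t = 1" "\<And>t. F (s * t) = F t" "cmod (F 1) \<noteq> 1"
    using cyc_nontrivial_unit[OF k s] by metis
  have F'_inv: "F' (s * t) = F' t" for t
    using F(3)[of t] F(3)[of "s * t"] F(4)[of t] by (metis mult_cancel_left mult_zero_left zero_neq_one)
  obtain c c' :: "nat \<Rightarrow> int" where c: "\<And>t. F t = (\<Sum>l<k. of_int (c l) * zeta k ^ (l * t))"
    "\<And>t. F' t = (\<Sum>l<k. of_int (c' l) * zeta k ^ (l * t))"
    using cyc_coeffs[OF k F(1)] cyc_coeffs[OF k F(2)] by metis
  have el_keys: "keys (el c) \<subseteq> carrier G" for c
    unfolding el_def by (rule order_trans[OF keys_sum]) (use keys_cmul x(1) in fastforce)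
  then have el: "el c \<in> carrier (group_ring G)" for c by (simp add: carrier_group_ring)
  have el_char: "lin_ext (\<psi> t) (el c) = single 0 (\<Sum>l<k. of_int (c l) * zeta k ^ (l * t))" for t c
    by (simp add: el_def lin_ext_sum lin_ext_cmul x(2) of_int_single sum_single)
  have "lin_ext (\<psi> (s * t)) (el c) = lin_ext (\<psi> t) (el c)" "lin_ext (\<psi> (s * t)) (el c') = lin_ext (\<psi> t) (el c')" for t
    by (simp_all only: el_char c[symmetric] F(4) F'_inv)
  then have c_comm: "frag_of g \<star> el c = el c \<star> frag_of g"
    and c'_comm: "frag_of g \<star> el c' = el c' \<star> frag_of g"
    if "g = a \<or> g = b" for g
    using comm that by blast+
  have "frag_of g \<star> el c' = el c' \<star> frag_of g" if "g \<in> carrier G" for g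
    by (rule commute_generated[OF el a_closed b_closed carrier_eq c'_comm c'_comm that]) simp_all
  then have "lin_ext (\<psi> t) (el c \<star> el c') = lin_ext (\<psi> t) (el c) * lin_ext (\<psi> t) (el c')" for t
    by (rule mult[OF el el])
  then have eq: "lin_ext (\<psi> t) (el c \<star> el c') = lin_ext (\<psi> t) (frag_of \<one>)" for t
    by (simp add: el_char mult_single one F(3) flip: c)
  have prod: "el c \<star> el c' = frag_of \<one>"
    by (rule inject[OF Z.m_closed[OF el el] _ eq]) (simp add: carrier_group_ring)
  obtain g where g: "g \<in> carrier G" "el c = frag_of g \<or> el c = - frag_of g"
    by (rule group_ring_unit_witness[OF el el c_comm c_comm prod cut]) simp_all
  \<comment> \<open>A trivial unit has a value of modulus 1 at the first character, whereas
    \<open>cmod (F 1)\<close> is not 1.\<close>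
  obtain i w where w: "\<psi> 1 g = single i w" "cmod w = 1" using norm[OF g(1)] by blast
  have "lin_ext (\<psi> 1) (el c) = single 0 (F 1)" by (simp only: el_char c(1))
  moreover have "lin_ext (\<psi> 1) (el c) = single i w \<or> lin_ext (\<psi> 1) (el c) = single i (- w)"
    using g(2) w(1) by (auto simp: lin_ext_minus single_uminus)
  ultimately have "single 0 (F 1) = single i w \<or> single 0 (F 1) = single i (- w)"
    by (simp only:)
  then have "F 1 = (w when i = 0) \<or> F 1 = (- w when i = 0)"
    by (metis lookup_single lookup_single_eq)
  moreover have "F 1 \<noteq> 0" using F(3)[of 1] by auto
  ultimately have "F 1 = w \<or> F 1 = - w" by (auto simp: when_def split: if_splits)
  with F(5) w(2) show False by auto
qed

text \<open>A central unit has one nonzero homogeneous component, so it lies in Z[<a>] b^k, and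
  commuting with b makes its coefficients invariant under l -> r' l. Conversely, an invariant
  element of Z[<a>] commutes with a and b.\<close>

lemma cut_group_finite_kernel:
  assumes n: "n = 0" and m: "m > 0" and r': "r = int r'" "coprime r' m"
  shows "cut_group G \<longleftrightarrow> units_generated m r'"
proof -
  define A :: "nat \<Rightarrow> int \<Rightarrow> int \<Rightarrow>\<^sub>0 complex" where "A t k = single 0 (zeta m powi (k * int t))" for t k
  define B :: "int \<Rightarrow> int \<Rightarrow>\<^sub>0 complex" where "B j = single j 1" for j
  define e where "e i l = a [^] (int l) \<otimes> b [^] i" for i :: int and l :: nat
  have A: "\<And>k l. int m dvd k - l \<Longrightarrow> A t k = A t l" "A t 0 = 1" "\<And>k l. A t (k + l) = A t k * A t l" for t
  proof -
    show "A t k = A t l" if "int m dvd k - l" for k l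
    proof -
      have "zeta m powi (k * int t) = zeta m powi (l * int t)"
        using that by (intro zeta_powi_cong[OF m]) (simp add: left_diff_distrib[symmetric])
      then show ?thesis by (simp add: A_def)
    qed
  qed (auto simp: A_def mult_single distrib_right power_int_add)
  have B: "\<And>k l. int n dvd k - l \<Longrightarrow> B k = B l" "B 0 = 1" "\<And>k l. B (k + l) = B k * B l"
    using n by (auto simp: B_def mult_single)
  have char: "char_of (A t) B (a [^] (k::int) \<otimes> b [^] (j::int)) = single j (zeta m powi (k * int t))"
    for t k j by (subst char_of_eq[OF A(1) B(1)]) (auto simp: A_def B_def mult_single)
  interpret gc: graded_character "carrier G" m e "\<lambda>t. char_of (A t) B"
  proof
    show "m > 0" by (rule m)
    show "\<exists>i l. l < m \<and> g = e i l" if g_in: "g \<in> carrier G" for g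
    proof -
      obtain k j :: int where g: "g = a [^] k \<otimes> b [^] j" using g_in carrier_eq by auto
      have "g = e j (nat (k mod int m))" using m by (simp add: g e_def eq_iff mod_eq_dvd_iff[symmetric])
      moreover have "nat (k mod int m) < m" using m by (simp add: nat_less_iff)
      ultimately show ?thesis by blast
    qed
    show "i = i' \<and> l = l'" if "l < m" "l' < m" "e i l = e i' l'" for i i' l l'
    proof -
      have "int m dvd int l - int l'" "i = i'" using that(3) n by (simp_all add: e_def eq_iff)
      then have "int l mod int m = int l' mod int m" by (simp add: mod_eq_dvd_iff)
      then show ?thesis using that(1,2) \<open>i = i'\<close> by (simp flip: of_nat_mod)
    qed
    show "char_of (A t) B (e i l) = single i (zeta m ^ (l * t))" for t i l
      by (simp only: e_def char of_nat_mult[symmetric] power_int_of_nat)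
  qed
  show ?thesis
  proof
    assume gen: "units_generated m r'"
    show "cut_group G"
      unfolding cut_group_iff
    proof (intro ballI impI)
      fix u assume u: "u \<in> Units (group_ring G)"
        and comm: "\<forall>g\<in>carrier G. frag_of g \<star> u = u \<star> frag_of g"
      have uc: "u \<in> carrier (group_ring G)" using u by (simp add: Units_def)
      obtain v where v: "v \<in> carrier (group_ring G)" "u \<star> v = frag_of \<one>"
        "\<And>g. g \<in> carrier G \<Longrightarrow> frag_of g \<star> v = v \<star> frag_of g"
        using central_unit_inverse[OF u] comm by blast
      have keys: "keys u \<subseteq> carrier G" "keys v \<subseteq> carrier G"
        using uc v(1) by (simp_all add: carrier_group_ring)
      have "lin_ext (char_of (A t) B) u * lin_ext (char_of (A t) B) v = 1" for t
        by (rule lin_ext_central_inverse[OF A B uc v])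
      then obtain k where k: "\<And>t. gc.component u k t * gc.component v (- k) t = 1"
        "\<And>i t. i \<noteq> k \<Longrightarrow> gc.component u i t = 0"
        using gc.unit_homogeneous[OF keys] by blast
      have inv: "gc.component u k (r' * t) = gc.component u k t" for t
      proof -
        define c where "c l = lookup u (e k l)" for l
        have c: "c (r' * l) = c l" for l
        proof -
          have "lookup u (e k l) = lookup u (e k (r' * l))"
          proof (rule lookup_conjugate[OF keys(1) b_closed])
            have "b \<otimes> e k l = a [^] (r * int l) \<otimes> b \<otimes> b [^] k"
              by (simp add: e_def m_assoc[symmetric] b_a_pow)
            also have "b \<otimes> b [^] k = b [^] k \<otimes> b"
              using int_pow_mult[of b 1 k] int_pow_mult[of b k 1] by (simp add: add.commute)
            then have "a [^] (r * int l) \<otimes> b \<otimes> b [^] k = a [^] (r * int l) \<otimes> b [^] k \<otimes> b"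
              by (simp add: m_assoc)
            finally show "b \<otimes> e k l = e k (r' * l) \<otimes> b" by (simp add: e_def r'(1))
          qed (use comm in \<open>simp_all add: e_def\<close>)
          then show ?thesis by (simp add: c_def)
        qed
        have c_cong: "c l = c l'" if "[l = l'] (mod m)" for l l'
        proof -
          have "int m dvd int l - int l'" using that by (simp add: cong_iff_dvd_diff flip: cong_int_iff)
          then show ?thesis by (simp add: c_def e_def) (metis eq_iff diff_self dvd_0_right)
        qed
        \<comment> \<open>Invariance allows r' to be inserted into the coefficient index as well;
          then l -> r' l merely permutes the residues.\<close>
        have "gc.component u k (r' * t) = (\<Sum>l<m. of_int (c (r' * l)) * zeta m ^ ((r' * l) * t))"
          unfolding gc.component_def c_def[symmetric] c by (simp add: ac_simps)
        also have "\<dots> = (\<Sum>l<m. of_int (c l) * zeta m ^ (l * t))"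
        proof (rule sum_mult_residues[OF m r'(2)])
          fix x y assume xy: "[x = y] (mod m)"
          then have "zeta m ^ (x * t) = zeta m ^ (y * t)" by (intro zeta_pow_cong[OF m] cong_mult cong_refl)
          then show "of_int (c x) * zeta m ^ (x * t) = of_int (c y) * zeta m ^ (y * t)"
            using c_cong[OF xy] by simp
        qed
        finally show ?thesis by (simp add: gc.component_def c_def)
      qed
      obtain l where "(\<forall>t. gc.component u k t = zeta m ^ (l * t)) \<or> (\<forall>t. gc.component u k t = - (zeta m ^ (l * t)))"
        using cyc_trivial_units[OF m gen gc.component_cyc gc.component_cyc k(1) inv] by blast
      then obtain d :: int where d: "d = 1 \<or> d = -1" "\<And>t. gc.component u k t = of_int d * zeta m ^ (l * t)"
      proof
        assume "\<forall>t. gc.component u k t = zeta m ^ (l * t)"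
        then show ?thesis using that[of 1] by simp
      next
        assume "\<forall>t. gc.component u k t = - (zeta m ^ (l * t))"
        then show ?thesis using that[of "-1"] by simp
      qed
      let ?g = "a [^] int l \<otimes> b [^] k"
      have "u = frag_cmul d (frag_of ?g)"
      proof (rule gc.lin_ext_inject[OF keys(1)])
        show "keys (frag_cmul d (frag_of ?g)) \<subseteq> carrier G" using keys_cmul[of d "frag_of ?g"] by auto
        fix t
        show "lin_ext (char_of (A t) B) u = lin_ext (char_of (A t) B) (frag_cmul d (frag_of ?g))"
        proof (rule poly_mapping_eqI)
          fix i
          have "lin_ext (char_of (A t) B) (frag_cmul d (frag_of ?g)) = single k (of_int d * zeta m ^ (l * t))"
            using d(1) by (auto simp: lin_ext_cmul char single_uminus simp flip: of_nat_mult)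
          then show "lookup (lin_ext (char_of (A t) B) u) i =
              lookup (lin_ext (char_of (A t) B) (frag_cmul d (frag_of ?g))) i"
            using k(2)[of i t] d(2)[of t] by (auto simp: gc.lookup_lin_ext[OF keys(1)] lookup_single when_def)
        qed
      qed
      then show "\<exists>g\<in>carrier G. u = frag_of g \<or> u = - frag_of g"
        using d(1) by (intro bexI[of _ ?g]) auto
    qed
  next
    assume cut: "cut_group G"
    show "units_generated m r'"
    proof (rule cut_group_imp_units_generated[OF cut m r'(2), where \<psi> = "\<lambda>t. char_of (A t) B" and x = "\<lambda>l. a [^] int l"])
      interpret Z: ring "group_ring G" by (rule ring_group_ring) (rule is_group)
      show chi: "char_of (A t) B (a [^] int l) = single 0 (zeta m ^ (l * t))" for t l
        using char[of t "int l" 0] by (simp flip: of_nat_mult)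
      show "char_of (A t) B \<one> = 1" for t using char[of t 0 0] by simp
      show "\<exists>i w. char_of (A t) B g = single i w \<and> cmod w = 1" if g: "g \<in> carrier G" for t g
      proof -
        obtain k j :: int where "g = a [^] k \<otimes> b [^] j" using g carrier_eq by auto
        then show ?thesis using char[of t k j]
          by (intro exI[of _ j] exI[of _ "zeta m powi (k * int t)"]) (simp add: norm_power_int)
      qed
      show "lin_ext (char_of (A t) B) (p \<star> q) = lin_ext (char_of (A t) B) p * lin_ext (char_of (A t) B) q"
        if "p \<in> carrier (group_ring G)" "q \<in> carrier (group_ring G)"
          "\<And>g. g \<in> carrier G \<Longrightarrow> frag_of g \<star> q = q \<star> frag_of g" for t p q
        by (rule lin_ext_char_of_mult[OF A B that])
      show inject: "p = q" if "p \<in> carrier (group_ring G)" "q \<in> carrier (group_ring G)"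
        "\<And>t. lin_ext (char_of (A t) B) p = lin_ext (char_of (A t) B) q" for p q
        using that by (intro gc.lin_ext_inject) (simp_all add: carrier_group_ring)
      fix c :: "nat \<Rightarrow> int" and g
      let ?el = "\<Sum>l<m. frag_cmul (c l) (frag_of (a [^] int l))"
      assume inv: "\<And>t. lin_ext (char_of (A (r' * t)) B) ?el = lin_ext (char_of (A t) B) ?el" and g: "g = a \<or> g = b"
      have "keys ?el \<subseteq> carrier G"
        by (rule order_trans[OF keys_sum]) (use keys_cmul in fastforce)
      then have el: "?el \<in> carrier (group_ring G)" by (simp add: carrier_group_ring)
      have "a \<otimes> a [^] int l = a [^] int l \<otimes> a" for l
        using int_pow_mult[of a 1 "int l"] int_pow_mult[of a "int l" 1] by (simp add: add.commute)
      then have "frag_of a \<star> ?el = ?el \<star> frag_of a"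
        by (simp add: group_ring_mult_sum_left group_ring_mult_sum_right group_ring_mult_cmul group_ring_mult_of)
      moreover have "frag_of b \<star> ?el = ?el \<star> frag_of b"
      proof (rule inject)
        show "frag_of b \<star> ?el \<in> carrier (group_ring G)" "?el \<star> frag_of b \<in> carrier (group_ring G)"
          by (intro Z.m_closed el; simp add: carrier_group_ring)+
        fix t
        have ba: "char_of (A t) B (b \<otimes> a [^] int l) = single 1 (zeta m ^ (l * (r' * t)))" for l
          using char[of t "r * int l" 1] by (simp add: b_a_pow r'(1) ac_simps flip: of_nat_mult)
        have ab: "char_of (A t) B (a [^] int l \<otimes> b) = single 1 (zeta m ^ (l * t))" for l
          using char[of t "int l" 1] by (simp flip: of_nat_mult)
        have "(\<Sum>l<m. of_int (c l) * zeta m ^ (l * (r' * t))) = (\<Sum>l<m. of_int (c l) * zeta m ^ (l * t))"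
          using arg_cong[OF inv[of t], of "\<lambda>p. lookup p 0"]
          by (simp add: lin_ext_sum lin_ext_cmul chi of_int_single sum_single)
        then show "lin_ext (char_of (A t) B) (frag_of b \<star> ?el) = lin_ext (char_of (A t) B) (?el \<star> frag_of b)"
          by (simp add: group_ring_mult_sum_left group_ring_mult_sum_right group_ring_mult_cmul group_ring_mult_of
              lin_ext_sum lin_ext_cmul ba ab of_int_single sum_single)
      qed
      ultimately show "frag_of g \<star> ?el = ?el \<star> frag_of g" using g by blast
    qed simp
  qed
qed

end

lemma zeta_double_pow: "k > 0 \<Longrightarrow> zeta (2 * k) ^ (2 * j) = zeta k ^ j"
  by (simp add: power_mult zeta_def DeMoivre power2_eq_square cis_mult)

lemma sum_even_odd:
  fixes f :: "nat \<Rightarrow> 'b :: comm_monoid_add"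
  shows "(\<Sum>l<2 * k. f l) = (\<Sum>j<k. f (2 * j)) + (\<Sum>j<k. f (2 * j + 1))"
  by (induction k) (simp_all add: ac_simps)

context graded_character
begin

lemma lookup_eq_0_if_component_eq_0:
  assumes "\<And>t. component p i t = 0" "l < m"
  shows "lookup p (e i l) = 0"
proof -
  have "of_nat m * of_int (lookup p (e i l)) = (\<Sum>t<m. component p i t * zeta m ^ ((m - l) * t))"
    by (rule fourier_inversion[OF m_pos _ assms(2), symmetric]) (simp add: component_def)
  then show ?thesis using m_pos by (simp add: assms(1))
qed

end

context normal_form
begin

lemma b_pow_a: "b [^] (l::nat) \<otimes> a = a [^] (r ^ l) \<otimes> b [^] l"
proof (induction l)
  case (Suc l)
  have "b [^] Suc l = b \<otimes> b [^] l" by (rule nat_pow_Suc2) simp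
  then have "b [^] Suc l \<otimes> a = b \<otimes> (b [^] l \<otimes> a)" by (simp add: m_assoc)
  also have "\<dots> = (b \<otimes> a [^] (r ^ l)) \<otimes> b [^] l" by (simp add: Suc m_assoc)
  also have "\<dots> = a [^] (r ^ Suc l) \<otimes> (b \<otimes> b [^] l)" by (simp add: b_a_pow m_assoc)
  also have "b \<otimes> b [^] l = b [^] Suc l" by (rule nat_pow_Suc2[symmetric]) simp
  finally show ?case .
qed simp

text \<open>Commuting with b equates the coefficients of a^i b^l and a^(-i) b^l, which forces degree
  0; commuting with a then removes the odd powers of b. What remains is Z[<b^2>], the group ring of
  a cyclic group of order k. Since b^2 is central, there is no further invariance, which is why r is
  replaced by 1.\<close>

lemma cut_group_infinite_kernel:
  assumes m: "m = 0" and r: "r = -1" and n: "n = 2 * k" "k > 0"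
  shows "cut_group G \<longleftrightarrow> units_generated k 1"
proof -
  have n0: "n > 0" using n by simp
  define A :: "int \<Rightarrow> int \<Rightarrow>\<^sub>0 complex" where "A i = single i 1" for i
  define B :: "nat \<Rightarrow> int \<Rightarrow> int \<Rightarrow>\<^sub>0 complex" where "B t j = single 0 (zeta n powi (j * int t))" for t j
  define e where "e i l = a [^] i \<otimes> b [^] (int l)" for i :: int and l :: nat
  have A: "\<And>k l. int m dvd k - l \<Longrightarrow> A k = A l" "A 0 = 1" "\<And>k l. A (k + l) = A k * A l"
    using m by (auto simp: A_def mult_single)
  have B: "\<And>k l. int n dvd k - l \<Longrightarrow> B t k = B t l" "B t 0 = 1" "\<And>k l. B t (k + l) = B t k * B t l" for t
  proof -
    show "B t k = B t l" if "int n dvd k - l" for k l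
    proof -
      have "zeta n powi (k * int t) = zeta n powi (l * int t)"
        using that by (intro zeta_powi_cong[OF n0]) (simp add: left_diff_distrib[symmetric])
      then show ?thesis by (simp add: B_def)
    qed
  qed (auto simp: B_def mult_single distrib_right power_int_add)
  have char: "char_of A (B t) (a [^] (i::int) \<otimes> b [^] (j::int)) = single i (zeta n powi (j * int t))"
    for t i j by (subst char_of_eq[OF A(1) B(1)]) (auto simp: A_def B_def mult_single)
  have char_b2: "char_of A (B t) (b [^] int (2 * j)) = single 0 (zeta k ^ (j * t))" for t j
  proof -
    have "zeta n powi (int (2 * j) * int t) = zeta n ^ (2 * (j * t))"
      by (simp only: of_nat_mult[symmetric] power_int_of_nat mult.assoc)
    also have "\<dots> = zeta k ^ (j * t)" using n by (simp add: zeta_double_pow)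
    finally show ?thesis using char[of t 0 "int (2 * j)"] by simp
  qed
  interpret gc: graded_character "carrier G" n e "\<lambda>t. char_of A (B t)"
  proof
    show "n > 0" by (rule n0)
    show "\<exists>i l. l < n \<and> g = e i l" if g_in: "g \<in> carrier G" for g
    proof -
      obtain i j :: int where g: "g = a [^] i \<otimes> b [^] j" using g_in carrier_eq by auto
      have "g = e i (nat (j mod int n))" using n0 by (simp add: g e_def eq_iff mod_eq_dvd_iff[symmetric])
      moreover have "nat (j mod int n) < n" using n0 by (simp add: nat_less_iff)
      ultimately show ?thesis by blast
    qed
    show "i = i' \<and> l = l'" if "l < n" "l' < n" "e i l = e i' l'" for i i' l l'
    proof -
      have "int n dvd int l - int l'" "i = i'" using that(3) m by (simp_all add: e_def eq_iff)
      then have "int l mod int n = int l' mod int n" by (simp add: mod_eq_dvd_iff)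
      then show ?thesis using that(1,2) \<open>i = i'\<close> by (simp flip: of_nat_mod)
    qed
    show "char_of A (B t) (e i l) = single i (zeta n ^ (l * t))" for t i l
      by (simp only: e_def char of_nat_mult[symmetric] power_int_of_nat)
  qed
  show ?thesis
  proof
    assume gen: "units_generated k 1"
    show "cut_group G"
      unfolding cut_group_iff
    proof (intro ballI impI)
      fix u assume u: "u \<in> Units (group_ring G)"
        and comm: "\<forall>g\<in>carrier G. frag_of g \<star> u = u \<star> frag_of g"
      have uc: "u \<in> carrier (group_ring G)" using u by (simp add: Units_def)
      obtain v where v: "v \<in> carrier (group_ring G)" "u \<star> v = frag_of \<one>"
        "\<And>g. g \<in> carrier G \<Longrightarrow> frag_of g \<star> v = v \<star> frag_of g"
        using central_unit_inverse[OF u] comm by blast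
      have keys: "keys u \<subseteq> carrier G" "keys v \<subseteq> carrier G"
        using uc v(1) by (simp_all add: carrier_group_ring)
      have uv: "lin_ext (char_of A (B t)) u * lin_ext (char_of A (B t)) v = 1" for t
        by (rule lin_ext_central_inverse[OF A B uc v])
      have sym: "gc.component p (- i) t = gc.component p i t"
        if p: "keys p \<subseteq> carrier G" "frag_of b \<star> p = p \<star> frag_of b"
        for p i t
      proof -
        have "lookup p (e i l) = lookup p (e (- i) l)" for l
        proof (rule lookup_conjugate[OF p(1) b_closed _ _ p(2)])
          have "b \<otimes> e i l = a [^] (- i) \<otimes> b \<otimes> b [^] int l"
            by (simp add: e_def m_assoc[symmetric] b_a_pow r)
          also have "b \<otimes> b [^] int l = b [^] int l \<otimes> b"
            using int_pow_mult[of b 1 "int l"] int_pow_mult[of b "int l" 1] by (simp add: add.commute)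
          then have "a [^] (- i) \<otimes> b \<otimes> b [^] int l = a [^] (- i) \<otimes> b [^] int l \<otimes> b"
            by (simp add: m_assoc)
          finally show "b \<otimes> e i l = e (- i) l \<otimes> b" by (simp add: e_def)
        qed (simp_all add: e_def)
        then show ?thesis by (simp add: gc.component_def)
      qed
      have comp: "gc.component u 0 t * gc.component v 0 t = 1 \<and> (\<forall>i. i \<noteq> 0 \<longrightarrow> gc.component u i t = 0 \<and> gc.component v i t = 0)" for t
      proof -
        obtain d where d: "\<And>i. i \<noteq> d \<Longrightarrow> gc.component u i t = 0" "\<And>i. i \<noteq> d \<Longrightarrow> gc.component v (- i) t = 0"
          "gc.component u d t * gc.component v (- d) t = 1"
          using graded_units[OF uv[of t]] unfolding gc.lookup_lin_ext[OF keys(1)] gc.lookup_lin_ext[OF keys(2)]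
          by blast
        have "gc.component u (- d) t \<noteq> 0" using d(3) sym[OF keys(1), of d t] comm by auto
        then have "- d = d" using d(1) by blast
        then have "d = 0" by simp
        have "gc.component v i t = 0" if "i \<noteq> 0" for i using d(2)[of "- i"] that \<open>d = 0\<close> by simp
        then show ?thesis using d(1,3) \<open>d = 0\<close> by simp
      qed
      \<comment> \<open>For odd l conjugation by a takes b^l to a^2 b^l, and the component of degree
        2 is zero.\<close>
      have odd: "lookup p (e 0 (2 * j + 1)) = 0"
        if p: "keys p \<subseteq> carrier G" "frag_of a \<star> p = p \<star> frag_of a"
          "\<And>t i. i \<noteq> 0 \<Longrightarrow> gc.component p i t = 0" and j: "j < k" for p j
      proof -
        let ?l = "2 * j + 1"
        have "lookup p (e 0 ?l) = lookup p (e 2 ?l)"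
        proof (rule lookup_conjugate[OF p(1) a_closed _ _ p(2)])
          have "e 2 ?l \<otimes> a = a [^] (2::int) \<otimes> (b [^] ?l \<otimes> a)"
            unfolding e_def int_pow_int by (simp add: m_assoc)
          also have "\<dots> = a [^] (2::int) \<otimes> (a [^] (-1::int) \<otimes> b [^] ?l)" unfolding b_pow_a r by simp
          also have "\<dots> = (a [^] (2::int) \<otimes> a [^] (-1::int)) \<otimes> b [^] ?l" by (simp add: m_assoc)
          also have "a [^] (2::int) \<otimes> a [^] (-1::int) = a" by (simp add: int_pow_mult[symmetric])
          finally show "a \<otimes> e 0 ?l = e 2 ?l \<otimes> a" unfolding e_def int_pow_int by simp
        qed (simp_all add: e_def)
        also have "\<dots> = 0" using p(3) j n by (intro gc.lookup_eq_0_if_component_eq_0) auto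
        finally show ?thesis .
      qed
      \<comment> \<open>The part supported on even powers of b, as an element over the cyclic group
        of order k generated by b^2.\<close>
      define ev where "ev p = (\<lambda>t. \<Sum>j<k. of_int (lookup p (e 0 (2 * j))) * zeta k ^ (j * t))"
        for p :: "'a \<Rightarrow>\<^sub>0 int"
      have ev_cyc: "ev p \<in> cyc k" for p
        unfolding ev_def using cyc_of_coeffs[of _ k "\<lambda>l. l"] by simp
      have ev: "gc.component p 0 t = ev p t"
        if p: "keys p \<subseteq> carrier G" "frag_of a \<star> p = p \<star> frag_of a"
          "\<And>t i. i \<noteq> 0 \<Longrightarrow> gc.component p i t = 0" for p t
      proof -
        have "gc.component p 0 t = (\<Sum>j<k. of_int (lookup p (e 0 (2 * j))) * zeta n ^ (2 * j * t)) +
            (\<Sum>j<k. of_int (lookup p (e 0 (2 * j + 1))) * zeta n ^ ((2 * j + 1) * t))"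
          unfolding gc.component_def
          using sum_even_odd[of "\<lambda>l. of_int (lookup p (e 0 l)) * zeta n ^ (l * t)" k]
          by (simp only: n(1)[symmetric])
        also have "(\<Sum>j<k. of_int (lookup p (e 0 (2 * j + 1))) * zeta n ^ ((2 * j + 1) * t)) = 0"
          using odd[OF p] by (intro sum.neutral) simp
        also have "(\<Sum>j<k. of_int (lookup p (e 0 (2 * j))) * zeta n ^ (2 * j * t)) = ev p t"
          unfolding ev_def n(1) mult.assoc zeta_double_pow[OF n(2)] ..
        finally show ?thesis by simp
      qed
      have ev_uv: "ev u t * ev v t = 1" for t
        using comp[of t] ev[OF keys(1), of t] ev[OF keys(2), of t] comm v(3)[OF a_closed] comp by simp
      obtain l where "(\<forall>t. ev u t = zeta k ^ (l * t)) \<or> (\<forall>t. ev u t = - (zeta k ^ (l * t)))"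
        using cyc_trivial_units[OF n(2) gen ev_cyc ev_cyc ev_uv] by auto
      then obtain d :: int where d: "d = 1 \<or> d = -1" "\<And>t. ev u t = of_int d * zeta k ^ (l * t)"
      proof
        assume "\<forall>t. ev u t = zeta k ^ (l * t)"
        then show ?thesis using that[of 1] by simp
      next
        assume "\<forall>t. ev u t = - (zeta k ^ (l * t))"
        then show ?thesis using that[of "-1"] by simp
      qed
      let ?g = "b [^] int (2 * l)"
      have "u = frag_cmul d (frag_of ?g)"
      proof (rule gc.lin_ext_inject[OF keys(1)])
        show "keys (frag_cmul d (frag_of ?g)) \<subseteq> carrier G" using keys_cmul[of d "frag_of ?g"] by auto
        fix t
        show "lin_ext (char_of A (B t)) u = lin_ext (char_of A (B t)) (frag_cmul d (frag_of ?g))"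
        proof (rule poly_mapping_eqI)
          fix i
          have "lin_ext (char_of A (B t)) (frag_cmul d (frag_of ?g)) = single 0 (of_int d * zeta k ^ (l * t))"
            using d(1) by (auto simp only: lin_ext_cmul lin_ext_of char_b2) (auto simp: single_uminus)
          moreover have "gc.component u 0 t = ev u t"
            using ev[OF keys(1), of t] comm comp by simp
          ultimately show "lookup (lin_ext (char_of A (B t)) u) i =
              lookup (lin_ext (char_of A (B t)) (frag_cmul d (frag_of ?g))) i"
            using comp[of t] d(2)[of t] by (auto simp: gc.lookup_lin_ext[OF keys(1)] lookup_single when_def)
        qed
      qed
      then show "\<exists>g\<in>carrier G. u = frag_of g \<or> u = - frag_of g"
        using d(1) by (intro bexI[of _ ?g]) auto
    qed
  next
    assume cut: "cut_group G"
    show "units_generated k 1"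
    proof (rule cut_group_imp_units_generated[OF cut n(2), where \<psi> = "\<lambda>t. char_of A (B t)" and x = "\<lambda>l. b [^] int (2 * l)"])
      show "char_of A (B t) (b [^] int (2 * l)) = single 0 (zeta k ^ (l * t))" for t l by (rule char_b2)
      show "char_of A (B t) \<one> = 1" for t using char[of t 0 0] by simp
      show "\<exists>i w. char_of A (B t) g = single i w \<and> cmod w = 1" if g: "g \<in> carrier G" for t g
      proof -
        obtain i j :: int where "g = a [^] i \<otimes> b [^] j" using g carrier_eq by auto
        then show ?thesis using char[of t i j]
          by (intro exI[of _ i] exI[of _ "zeta n powi (j * int t)"]) (simp add: norm_power_int)
      qed
      show "lin_ext (char_of A (B t)) (p \<star> q) = lin_ext (char_of A (B t)) p * lin_ext (char_of A (B t)) q"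
        if "p \<in> carrier (group_ring G)" "q \<in> carrier (group_ring G)"
          "\<And>g. g \<in> carrier G \<Longrightarrow> frag_of g \<star> q = q \<star> frag_of g" for t p q
        by (rule lin_ext_char_of_mult[OF A B that])
      show "p = q" if "p \<in> carrier (group_ring G)" "q \<in> carrier (group_ring G)"
        "\<And>t. lin_ext (char_of A (B t)) p = lin_ext (char_of A (B t)) q" for p q
        using that by (intro gc.lin_ext_inject) (simp_all add: carrier_group_ring)
      fix c :: "nat \<Rightarrow> int" and g assume g: "g = a \<or> g = b"
      have "a \<otimes> b [^] int (2 * l) = b [^] int (2 * l) \<otimes> a" for l
        unfolding int_pow_int b_pow_a r by simp
      moreover have "b \<otimes> b [^] int (2 * l) = b [^] int (2 * l) \<otimes> b" for l
        using int_pow_mult[of b 1 "int (2 * l)"] int_pow_mult[of b "int (2 * l)" 1] by (simp add: add.commute)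
      ultimately have "g \<otimes> b [^] int (2 * l) = b [^] int (2 * l) \<otimes> g" for l using g by blast
      then show "frag_of g \<star> (\<Sum>l<k. frag_cmul (c l) (frag_of (b [^] int (2 * l)))) =
          (\<Sum>l<k. frag_cmul (c l) (frag_of (b [^] int (2 * l)))) \<star> frag_of g"
        by (simp only: group_ring_mult_sum_left group_ring_mult_sum_right group_ring_mult_cmul group_ring_mult_of)
    qed simp_all
  qed
qed

end

text \<open>For any other k a unit strictly between 1 and k - 1 exists: 2 if k is odd, k / 2 - 1 if
  4 divides k, and k / 2 - 2 if k is 2 modulo 4.\<close>

lemma units_generated_1_imp:
  assumes "units_generated k 1" "k > 0"
  shows "k \<in> {1, 2, 3, 4, 6}"
proof (rule ccontr)
  assume k: "k \<notin> {1, 2, 3, 4, 6}"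
  have "\<exists>u. coprime u k \<and> 1 < u \<and> u + 1 < k"
  proof -
    consider "odd k" | q where "k = 4 * q" | q where "k = 4 * q + 2"
    proof -
      have "k mod 4 = 0 \<or> k mod 4 = 2 \<or> odd k" by presburger
      moreover have "k = 4 * (k div 4) + k mod 4" by simp
      ultimately show ?thesis using that by (metis add_0_right)
    qed
    then show ?thesis
    proof cases
      case 1
      moreover from 1 have "k \<ge> 5" using k assms(2) by (cases "k = 0"; cases "k = 1"; cases "k = 2"; cases "k = 3"; cases "k = 4") auto
      ultimately show ?thesis by (intro exI[of _ 2]) auto
    next
      case (2 q)
      then have q: "q \<ge> 2" using k assms(2) by (cases q) auto
      have "coprime (2 * q - 1) (4 * q)"
      proof (rule coprimeI)
        fix c assume c: "c dvd 2 * q - 1" "c dvd 4 * q"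
        have "c dvd 4 * q - 2 * (2 * q - 1)" by (rule dvd_diff_nat[OF c(2) dvd_mult[OF c(1)]])
        also have "4 * q - 2 * (2 * q - 1) = 2" using q by simp
        finally have "c = 1 \<or> c = 2" using prime_nat_iff two_is_prime_nat by blast
        moreover have "c \<noteq> 2" using c(1) q by auto
        ultimately show "is_unit c" by simp
      qed
      then show ?thesis using 2 q by (intro exI[of _ "2 * q - 1"]) auto
    next
      case (3 q)
      then have q: "q \<ge> 2" using k assms(2) by (cases q; cases "q - 1") auto
      have "coprime (2 * q - 1) (4 * q + 2)"
      proof (rule coprimeI)
        fix c assume c: "c dvd 2 * q - 1" "c dvd 4 * q + 2"
        have "c dvd (4 * q + 2) - 2 * (2 * q - 1)" by (rule dvd_diff_nat[OF c(2) dvd_mult[OF c(1)]])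
        also have "(4 * q + 2) - 2 * (2 * q - 1) = 4" using q by simp
        finally have "c dvd 4" .
        then have "c \<le> 4" by (intro dvd_imp_le) auto
        then have "c = 0 \<or> c = 1 \<or> c = 2 \<or> c = 3 \<or> c = 4" by linarith
        moreover have "odd (2 * q - 1)" using q by simp
        then have "odd c" using c(1) dvd_trans by blast
        ultimately show "is_unit c" using \<open>c dvd 4\<close> by auto
      qed
      then show ?thesis using 3 q by (intro exI[of _ "2 * q - 1"]) auto
    qed
  qed
  then obtain u where u: "coprime u k" "1 < u" "u + 1 < k" by blast
  then have "[u = 1] (mod k) \<or> [u = k - 1] (mod k)"
    using assms(1) by (auto simp: units_generated_def)
  then show False using u by (auto simp: cong_mod_def)
qed

lemma units_generated_1:
  assumes "k \<in> {1, 2, 3, 4, 6}"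
  shows "units_generated k 1"
  unfolding units_generated_def
proof (intro allI impI)
  fix u :: nat assume u: "coprime u k"
  have "k > 0" using assms by auto
  have "u mod k = 1 mod k \<or> u mod k = (k - 1) mod k"
  proof -
    have c: "coprime (u mod k) k" using u \<open>k > 0\<close> by (simp add: coprime_mod_left_iff)
    have "u mod k < k" using \<open>k > 0\<close> by simp
    then have "u mod k \<in> {..<k}" by simp
    have "\<forall>k\<in>{1, 2, 3, 4, 6::nat}. \<forall>v\<in>set [0..<k]. gcd v k = 1 \<longrightarrow> v = 1 mod k \<or> v = (k - 1) mod k"
      by code_simp
    then show ?thesis using c \<open>u mod k < k\<close> assms
      by (metis atLeastLessThan_iff coprime_iff_gcd_eq_1 le0 set_upt)
  qed
  then show "\<exists>i. [u = 1 ^ i] (mod k) \<or> [u = (k - 1) * 1 ^ i] (mod k)"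
    by (auto simp: cong_mod_def)
qed

section \<open>Presentations\<close>

context group
begin

lemma int_pow_add_1:
  assumes "x \<in> carrier G"
  shows "x \<otimes> x [^] (k::int) = x [^] (k + 1)" "inv x \<otimes> x [^] (k::int) = x [^] (k - 1)"
proof -
  show "x \<otimes> x [^] k = x [^] (k + 1)"
    using int_pow_mult[OF assms, of 1 k] assms by (simp add: add.commute)
  show "inv x \<otimes> x [^] k = x [^] (k - 1)"
    using int_pow_mult[OF assms, of "-1" k] assms by (simp add: int_pow_neg)
qed

end

section \<open>Evaluation of words and maps out of a presented group\<close>

definition word_eval :: "('a, 'b) monoid_scheme \<Rightarrow> ('x \<Rightarrow> 'a) \<Rightarrow> 'x group_word \<Rightarrow> 'a" where
  "word_eval G f w = foldr (\<lambda>(x, e) y. (if e then f x else inv\<^bsub>G\<^esub> (f x)) \<otimes>\<^bsub>G\<^esub> y) w \<one>\<^bsub>G\<^esub>"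

lemma word_eval_simps [simp]:
  "word_eval G f [] = \<one>\<^bsub>G\<^esub>"
  "word_eval G f ((x, e) # w) = (if e then f x else inv\<^bsub>G\<^esub> (f x)) \<otimes>\<^bsub>G\<^esub> word_eval G f w"
  by (simp_all add: word_eval_def)

context group
begin

lemma word_eval_closed [simp]:
  assumes "\<And>x. f x \<in> carrier G"
  shows "word_eval G f w \<in> carrier G"
  by (induction w) (use assms in auto)

lemma word_eval_append:
  assumes "\<And>x. f x \<in> carrier G"
  shows "word_eval G f (u @ v) = word_eval G f u \<otimes> word_eval G f v"
  by (induction u) (use assms in \<open>auto simp: m_assoc\<close>)

lemma word_eval_replicate:
  assumes "f x \<in> carrier G"
  shows "word_eval G f (replicate n (x, True)) = f x [^] n"
proof (induction n)
  case (Suc n)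
  then show ?case using nat_pow_Suc2[OF assms, of n] by simp
qed simp

lemma word_eval_cong:
  assumes f: "\<And>x. f x \<in> carrier G" and R: "\<And>u v. (u, v) \<in> R \<Longrightarrow> word_eval G f u = word_eval G f v"
    and uv: "(u, v) \<in> relation_cong R"
  shows "word_eval G f u = word_eval G f v"
  using uv
proof induction
  case (cancel x e)
  then show ?case using f by auto
qed (use R f in \<open>auto simp: word_eval_append\<close>)

end

abbreviation word_class :: "('x group_word \<times> 'x group_word) set \<Rightarrow> 'x group_word \<Rightarrow> 'x group_word set" where
  "word_class R w \<equiv> relation_cong R `` {w}"

lemma carrier_presented_group: "carrier (presented_group R) = range (word_class R)"
  by (auto simp: presented_group_def quotient_def)

lemma one_presented_group: "\<one>\<^bsub>presented_group R\<^esub> = word_class R []"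
  by (simp add: presented_group_def)

lemma word_class_eq_iff: "word_class R u = word_class R v \<longleftrightarrow> (u, v) \<in> relation_cong R"
  using eq_equiv_class_iff[OF equiv_relation_cong] by simp

lemma word_class_eval:
  "word_class R w = word_eval (presented_group R) (\<lambda>x. word_class R [(x, True)]) w"
proof (induction w)
  case Nil
  then show ?case by (simp add: one_presented_group)
next
  case (Cons l w)
  interpret P: group "presented_group R" by (rule group_presented_group)
  obtain x e where l: "l = (x, e)" by (cases l)
  have "inv\<^bsub>presented_group R\<^esub> word_class R [(x, True)] = word_class R [(x, False)]"
  proof (rule P.inv_equality)
    have "([(x, False), (x, \<not> False)], []) \<in> relation_cong R" by (rule relation_cong.cancel)
    then show "word_class R [(x, False)] \<otimes>\<^bsub>presented_group R\<^esub> word_class R [(x, True)] = \<one>\<^bsub>presented_group R\<^esub>"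
      by (simp add: mult_presented_group one_presented_group word_class_eq_iff)
  qed (simp_all add: carrier_presented_group)
  then have "word_class R [(x, e)] = (if e then word_class R [(x, True)] else inv\<^bsub>presented_group R\<^esub> word_class R [(x, True)])"
    by simp
  moreover have "word_class R (l # w) = word_class R [(x, e)] \<otimes>\<^bsub>presented_group R\<^esub> word_class R w"
    by (simp add: l mult_presented_group)
  ultimately show ?case by (simp add: l Cons)
qed

text \<open>Von Dyck's theorem. A class is evaluated at a chosen representative, and
  \<open>word_eval_cong\<close> makes the choice harmless.\<close>

lemma (in group) presented_group_hom:
  assumes f: "\<And>x. f x \<in> carrier G" and R: "\<And>u v. (u, v) \<in> R \<Longrightarrow> word_eval G f u = word_eval G f v"
  obtains h where "h \<in> hom (presented_group R) G" "\<And>w. h (word_class R w) = word_eval G f w"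
proof -
  define h where "h A = word_eval G f (SOME w. w \<in> A)" for A
  have h: "h (word_class R w) = word_eval G f w" for w
  proof -
    have "w \<in> word_class R w" by (simp add: relation_cong.refl)
    then have "(SOME w'. w' \<in> word_class R w) \<in> word_class R w" by (rule someI)
    then have "(w, SOME w'. w' \<in> word_class R w) \<in> relation_cong R" by simp
    then show ?thesis using word_eval_cong[OF f R] by (simp add: h_def)
  qed
  have "h \<in> hom (presented_group R) G"
    by (rule homI) (auto simp: carrier_presented_group mult_presented_group h word_eval_append[OF f] f)
  with h that show ?thesis by blast
qed

definition gens :: "'a \<Rightarrow> 'a \<Rightarrow> gen \<Rightarrow> 'a" where
  "gens a b x = (case x of Gen_a \<Rightarrow> a | Gen_b \<Rightarrow> b)"

lemma gens_simps [simp]: "gens a b Gen_a = a" "gens a b Gen_b = b"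
  by (simp_all add: gens_def)

lemma (in group) gens_closed: "a \<in> carrier G \<Longrightarrow> b \<in> carrier G \<Longrightarrow> gens a b x \<in> carrier G"
  by (cases x) auto

text \<open>The first relation moves b past powers of a, the second, rewritten as
  \<open>b_inv\<close>, moves the inverse of b. A rule for b alone would not do in general: if the
  only relation is ba = a^2 b, then b^-1 a b is no power of a.\<close>

lemma (in group) word_eval_normal_form:
  assumes ab: "a \<in> carrier G" "b \<in> carrier G"
    and rel: "b \<otimes> a = a [^] (r::int) \<otimes> b" "a \<otimes> b = b \<otimes> a [^] (r'::int)"
  obtains k j :: int where "word_eval G (gens a b) w = a [^] k \<otimes> b [^] j"
proof -
  have "\<exists>(k::int) (j::int). word_eval G (gens a b) w = a [^] k \<otimes> b [^] j"
  proof (induction w)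
    case Nil
    show ?case by (intro exI[of _ 0]) simp
  next
    case (Cons l w)
    then obtain k j :: int where w: "word_eval G (gens a b) w = a [^] k \<otimes> b [^] j" by blast
    have b_inv: "inv b \<otimes> a = a [^] r' \<otimes> inv b"
    proof -
      have "inv b \<otimes> a = inv b \<otimes> ((a \<otimes> b) \<otimes> inv b)" using ab by (simp add: m_assoc)
      also have "\<dots> = inv b \<otimes> ((b \<otimes> a [^] r') \<otimes> inv b)" by (simp only: rel(2))
      also have "\<dots> = a [^] r' \<otimes> inv b" using ab by (simp add: m_assoc[symmetric])
      finally show ?thesis .
    qed
    obtain x e where l: "l = (x, e)" by (cases l)
    show ?case
    proof (cases x)
      case Gen_a
      have "word_eval G (gens a b) (l # w) = (if e then a else inv a) \<otimes> a [^] k \<otimes> b [^] j"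
        using ab by (simp add: l Gen_a w m_assoc)
      also have "\<dots> = a [^] (if e then k + 1 else k - 1) \<otimes> b [^] j"
        using ab by (simp add: int_pow_add_1)
      finally show ?thesis by blast
    next
      case Gen_b
      have "word_eval G (gens a b) (l # w) = ((if e then b else inv b) \<otimes> a [^] k) \<otimes> b [^] j"
        using ab by (simp add: l Gen_b w m_assoc)
      also have "(if e then b else inv b) \<otimes> a [^] k = a [^] ((if e then r else r') * k) \<otimes> (if e then b else inv b)"
        using conj_int_pow[OF ab rel(1), of k] conj_int_pow[of a "inv b", OF _ _ b_inv, of k] ab by simp
      also have "\<dots> \<otimes> b [^] j = a [^] ((if e then r else r') * k) \<otimes> b [^] (if e then j + 1 else j - 1)"
        using ab by (simp add: m_assoc int_pow_add_1)
      finally show ?thesis by blast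
    qed
  qed
  then show ?thesis using that by blast
qed

text \<open>The relations bring the elements of the presented group to the form a^k b^j and bound
  the orders of its generators. An element in the kernel of the canonical map to G has exponents
  divisible by these orders, hence is trivial.\<close>

lemma (in normal_form) iso_presented_group:
  fixes R :: "(gen group_word \<times> gen group_word) set"
  defines "\<alpha> \<equiv> word_class R [letter_a]" and "\<beta> \<equiv> word_class R [letter_b]"
  assumes R: "\<And>u v. (u, v) \<in> R \<Longrightarrow> word_eval G (gens a b) u = word_eval G (gens a b) v"
    and orders: "\<alpha> [^]\<^bsub>presented_group R\<^esub> m = \<one>\<^bsub>presented_group R\<^esub>" "\<beta> [^]\<^bsub>presented_group R\<^esub> n = \<one>\<^bsub>presented_group R\<^esub>"
    and rels: "\<beta> \<otimes>\<^bsub>presented_group R\<^esub> \<alpha> = \<alpha> [^]\<^bsub>presented_group R\<^esub> r \<otimes>\<^bsub>presented_group R\<^esub> \<beta>"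
      "\<alpha> \<otimes>\<^bsub>presented_group R\<^esub> \<beta> = \<beta> \<otimes>\<^bsub>presented_group R\<^esub> \<alpha> [^]\<^bsub>presented_group R\<^esub> (r'::int)"
  shows "G \<cong> presented_group R"
proof -
  interpret P: group "presented_group R" by (rule group_presented_group)
  obtain h where h: "h \<in> hom (presented_group R) G" "\<And>w. h (word_class R w) = word_eval G (gens a b) w"
    using presented_group_hom[of "gens a b" R, OF gens_closed[OF a_closed b_closed] R] by blast
  interpret h: group_hom "presented_group R" G h
    by (rule group_hom.intro) (simp_all add: group_hom_axioms_def h(1) is_group P.is_group)
  have \<alpha>\<beta>: "\<alpha> \<in> carrier (presented_group R)" "\<beta> \<in> carrier (presented_group R)"
    by (simp_all add: \<alpha>_def \<beta>_def carrier_presented_group)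
  have h_\<alpha>\<beta>: "h \<alpha> = a" "h \<beta> = b" by (simp_all add: \<alpha>_def \<beta>_def h(2))
  have h_pow: "h (\<alpha> [^]\<^bsub>presented_group R\<^esub> k \<otimes>\<^bsub>presented_group R\<^esub> \<beta> [^]\<^bsub>presented_group R\<^esub> j) = a [^] k \<otimes> b [^] j"
    for k j :: int
    using \<alpha>\<beta> by (simp add: h.hom_int_pow h_\<alpha>\<beta>)
  have gens: "(\<lambda>x. word_class R [(x, True)]) = gens \<alpha> \<beta>"
  proof
    show "word_class R [(x, True)] = gens \<alpha> \<beta> x" for x by (cases x) (simp_all add: \<alpha>_def \<beta>_def)
  qed
  have nf: "\<exists>(k::int) (j::int). A = \<alpha> [^]\<^bsub>presented_group R\<^esub> k \<otimes>\<^bsub>presented_group R\<^esub> \<beta> [^]\<^bsub>presented_group R\<^esub> j"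
    if A_in: "A \<in> carrier (presented_group R)" for A
  proof -
    obtain w where "A = word_class R w" using A_in by (auto simp: carrier_presented_group)
    then have "A = word_eval (presented_group R) (gens \<alpha> \<beta>) w" using word_class_eval[of R w] by (simp add: gens)
    then show ?thesis using P.word_eval_normal_form[OF \<alpha>\<beta> rels] by metis
  qed
  have "bij_betw h (carrier (presented_group R)) (carrier G)"
    unfolding bij_betw_def
  proof
    show "inj_on h (carrier (presented_group R))"
    proof (rule h.trivial_ker_imp_inj, rule equalityI)
      show "kernel (presented_group R) G h \<subseteq> {\<one>\<^bsub>presented_group R\<^esub>}"
      proof
        fix A assume A: "A \<in> kernel (presented_group R) G h"
        then obtain k j :: int where kj: "A = \<alpha> [^]\<^bsub>presented_group R\<^esub> k \<otimes>\<^bsub>presented_group R\<^esub> \<beta> [^]\<^bsub>presented_group R\<^esub> j"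
          using nf[of A] by (auto simp: kernel_def)
        then have "a [^] k \<otimes> b [^] j = \<one>" using A h_pow by (simp add: kernel_def)
        then obtain p q where "k = int m * p" "j = int n * q" by (auto simp: trivial_iff elim!: dvdE)
        then show "A \<in> {\<one>\<^bsub>presented_group R\<^esub>}"
          using orders \<alpha>\<beta> by (simp add: kj P.int_pow_pow[symmetric] int_pow_int)
      qed
    qed (auto simp: kernel_def)
    show "h ` carrier (presented_group R) = carrier G"
    proof
      show "carrier G \<subseteq> h ` carrier (presented_group R)"
      proof
        fix g assume "g \<in> carrier G"
        then obtain k j :: int where "g = a [^] k \<otimes> b [^] j" using carrier_eq by auto
        then have "g = h (\<alpha> [^]\<^bsub>presented_group R\<^esub> k \<otimes>\<^bsub>presented_group R\<^esub> \<beta> [^]\<^bsub>presented_group R\<^esub> j)" by (simp add: h_pow)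
        then show "g \<in> h ` carrier (presented_group R)" using \<alpha>\<beta> by (simp only: imageI P.m_closed P.int_pow_closed)
      qed
    qed auto
  qed
  then have "h \<in> iso (presented_group R) G" using h(1) by (simp add: iso_def)
  then have "presented_group R \<cong> G" by (rule is_isoI)
  then show ?thesis using P.iso_sym by blast
qed

lemma presented_group_relation:
  assumes "(u, v) \<in> R"
  shows "word_eval (presented_group R) (\<lambda>x. word_class R [(x, True)]) u =
    word_eval (presented_group R) (\<lambda>x. word_class R [(x, True)]) v"
  using relation_cong.rel[OF assms] by (simp add: word_class_eval[symmetric] word_class_eq_iff)

lemma hom_word_eval:
  assumes "group_hom G H h" "\<And>x. f x \<in> carrier G"
  shows "h (word_eval G f w) = word_eval H (\<lambda>x. h (f x)) w"
proof -
  interpret group_hom G H h by fact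
  show ?thesis by (induction w) (use assms(2) in auto)
qed

text \<open>An obtained fact has a fixed type for \<open>H\<close>, so the universal property is
  recorded for the type of \<open>klein_bottle_group\<close>, the model to which it is
  applied.\<close>

lemma (in group) iso_presented_groupE:
  fixes R :: "(gen group_word \<times> gen group_word) set"
  assumes "G \<cong> presented_group R"
  obtains a b where "a \<in> carrier G" "b \<in> carrier G"
    "\<And>u v. (u, v) \<in> R \<Longrightarrow> word_eval G (gens a b) u = word_eval G (gens a b) v"
    "\<And>g. g \<in> carrier G \<Longrightarrow> \<exists>w. g = word_eval G (gens a b) w"
    "\<And>(H :: (int \<times> int) monoid) c d. group H \<Longrightarrow> c \<in> carrier H \<Longrightarrow> d \<in> carrier H \<Longrightarrow>
      (\<And>u v. (u, v) \<in> R \<Longrightarrow> word_eval H (gens c d) u = word_eval H (gens c d) v) \<Longrightarrow>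
      \<exists>\<psi>\<in>hom G H. \<psi> a = c \<and> \<psi> b = d"
proof -
  let ?P = "presented_group R"
  interpret P: group ?P by (rule group_presented_group)
  obtain \<phi> where \<phi>: "\<phi> \<in> iso G ?P" using assms by (auto simp: is_iso_def)
  define h where "h = inv_into (carrier G) \<phi>"
  have h_iso: "h \<in> iso ?P G" unfolding h_def by (rule iso_set_sym[OF \<phi>])
  have bij: "bij_betw \<phi> (carrier G) (carrier ?P)" using \<phi> by (simp add: iso_def)
  have \<phi>h: "\<phi> (h A) = A" if "A \<in> carrier ?P" for A
    unfolding h_def using bij that by (simp add: bij_betw_inv_into_right)
  have h_hom: "group_hom ?P G h"
    using h_iso by (intro group_hom.intro) (simp_all add: group_hom_axioms_def iso_def is_group P.is_group)
  interpret h: group_hom ?P G h by (rule h_hom)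
  define a where "a = h (word_class R [letter_a])"
  define b where "b = h (word_class R [letter_b])"
  have P_gen: "word_class R w \<in> carrier ?P" for w by (simp add: carrier_presented_group)
  have gens: "(\<lambda>x. h (word_class R [(x, True)])) = gens a b"
  proof
    show "h (word_class R [(x, True)]) = gens a b x" for x by (cases x) (simp_all add: a_def b_def)
  qed
  have h_eval: "h (word_class R w) = word_eval G (gens a b) w" for w
    using hom_word_eval[OF h_hom, of "\<lambda>x. word_class R [(x, True)]" w] P_gen
    by (simp add: word_class_eval[symmetric] gens)
  show ?thesis
  proof (rule that)
    show "a \<in> carrier G" "b \<in> carrier G" by (simp_all add: a_def b_def P_gen)
    show "word_eval G (gens a b) u = word_eval G (gens a b) v" if "(u, v) \<in> R" for u v
    proof -
      have "word_class R u = word_class R v"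
        using relation_cong.rel[OF that] by (simp only: word_class_eq_iff)
      then show ?thesis by (simp only: h_eval[symmetric])
    qed
    show "\<exists>w. g = word_eval G (gens a b) w" if g: "g \<in> carrier G" for g
    proof -
      have "g \<in> h ` carrier ?P" using h_iso g by (simp add: iso_def bij_betw_def)
      then show ?thesis by (auto simp: carrier_presented_group h_eval)
    qed
    show "\<exists>\<psi>\<in>hom G H. \<psi> a = c \<and> \<psi> b = d"
      if H: "group H" "c \<in> carrier H" "d \<in> carrier H"
        and rel: "\<And>u v. (u, v) \<in> R \<Longrightarrow> word_eval H (gens c d) u = word_eval H (gens c d) v"
      for H :: "(int \<times> int) monoid" and c d
    proof -
      interpret H: group H by (rule H(1))
      obtain h' where h': "h' \<in> hom ?P H" "\<And>w. h' (word_class R w) = word_eval H (gens c d) w"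
        using H.presented_group_hom[of "gens c d" R, OF H.gens_closed[OF H(2,3)] rel] by blast
      have "h' \<circ> \<phi> \<in> hom G H" using \<phi> h'(1) by (auto simp: iso_def hom_def Pi_iff)
      moreover have "(h' \<circ> \<phi>) a = c" "(h' \<circ> \<phi>) b = d"
        using H(2,3) by (simp_all add: a_def b_def \<phi>h P_gen h'(2))
      ultimately show ?thesis by blast
    qed
  qed
qed

section \<open>The two families of presentations\<close>

definition infinite_kernel_relations :: "nat \<Rightarrow> (gen group_word \<times> gen group_word) set" where
  "infinite_kernel_relations n =
     {(replicate n letter_b, []), ([letter_b, letter_a], [letter_a_inv, letter_b])}"

definition finite_kernel_relations :: "nat \<Rightarrow> nat \<Rightarrow> (gen group_word \<times> gen group_word) set" where
  "finite_kernel_relations m r =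
     {(replicate m letter_a, []), ([letter_b, letter_a], replicate r letter_a @ [letter_b])}"

context group
begin

lemma infinite_kernel_relations_iff:
  assumes "a \<in> carrier G" "b \<in> carrier G"
  shows "(\<forall>(u, v)\<in>infinite_kernel_relations n. word_eval G (gens a b) u = word_eval G (gens a b) v) \<longleftrightarrow>
    b [^] n = \<one> \<and> b \<otimes> a = a [^] (-1::int) \<otimes> b"
  using assms word_eval_replicate[of "gens a b" Gen_b n] by (auto simp: infinite_kernel_relations_def int_pow_neg)

lemma finite_kernel_relations_iff:
  assumes "a \<in> carrier G" "b \<in> carrier G"
  shows "(\<forall>(u, v)\<in>finite_kernel_relations m r. word_eval G (gens a b) u = word_eval G (gens a b) v) \<longleftrightarrow>
    a [^] m = \<one> \<and> b \<otimes> a = a [^] int r \<otimes> b"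
  using assms word_eval_replicate[of "gens a b" Gen_a] word_eval_append[of "gens a b", OF gens_closed[OF assms]]
  by (auto simp: finite_kernel_relations_def int_pow_int)

lemma inverse_relation_infinite:
  assumes "a \<in> carrier G" "b \<in> carrier G" "b \<otimes> a = a [^] (-1::int) \<otimes> b"
  shows "a \<otimes> b = b \<otimes> a [^] (-1::int)"
  using conj_int_pow[OF assms, of "-1"] assms(1) by simp

lemma inverse_relation_finite:
  assumes ab: "a \<in> carrier G" "b \<in> carrier G" "b \<otimes> a = a [^] int r \<otimes> b"
    and m: "a [^] m = \<one>" and r': "[r' * r = 1] (mod m)"
  shows "a \<otimes> b = b \<otimes> a [^] int r'"
proof -
  have "int m dvd int (r' * r) - int 1" using r' by (simp add: cong_iff_dvd_diff flip: cong_int_iff)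
  then obtain q where q: "int (r' * r) - int 1 = int m * q" ..
  then have "int r * int r' = 1 + int m * q" by (simp add: mult.commute)
  then have "a [^] (int r * int r') = a [^] (1 + int m * q)" by simp
  also have "\<dots> = a \<otimes> a [^] (int m * q)" using ab(1) by (simp add: int_pow_mult)
  also have "a [^] (int m * q) = \<one>" using ab(1) m by (simp add: int_pow_pow[symmetric] int_pow_int)
  finally show ?thesis using conj_int_pow[OF ab, of "int r'"] ab(1) by simp
qed

lemma iso_infinite_kernel_groupE:
  assumes "G \<cong> infinite_kernel_group n"
  obtains a b where "a \<in> carrier G" "b \<in> carrier G" "b [^] n = \<one>" "b \<otimes> a = a [^] (-1::int) \<otimes> b"
    "carrier G = {a [^] (k::int) \<otimes> b [^] (j::int) | k j. True}"
    "\<And>(H :: (int \<times> int) monoid) c d. group H \<Longrightarrow> c \<in> carrier H \<Longrightarrow> d \<in> carrier H \<Longrightarrow>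
      d [^]\<^bsub>H\<^esub> n = \<one>\<^bsub>H\<^esub> \<Longrightarrow> d \<otimes>\<^bsub>H\<^esub> c = c [^]\<^bsub>H\<^esub> (-1::int) \<otimes>\<^bsub>H\<^esub> d \<Longrightarrow> \<exists>\<psi>\<in>hom G H. \<psi> a = c \<and> \<psi> b = d"
proof -
  have "G \<cong> presented_group (infinite_kernel_relations n)"
    using assms by (simp add: infinite_kernel_group_def infinite_kernel_relations_def)
  then obtain a b where ab: "a \<in> carrier G" "b \<in> carrier G"
    and rel: "\<And>u v. (u, v) \<in> infinite_kernel_relations n \<Longrightarrow> word_eval G (gens a b) u = word_eval G (gens a b) v"
    and gen: "\<And>g. g \<in> carrier G \<Longrightarrow> \<exists>w. g = word_eval G (gens a b) w"
    and univ: "\<And>(H :: (int \<times> int) monoid) c d. group H \<Longrightarrow> c \<in> carrier H \<Longrightarrow> d \<in> carrier H \<Longrightarrow>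
      (\<And>u v. (u, v) \<in> infinite_kernel_relations n \<Longrightarrow> word_eval H (gens c d) u = word_eval H (gens c d) v) \<Longrightarrow>
      \<exists>\<psi>\<in>hom G H. \<psi> a = c \<and> \<psi> b = d"
    by (rule iso_presented_groupE) blast
  have r: "b [^] n = \<one>" "b \<otimes> a = a [^] (-1::int) \<otimes> b"
    using infinite_kernel_relations_iff[OF ab, of n] rel by auto
  show ?thesis
  proof (rule that[OF ab r])
    show "carrier G = {a [^] (k::int) \<otimes> b [^] (j::int) | k j. True}"
    proof
      show "carrier G \<subseteq> {a [^] (k::int) \<otimes> b [^] (j::int) | k j. True}"
      proof
        fix g assume "g \<in> carrier G"
        then obtain w where w: "g = word_eval G (gens a b) w" using gen by blast
        obtain k j :: int where "word_eval G (gens a b) w = a [^] k \<otimes> b [^] j"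
          by (rule word_eval_normal_form[OF ab r(2) inverse_relation_infinite[OF ab r(2)]])
        then show "g \<in> {a [^] (k::int) \<otimes> b [^] (j::int) | k j. True}" using w by blast
      qed
    qed (use ab in auto)
    show "\<exists>\<psi>\<in>hom G H. \<psi> a = c \<and> \<psi> b = d"
      if H: "group H" "c \<in> carrier H" "d \<in> carrier H"
        and "d [^]\<^bsub>H\<^esub> n = \<one>\<^bsub>H\<^esub>" "d \<otimes>\<^bsub>H\<^esub> c = c [^]\<^bsub>H\<^esub> (-1::int) \<otimes>\<^bsub>H\<^esub> d"
      for H :: "(int \<times> int) monoid" and c d
    proof -
      have "\<forall>(u, v)\<in>infinite_kernel_relations n. word_eval H (gens c d) u = word_eval H (gens c d) v"
        unfolding group.infinite_kernel_relations_iff[OF H] using that by blast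
      then show ?thesis by (intro univ[OF H]) auto
    qed
  qed
qed

lemma iso_finite_kernel_groupE:
  assumes "G \<cong> finite_kernel_group m r" "coprime r m"
  obtains a b where "a \<in> carrier G" "b \<in> carrier G" "a [^] m = \<one>" "b \<otimes> a = a [^] int r \<otimes> b"
    "carrier G = {a [^] (k::int) \<otimes> b [^] (j::int) | k j. True}"
proof -
  have "G \<cong> presented_group (finite_kernel_relations m r)"
    using assms by (simp add: finite_kernel_group_def finite_kernel_relations_def)
  then obtain a b where ab: "a \<in> carrier G" "b \<in> carrier G"
    and rel: "\<And>u v. (u, v) \<in> finite_kernel_relations m r \<Longrightarrow> word_eval G (gens a b) u = word_eval G (gens a b) v"
    and gen: "\<And>g. g \<in> carrier G \<Longrightarrow> \<exists>w. g = word_eval G (gens a b) w"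
    by (rule iso_presented_groupE) blast
  have r: "a [^] m = \<one>" "b \<otimes> a = a [^] int r \<otimes> b"
    using finite_kernel_relations_iff[OF ab, of m r] rel by auto
  obtain r' where r': "[r' * r = 1] (mod m)" using modular_inverse_exists[OF assms(2)] by blast
  show ?thesis
  proof (rule that[OF ab r])
    show "carrier G = {a [^] (k::int) \<otimes> b [^] (j::int) | k j. True}"
    proof
      show "carrier G \<subseteq> {a [^] (k::int) \<otimes> b [^] (j::int) | k j. True}"
      proof
        fix g assume "g \<in> carrier G"
        then obtain w where w: "g = word_eval G (gens a b) w" using gen by blast
        obtain k j :: int where "word_eval G (gens a b) w = a [^] k \<otimes> b [^] j"
          by (rule word_eval_normal_form[OF ab r(2) inverse_relation_finite[OF ab r(2) r(1) r']])
        then show "g \<in> {a [^] (k::int) \<otimes> b [^] (j::int) | k j. True}" using w by blast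
      qed
    qed (use ab in auto)
  qed
qed

end

lemma iso_infinite_kernel_group:
  fixes G (structure)
  assumes "normal_form G a b 0 n (-1)"
  shows "G \<cong> infinite_kernel_group n"
proof -
  interpret normal_form G a b 0 n "-1" by fact
  let ?R = "infinite_kernel_relations n"
  interpret P: group "presented_group ?R" by (rule group_presented_group)
  let ?\<alpha> = "word_class ?R [letter_a]" and ?\<beta> = "word_class ?R [letter_b]"
  have ab: "?\<alpha> \<in> carrier (presented_group ?R)" "?\<beta> \<in> carrier (presented_group ?R)"
    by (simp_all add: carrier_presented_group)
  have gens: "(\<lambda>x. word_class ?R [(x, True)]) = gens ?\<alpha> ?\<beta>"
  proof
    show "word_class ?R [(x, True)] = gens ?\<alpha> ?\<beta> x" for x by (cases x) simp_all
  qed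
  have "\<forall>(u, v)\<in>?R. word_eval (presented_group ?R) (gens ?\<alpha> ?\<beta>) u = word_eval (presented_group ?R) (gens ?\<alpha> ?\<beta>) v"
    using presented_group_relation[of _ _ ?R] unfolding gens by blast
  then have rels: "?\<beta> [^]\<^bsub>presented_group ?R\<^esub> n = \<one>\<^bsub>presented_group ?R\<^esub>"
    "?\<beta> \<otimes>\<^bsub>presented_group ?R\<^esub> ?\<alpha> = ?\<alpha> [^]\<^bsub>presented_group ?R\<^esub> (-1::int) \<otimes>\<^bsub>presented_group ?R\<^esub> ?\<beta>"
    unfolding P.infinite_kernel_relations_iff[OF ab] by blast+
  have "b [^] n = \<one>" using trivial_iff[of 0 "int n"] by (simp add: int_pow_int)
  then have "\<forall>(u, v)\<in>?R. word_eval G (gens a b) u = word_eval G (gens a b) v"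
    unfolding infinite_kernel_relations_iff[OF a_closed b_closed] using rel by blast
  then have "G \<cong> presented_group ?R"
    using rels P.inverse_relation_infinite[OF ab rels(2)] by (intro iso_presented_group) auto
  then show ?thesis by (simp add: infinite_kernel_group_def infinite_kernel_relations_def)
qed

lemma iso_finite_kernel_group:
  fixes G (structure)
  assumes "normal_form G a b m 0 (int r)" "coprime r m"
  shows "G \<cong> finite_kernel_group m r"
proof -
  interpret normal_form G a b m 0 "int r" by fact
  let ?R = "finite_kernel_relations m r"
  interpret P: group "presented_group ?R" by (rule group_presented_group)
  let ?\<alpha> = "word_class ?R [letter_a]" and ?\<beta> = "word_class ?R [letter_b]"
  have ab: "?\<alpha> \<in> carrier (presented_group ?R)" "?\<beta> \<in> carrier (presented_group ?R)"
    by (simp_all add: carrier_presented_group)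
  have gens: "(\<lambda>x. word_class ?R [(x, True)]) = gens ?\<alpha> ?\<beta>"
  proof
    show "word_class ?R [(x, True)] = gens ?\<alpha> ?\<beta> x" for x by (cases x) simp_all
  qed
  have "\<forall>(u, v)\<in>?R. word_eval (presented_group ?R) (gens ?\<alpha> ?\<beta>) u = word_eval (presented_group ?R) (gens ?\<alpha> ?\<beta>) v"
    using presented_group_relation[of _ _ ?R] unfolding gens by blast
  then have rels: "?\<alpha> [^]\<^bsub>presented_group ?R\<^esub> m = \<one>\<^bsub>presented_group ?R\<^esub>"
    "?\<beta> \<otimes>\<^bsub>presented_group ?R\<^esub> ?\<alpha> = ?\<alpha> [^]\<^bsub>presented_group ?R\<^esub> int r \<otimes>\<^bsub>presented_group ?R\<^esub> ?\<beta>"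
    unfolding P.finite_kernel_relations_iff[OF ab] by blast+
  obtain r' where r': "[r' * r = 1] (mod m)" using modular_inverse_exists[OF assms(2)] by blast
  have "a [^] m = \<one>" using trivial_iff[of "int m" 0] by (simp add: int_pow_int)
  then have "\<forall>(u, v)\<in>?R. word_eval G (gens a b) u = word_eval G (gens a b) v"
    unfolding finite_kernel_relations_iff[OF a_closed b_closed] using rel by blast
  then have "G \<cong> presented_group ?R"
    using rels P.inverse_relation_finite[OF ab rels(2,1) r'] by (intro iso_presented_group) auto
  then show ?thesis by (simp add: finite_kernel_group_def finite_kernel_relations_def)
qed

section \<open>Infinite metacyclic groups\<close>

context group
begin

lemma comm_group_if_generators_commute:
  assumes ab: "a \<in> carrier G" "b \<in> carrier G" "b \<otimes> a = a \<otimes> b"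
    and gen: "carrier G = {a [^] (k::int) \<otimes> b [^] (j::int) | k j. True}"
  shows "comm_group G"
proof (rule group_comm_groupI)
  have ba: "b \<otimes> a [^] k = a [^] k \<otimes> b" for k :: int
    using conj_int_pow[of a b 1 k] ab by simp
  have comm: "a [^] k \<otimes> b [^] j = b [^] j \<otimes> a [^] k" for k j :: int
    using conj_int_pow[of b "a [^] k" 1 j] ba[of k] ab by simp
  fix x y assume "x \<in> carrier G" "y \<in> carrier G"
  then obtain k j k' j' :: int where x: "x = a [^] k \<otimes> b [^] j" and y: "y = a [^] k' \<otimes> b [^] j'"
    using gen by auto
  have "x \<otimes> y = a [^] k \<otimes> (b [^] j \<otimes> a [^] k') \<otimes> b [^] j'" using ab by (simp add: x y m_assoc)
  also have "\<dots> = a [^] k \<otimes> (a [^] k' \<otimes> b [^] j) \<otimes> b [^] j'" by (simp only: comm)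
  also have "\<dots> = a [^] (k + k') \<otimes> b [^] (j + j')" using ab by (simp add: int_pow_mult m_assoc)
  also have "\<dots> = a [^] (k' + k) \<otimes> b [^] (j' + j)" by (simp add: add.commute)
  also have "\<dots> = a [^] k' \<otimes> (a [^] k \<otimes> b [^] j') \<otimes> b [^] j" using ab by (simp add: int_pow_mult m_assoc)
  also have "\<dots> = a [^] k' \<otimes> (b [^] j' \<otimes> a [^] k) \<otimes> b [^] j" by (simp only: comm)
  also have "\<dots> = y \<otimes> x" using ab by (simp add: x y m_assoc)
  finally show "x \<otimes> y = y \<otimes> x" .
qed

text \<open>If a positive power of b were a power of a, the exponents of both generators could be
  reduced to finite ranges and G would be finite.\<close>

lemma normal_form_finite_kernel:
  assumes inf: "infinite (carrier G)" and ab: "a \<in> carrier G" "b \<in> carrier G" "b \<otimes> a = a [^] (r::int) \<otimes> b"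
    and gen: "carrier G = {a [^] (k::int) \<otimes> b [^] (j::int) | k j. True}" and ord: "ord a > 0"
  shows "normal_form G a b (ord a) 0 r"
proof
  \<comment> \<open>One-sided on purpose: it is applied to j and to -j, which together give j =
    0.\<close>
  have b_free: "j \<le> 0" if eq: "b [^] j = a [^] k" for k j :: int
  proof (rule ccontr)
    assume "\<not> j \<le> 0"
    have "carrier G \<subseteq> (\<lambda>(k, j). a [^] k \<otimes> b [^] j) ` ({0..<int (ord a)} \<times> {0..<j})"
    proof
      fix g assume "g \<in> carrier G"
      then obtain k' j' :: int where g: "g = a [^] k' \<otimes> b [^] j'" using gen by auto
      have "b [^] (j * (j' div j)) = (a [^] k) [^] (j' div j)"
        using int_pow_pow[of b j "j' div j"] ab(2) eq by simp
      then have "b [^] j' = (a [^] k) [^] (j' div j) \<otimes> b [^] (j' mod j)"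
        using int_pow_mult[OF ab(2), of "j * (j' div j)" "j' mod j"] by simp
      then have "g = a [^] (k' + k * (j' div j)) \<otimes> b [^] (j' mod j)"
        using ab by (simp add: g int_pow_pow int_pow_mult m_assoc)
      also have "a [^] (k' + k * (j' div j)) = a [^] ((k' + k * (j' div j)) mod int (ord a))"
        using ab(1) by (subst int_pow_eq) (simp_all add: mod_eq_dvd_iff[symmetric])
      finally show "g \<in> (\<lambda>(k, j). a [^] k \<otimes> b [^] j) ` ({0..<int (ord a)} \<times> {0..<j})"
        using ord \<open>\<not> j \<le> 0\<close> by (auto intro!: image_eqI[of _ _ "((k' + k * (j' div j)) mod int (ord a), j' mod j)"])
    qed
    then have "finite (carrier G)" by (rule finite_subset) simp
    with inf show False by simp
  qed
  show "a [^] k \<otimes> b [^] j = \<one> \<longleftrightarrow> int (ord a) dvd k \<and> int 0 dvd j" for k j :: int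
  proof
    assume eq: "a [^] k \<otimes> b [^] j = \<one>"
    then have "b [^] j = a [^] (- k)"
      using ab by (metis int_pow_closed int_pow_neg inv_equality inv_inv)
    moreover from this have "b [^] (- j) = a [^] k"
      using ab by (simp add: int_pow_neg)
    ultimately have "j = 0" using b_free[of j "- k"] b_free[of "- j" k] by simp
    then show "int (ord a) dvd k \<and> int 0 dvd j" using eq ab by (simp add: int_pow_eq_id)
  next
    assume "int (ord a) dvd k \<and> int 0 dvd j"
    then show "a [^] k \<otimes> b [^] j = \<one>" using ab int_pow_eq_id[of a k] by simp
  qed
qed (use ab gen in auto)

text \<open>A power of b lying in <a> commutes with b but is also inverted by it; as a has infinite
  order, it is trivial.\<close>

lemma normal_form_infinite_kernel:
  assumes ab: "a \<in> carrier G" "b \<in> carrier G" "b \<otimes> a = a [^] (-1::int) \<otimes> b"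
    and gen: "carrier G = {a [^] (k::int) \<otimes> b [^] (j::int) | k j. True}" and ord: "ord a = 0"
  shows "normal_form G a b 0 (ord b) (-1)"
proof
  show "a [^] k \<otimes> b [^] j = \<one> \<longleftrightarrow> int 0 dvd k \<and> int (ord b) dvd j" for k j :: int
  proof
    assume eq: "a [^] k \<otimes> b [^] j = \<one>"
    then have bj: "b [^] j = a [^] (- k)"
      using ab by (metis int_pow_closed int_pow_neg inv_equality inv_inv)
    have "b \<otimes> b [^] j = b [^] j \<otimes> b"
      using int_pow_mult[of b 1 j] int_pow_mult[of b j 1] ab(2) by (simp add: add.commute)
    then have "a [^] k \<otimes> b = a [^] (- k) \<otimes> b"
      using conj_int_pow[OF ab, of "- k"] by (simp add: bj)
    then have "a [^] k = a [^] (- k)" using ab by simp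
    then have "k = 0" using ab(1) by (simp add: int_pow_eq ord)
    then show "int 0 dvd k \<and> int (ord b) dvd j" using eq ab by (simp add: int_pow_eq_id)
  next
    assume "int 0 dvd k \<and> int (ord b) dvd j"
    then show "a [^] k \<otimes> b [^] j = \<one>" using ab int_pow_eq_id[of b j] by simp
  qed
qed (use ab gen in auto)

text \<open>An odd power of b inverts a, so it cannot be trivial when a has infinite order.\<close>

lemma even_ord_b:
  assumes "normal_form G a b 0 n (-1)"
  shows "even n"
proof (rule ccontr)
  interpret normal_form G a b 0 n "-1" by fact
  assume "odd n"
  have "b [^] n = \<one>" using trivial_iff[of 0 "int n"] by (simp add: int_pow_int)
  then have "a = a [^] (-1::int)" using b_pow_a[of n] \<open>odd n\<close> by simp
  then have "a [^] (1::int) \<otimes> b [^] (0::int) = a [^] (-1::int) \<otimes> b [^] (0::int)" by simp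
  then show False unfolding eq_iff by simp
qed

text \<open>Normality applies to conjugation by the inverse of b as well. This yields s', an inverse
  of s modulo the order of a; for infinite order the divisibility reads s s' = 1.\<close>

lemma metacyclic_generators:
  assumes "metacyclic G"
  obtains a b s s' where "a \<in> carrier G" "b \<in> carrier G" "b \<otimes> a = a [^] (s::int) \<otimes> b"
    "int (ord a) dvd s * s' - 1"
    "carrier G = {a [^] (k::int) \<otimes> b [^] (j::int) | k j. True}"
proof -
  obtain N where N: "N \<lhd> G" "cyclic_group (G\<lparr>carrier := N\<rparr>)" "cyclic_group (G Mod N)"
    using assms by (auto simp: metacyclic_def)
  interpret N: normal N G by (rule N(1))
  interpret Q: group "G Mod N" by (rule N.factorgroup_is_group)
  have sub: "subgroup N G" by (rule N.subgroup_axioms)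
  interpret NG: group "G\<lparr>carrier := N\<rparr>" by (rule subgroup_imp_group[OF sub])
  obtain a where a: "a \<in> N" "N = range (\<lambda>k::int. a [^]\<^bsub>G\<lparr>carrier := N\<rparr>\<^esub> k)"
    using N(2) NG.cyclic_group by auto
  then have Na: "N = range (\<lambda>k::int. a [^] k)" using int_pow_consistent[OF sub a(1)] by simp
  have ac: "a \<in> carrier G" using a(1) sub by (simp add: subgroup.mem_carrier)
  obtain B where B: "B \<in> carrier (G Mod N)" "carrier (G Mod N) = range (\<lambda>j::int. B [^]\<^bsub>G Mod N\<^esub> j)"
    using N(3) Q.cyclic_group by auto
  then obtain b where b: "b \<in> carrier G" "B = N #> b" by (auto simp: FactGroup_def RCOSETS_def)
  interpret q: group_hom G "G Mod N" "\<lambda>x. N #> x"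
    by (rule group_hom.intro) (simp_all add: group_hom_axioms_def is_group Q.is_group N.r_coset_hom_Mod)
  have gen: "carrier G = {a [^] (k::int) \<otimes> b [^] (j::int) | k j. True}"
  proof
    show "carrier G \<subseteq> {a [^] (k::int) \<otimes> b [^] (j::int) | k j. True}"
    proof
      fix g assume g: "g \<in> carrier G"
      then have "N #> g \<in> carrier (G Mod N)" by simp
      then obtain j :: int where "N #> g = B [^]\<^bsub>G Mod N\<^esub> j" using B(2) by auto
      also have "\<dots> = N #> b [^] j" using b by (simp add: q.hom_int_pow)
      finally have "g \<in> N #> b [^] j" using g rcos_self[OF g sub] by simp
      then obtain k :: int where "g = a [^] k \<otimes> b [^] j" using Na by (auto simp: r_coset_def)
      then show "g \<in> {a [^] (k::int) \<otimes> b [^] (j::int) | k j. True}" by blast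
    qed
  qed (use ac b in auto)
  have "b \<otimes> a \<otimes> inv b \<in> N" using N.inv_op_closed2[OF b(1) a(1)] .
  then obtain s :: int where "b \<otimes> a \<otimes> inv b = a [^] s" using Na by auto
  then have "b \<otimes> a \<otimes> inv b \<otimes> b = a [^] s \<otimes> b" by simp
  then have s: "b \<otimes> a = a [^] s \<otimes> b" using ac b(1) by (simp add: m_assoc)
  have "inv b \<otimes> a \<otimes> b \<in> N" using N.inv_op_closed1[OF b(1) a(1)] .
  then obtain s' :: int where "inv b \<otimes> a \<otimes> b = a [^] s'" using Na by auto
  then have "b \<otimes> (inv b \<otimes> a \<otimes> b) = b \<otimes> a [^] s'" by simp
  then have "a \<otimes> b = b \<otimes> a [^] s'" using ac b(1) by (simp add: m_assoc[symmetric])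
  also have "\<dots> = a [^] (s * s') \<otimes> b" by (rule conj_int_pow[OF ac b(1) s])
  finally have "a [^] (1::int) = a [^] (s * s')" using ac b(1) by simp
  then have "int (ord a) dvd s * s' - 1" using ac by (simp only: int_pow_eq)
  then show ?thesis using that[OF ac b(1) s _ gen] by blast
qed

text \<open>If a has infinite order, s is 1 or -1, and 1 would make G abelian. Otherwise s is
  reduced to r modulo the order m, and m >= 3 follows because r lies below m and is neither 0 nor
  1.\<close>

lemma infinite_metacyclic_cases:
  assumes "infinite (carrier G)" "\<not> comm_group G" "metacyclic G"
  obtains a b n where "normal_form G a b 0 n (-1)" "even n"
  | a b m r where "normal_form G a b m 0 (int r)" "m \<ge> 3" "r \<in> totatives m" "r \<noteq> 1"
proof -
  obtain a b s s' where ab: "a \<in> carrier G" "b \<in> carrier G" "b \<otimes> a = a [^] (s::int) \<otimes> b"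
    and s': "int (ord a) dvd s * s' - 1"
    and gen: "carrier G = {a [^] (k::int) \<otimes> b [^] (j::int) | k j. True}"
    by (rule metacyclic_generators[OF assms(3)])
  have noncomm: "b \<otimes> a \<noteq> a \<otimes> b"
    using comm_group_if_generators_commute[OF ab(1,2) _ gen] assms(2) by blast
  show ?thesis
  proof (cases "ord a = 0")
    case True
    then have "s * s' = 1" using s' by simp
    then have "s = 1 \<or> s = -1" by (simp add: zmult_eq_1_iff) blast
    moreover have "s \<noteq> 1" using noncomm ab by auto
    ultimately have "s = -1" by blast
    then have "normal_form G a b 0 (ord b) (-1)" using normal_form_infinite_kernel[of a b] ab gen True by simp
    then show ?thesis using that(1) even_ord_b by blast
  next
    case False
    define m where "m = ord a"
    define r where "r = nat (s mod int m)"
    have m: "m > 0" using False by (simp add: m_def)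
    have r: "int r = s mod int m" using m by (simp add: r_def)
    have "a [^] int r = a [^] s" using ab(1) by (simp add: int_pow_eq r m_def mod_eq_dvd_iff[symmetric])
    then have ba: "b \<otimes> a = a [^] int r \<otimes> b" using ab(3) by simp
    have nf: "normal_form G a b m 0 (int r)"
      unfolding m_def using False by (intro normal_form_finite_kernel assms(1) ab(1,2) ba gen) simp
    have neq: "a [^] int r \<noteq> a [^] (1::int)" using noncomm ba ab(1) by auto
    then have ndvd: "\<not> int m dvd 1 - int r" using ab(1) by (metis int_pow_eq m_def)
    have "int m dvd int r * s' - 1"
    proof -
      have "(int r * s') mod int m = (s * s') mod int m" by (simp add: r mod_mult_left_eq)
      then have "int m dvd int r * s' - s * s'" by (simp add: mod_eq_dvd_iff)
      then have "int m dvd (int r * s' - s * s') + (s * s' - 1)" using s' unfolding m_def by (rule dvd_add)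
      then show ?thesis by simp
    qed
    then obtain q where q: "int r * s' - 1 = int m * q" ..
    have cop: "coprime r m"
    proof -
      have "coprime (int r) (int m)"
      proof (rule coprimeI)
        fix c assume "c dvd int r" "c dvd int m"
        then have "c dvd int r * s' - int m * q" by simp
        also have "int r * s' - int m * q = 1" using q by simp
        finally show "is_unit c" .
      qed
      then show ?thesis by simp
    qed
    have "r < m" using m by (simp add: r_def nat_less_iff)
    have "m \<noteq> 1" using ndvd by auto
    then have "r \<noteq> 0" using cop by (intro notI) simp
    have "r \<noteq> 1" using ndvd by auto
    then have "m \<ge> 3" using \<open>r < m\<close> \<open>r \<noteq> 0\<close> by simp
    moreover have "r \<in> totatives m" using \<open>r \<noteq> 0\<close> \<open>r < m\<close> cop by (simp add: totatives_def)
    ultimately show ?thesis using that(2) nf \<open>r \<noteq> 1\<close> by blast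
  qed
qed

end

text \<open>A model of \<open>\<langle>a, b | ba = a\<^sup>-\<^sup>1b\<rangle>\<close>, which shows that \<open>a\<close> and \<open>b\<close> have infinite order there.\<close>

definition klein_bottle_group :: "(int \<times> int) monoid" where
  "klein_bottle_group = \<lparr>carrier = UNIV,
     monoid.mult = (\<lambda>(k, j) (k', j'). (k + (if even j then k' else - k'), j + j')),
     one = (0, 0)\<rparr>"

lemma klein_bottle_group_simps [simp]:
  "carrier klein_bottle_group = UNIV" "\<one>\<^bsub>klein_bottle_group\<^esub> = (0, 0)"
  "(k, j) \<otimes>\<^bsub>klein_bottle_group\<^esub> (k', j') = (k + (if even j then k' else - k'), j + j')"
  by (simp_all add: klein_bottle_group_def)

lemma group_klein_bottle_group: "group klein_bottle_group"
proof (rule groupI)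
  fix x assume "x \<in> carrier klein_bottle_group"
  obtain k j where x: "x = (k, j)" by (cases x)
  show "\<exists>y\<in>carrier klein_bottle_group. y \<otimes>\<^bsub>klein_bottle_group\<^esub> x = \<one>\<^bsub>klein_bottle_group\<^esub>"
    by (rule bexI[of _ "(if even j then - k else k, - j)"]) (simp_all add: x)
qed (auto simp: split_paired_all)

lemma klein_bottle_group_pow:
  "(1, 0) [^]\<^bsub>klein_bottle_group\<^esub> (k::int) \<otimes>\<^bsub>klein_bottle_group\<^esub> (0, 1) [^]\<^bsub>klein_bottle_group\<^esub> (j::int) = (k, j)"
proof -
  let ?K = klein_bottle_group
  interpret K: group ?K by (rule group_klein_bottle_group)
  have hom: "(\<lambda>k. (k, 0)) \<in> hom integer_group ?K" "(\<lambda>j. (0, j)) \<in> hom integer_group ?K"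
    by (auto intro!: homI)
  interpret fst: group_hom integer_group ?K "\<lambda>k. (k, 0)"
    by (rule group_hom.intro) (simp_all add: group_hom_axioms_def K.is_group hom)
  interpret snd: group_hom integer_group ?K "\<lambda>j. (0, j)"
    by (rule group_hom.intro) (simp_all add: group_hom_axioms_def K.is_group hom)
  have "(1, 0) [^]\<^bsub>?K\<^esub> k = (k, 0)" "(0, 1) [^]\<^bsub>?K\<^esub> j = (0, j)"
    using fst.hom_int_pow[of 1 k] snd.hom_int_pow[of 1 j] by simp_all
  then show ?thesis by simp
qed

section \<open>From the listed presentations to the cut property\<close>

lemma (in group) cut_group_iso_klein_bottle:
  assumes "G \<cong> infinite_kernel_group 0"
  shows "cut_group G"
proof -
  let ?K = klein_bottle_group
  interpret K: group ?K by (rule group_klein_bottle_group)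
  obtain a b where ab: "a \<in> carrier G" "b \<in> carrier G" "b \<otimes> a = a [^] (-1::int) \<otimes> b"
    and gen: "carrier G = {a [^] (k::int) \<otimes> b [^] (j::int) | k j. True}"
    and univ: "\<And>(H :: (int \<times> int) monoid) c d. group H \<Longrightarrow> c \<in> carrier H \<Longrightarrow> d \<in> carrier H \<Longrightarrow>
      d [^]\<^bsub>H\<^esub> (0::nat) = \<one>\<^bsub>H\<^esub> \<Longrightarrow> d \<otimes>\<^bsub>H\<^esub> c = c [^]\<^bsub>H\<^esub> (-1::int) \<otimes>\<^bsub>H\<^esub> d \<Longrightarrow> \<exists>\<psi>\<in>hom G H. \<psi> a = c \<and> \<psi> b = d"
    by (rule iso_infinite_kernel_groupE[OF assms]) blast
  have "(0, 1) \<otimes>\<^bsub>?K\<^esub> (1, 0) = (-1, 1)" by simp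
  also have "\<dots> = (1, 0) [^]\<^bsub>?K\<^esub> (-1::int) \<otimes>\<^bsub>?K\<^esub> (0, 1)"
    using klein_bottle_group_pow[of "-1" 1] K.int_pow_1[of "(0, 1)"] by simp
  finally have "\<exists>\<psi>\<in>hom G ?K. \<psi> a = (1, 0) \<and> \<psi> b = (0, 1)"
    by (intro univ[OF group_klein_bottle_group]) simp_all
  then obtain \<psi> where \<psi>: "\<psi> \<in> hom G ?K" "\<psi> a = (1, 0)" "\<psi> b = (0, 1)" by blast
  interpret \<psi>: group_hom G ?K \<psi>
    by (rule group_hom.intro) (simp_all add: group_hom_axioms_def is_group K.is_group \<psi>(1))
  have "normal_form G a b 0 0 (-1)"
  proof
    show "a [^] k \<otimes> b [^] j = \<one> \<longleftrightarrow> int 0 dvd k \<and> int 0 dvd j" for k j :: int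
    proof
      assume "a [^] k \<otimes> b [^] j = \<one>"
      then have "\<psi> (a [^] k \<otimes> b [^] j) = \<one>\<^bsub>?K\<^esub>" by simp
      then have "(k, j) = \<one>\<^bsub>?K\<^esub>"
        using ab by (simp add: \<psi>.hom_int_pow \<psi>(2,3) klein_bottle_group_pow del: klein_bottle_group_simps(3))
      then show "int 0 dvd k \<and> int 0 dvd j" by simp
    qed simp
  qed (use ab gen in auto)
  then show ?thesis by (intro normal_form.cut_group_torsion_free) auto
qed

text \<open>The exact order of b is never computed. It is an even divisor 2 k of n, and for every n
  listed all such k lie in {1, 2, 3, 4, 6}.\<close>

lemma (in group) cut_group_iso_infinite_kernel:
  assumes "infinite (carrier G)" and iso: "G \<cong> infinite_kernel_group n" and n: "n \<in> {2, 4, 6, 8, 12}"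
  shows "cut_group G"
proof -
  obtain a b where ab: "a \<in> carrier G" "b \<in> carrier G" "b \<otimes> a = a [^] (-1::int) \<otimes> b"
    and bn: "b [^] n = \<one>" and gen: "carrier G = {a [^] (k::int) \<otimes> b [^] (j::int) | k j. True}"
    by (rule iso_infinite_kernel_groupE[OF iso])
  \<comment> \<open>If a had finite order, b would have infinite order because G is infinite,
    against b^n = 1 with n > 0.\<close>
  have "ord a = 0"
  proof (rule ccontr)
    assume "ord a \<noteq> 0"
    then interpret normal_form G a b "ord a" 0 "-1"
      by (intro normal_form_finite_kernel assms(1) ab gen) simp
    have "n = 0" using bn trivial_iff[of 0 "int n"] by (simp add: int_pow_int)
    with n show False by simp
  qed
  then interpret nf: normal_form G a b 0 "ord b" "-1"
    by (intro normal_form_infinite_kernel ab gen)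
  have "ord b dvd n" using bn ab(2) by (simp add: pow_eq_id)
  moreover have "even (ord b)" using even_ord_b nf.normal_form_axioms by blast
  then obtain k where k: "ord b = 2 * k" by (rule evenE)
  ultimately have "2 * k dvd n" by simp
  moreover from this have "k dvd n" by (rule dvd_mult_right)
  then have "k > 0" "k \<le> n" using n by (auto intro!: dvd_imp_le Nat.gr0I)
  ultimately have "k \<in> {1, 2, 3, 4, 6}"
  proof -
    have "\<forall>n\<in>{2, 4, 6, 8, 12}. \<forall>k\<in>set [1..<13]. 2 * k dvd n \<longrightarrow> k \<in> {1, 2, 3, 4, 6::nat}"
      by code_simp
    moreover have "k \<in> set [1..<13]" using \<open>k > 0\<close> \<open>k \<le> n\<close> n by auto
    ultimately show ?thesis using n \<open>2 * k dvd n\<close> by blast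
  qed
  then have "units_generated k 1" by (rule units_generated_1)
  then show ?thesis using nf.cut_group_infinite_kernel[OF _ _ k \<open>k > 0\<close>] by simp
qed

text \<open>
  The exact order of \<open>a\<close> in \<open>\<langle>a, b | a\<^sup>m = 1, ba = a\<^sup>rb\<rangle>\<close> does not matter: it divides \<open>m\<close>, and
  \<open>U(m)\<close> maps onto \<open>U(m')\<close> for every divisor \<open>m'\<close>.
\<close>

lemma units_generated_dvd:
  assumes "units_generated m r" "m' dvd m" "m > 0"
  shows "units_generated m' r"
  unfolding units_generated_def
proof (intro allI impI)
  fix u assume u: "coprime u m'"
  have m': "m' > 0" "m' \<le> m" using assms(2,3) by (auto intro: dvd_pos_nat dvd_imp_le)
  \<comment> \<open>A lift of u to a unit modulo m: a number congruent to u whose prime factors all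
    exceed m is coprime to m.\<close>
  obtain k where k: "[k = u] (mod m')" "k > 0" "\<And>p. prime p \<Longrightarrow> p dvd k \<Longrightarrow> p > m"
    using cong_with_large_prime_factors[OF m'(1) u] by metis
  have "coprime k m"
  proof (rule ccontr)
    assume "\<not> coprime k m"
    then obtain p where "prime p" "p dvd k" "p dvd m"
      by (metis coprime_iff_gcd_eq_1 gcd_dvd1 gcd_dvd2 prime_factor_nat dvd_trans)
    then show False using k(3)[of p] assms(3) by (metis dvd_imp_le not_less)
  qed
  then obtain i where i: "[k = r ^ i] (mod m) \<or> [k = (m - 1) * r ^ i] (mod m)"
    using assms(1) by (auto simp: units_generated_def)
  have "[m - 1 = m' - 1] (mod m')"
  proof -
    have "[m - 1 + 1 = m' - 1 + 1] (mod m')"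
      using assms(2,3) m' by (simp add: cong_mod_def)
    then show ?thesis by (simp only: cong_add_rcancel_nat)
  qed
  then have "[(m - 1) * r ^ i = (m' - 1) * r ^ i] (mod m')" by (intro cong_mult cong_refl)
  then have "[k = r ^ i] (mod m') \<or> [k = (m' - 1) * r ^ i] (mod m')"
    using i cong_dvd_modulus_nat[OF _ assms(2)] by (meson cong_trans)
  then show "\<exists>i. [u = r ^ i] (mod m') \<or> [u = (m' - 1) * r ^ i] (mod m')"
    using k(1) by (meson cong_sym cong_trans)
qed

lemma (in group) cut_group_iso_finite_kernel:
  assumes "infinite (carrier G)" and iso: "G \<cong> finite_kernel_group m r"
    and m: "m > 0" and r: "coprime r m" "units_generated m r"
  shows "cut_group G"
proof -
  obtain a b where ab: "a \<in> carrier G" "b \<in> carrier G" "b \<otimes> a = a [^] int r \<otimes> b"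
    and am: "a [^] m = \<one>" and gen: "carrier G = {a [^] (k::int) \<otimes> b [^] (j::int) | k j. True}"
    by (rule iso_finite_kernel_groupE[OF iso r(1)])
  have dvd: "ord a dvd m" using am ab(1) by (simp add: pow_eq_id)
  then have ord: "ord a > 0" using m by (rule dvd_pos_nat[rotated])
  interpret normal_form G a b "ord a" 0 "int r"
    by (rule normal_form_finite_kernel[OF assms(1) ab gen ord])
  have "coprime r (ord a)" using r(1) dvd by (metis coprime_divisors dvd_refl)
  moreover have "units_generated (ord a) r" by (rule units_generated_dvd[OF r(2) dvd m])
  ultimately show ?thesis using cut_group_finite_kernel[OF _ ord] by simp
qed

text \<open>One direction builds each unit from r and -1; the other shows by induction over
  \<open>generate\<close> that only the classes of r^i and -r^i occur.\<close>

lemma units_generated_iff_generate: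
  assumes m: "m \<ge> 3" and r: "r \<in> totatives m"
  shows "carrier (units_of (residue_ring (int m))) =
      generate (units_of (residue_ring (int m))) {(-1) mod int m, int r} \<longleftrightarrow> units_generated m r"
proof -
  interpret R: residues "int m" "residue_ring (int m)" by unfold_locales (use m in auto)
  let ?U = "units_of (residue_ring (int m))"
  interpret U: group ?U by (rule R.units_group)
  have car: "carrier ?U = {x. 0 < x \<and> x < int m \<and> coprime x (int m)}"
    by (simp add: units_of_carrier R.res_units_eq)
  have mult: "x \<otimes>\<^bsub>?U\<^esub> y = (x * y) mod int m" for x y
    by (simp add: units_of_mult residue_ring_def)
  have one_U: "\<one>\<^bsub>?U\<^esub> = 1" by (simp add: units_of_one residue_ring_def)
  have m1: "(-1) mod int m = int m - 1" using m by (simp add: zmod_minus1)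
  have gens: "{(-1) mod int m, int r} \<subseteq> carrier ?U"
  proof -
    have "coprime (int m - 1) (int m)" by (simp add: coprime_diff_one_left)
    moreover have "0 < r" "r < m" "coprime r m"
      using r m by (auto simp: totatives_def intro: le_neq_implies_less)
    ultimately show ?thesis using m by (auto simp: car m1)
  qed
  show ?thesis
  proof
    assume gen: "units_generated m r"
    have pow: "int (r ^ i mod m) \<in> generate ?U {(-1) mod int m, int r}" for i
    proof (induction i)
      case 0
      have "int (r ^ 0 mod m) = \<one>\<^bsub>?U\<^esub>" using m by (simp add: one_U)
      then show ?case using generate.one[of ?U] by simp
    next
      case (Suc i)
      have "int (r ^ Suc i mod m) = int r \<otimes>\<^bsub>?U\<^esub> int (r ^ i mod m)"
        by (simp add: mult zmod_int mod_mult_right_eq)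
      then show ?case using generate.eng[OF generate.incl Suc] by simp
    qed
    have "carrier ?U \<subseteq> generate ?U {(-1) mod int m, int r}"
    proof
      fix x assume x: "x \<in> carrier ?U"
      then have x': "x = int (nat x)" "nat x < m" "coprime (nat x) m"
        by (auto simp: car) (metis coprime_int_iff int_nat_eq order_less_imp_le)
      then obtain i where "[nat x = r ^ i] (mod m) \<or> [nat x = (m - 1) * r ^ i] (mod m)"
        using gen by (auto simp: units_generated_def)
      then have "nat x = r ^ i mod m \<or> nat x = (m - 1) * r ^ i mod m"
        using x'(2) by (simp add: cong_mod_def)
      then show "x \<in> generate ?U {(-1) mod int m, int r}"
      proof
        assume "nat x = r ^ i mod m"
        then show ?thesis using pow[of i] x'(1) by simp
      next
        assume "nat x = (m - 1) * r ^ i mod m"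
        then have "x = int ((m - 1) * r ^ i mod m)" using x'(1) by simp
        also have "\<dots> = ((-1) mod int m) \<otimes>\<^bsub>?U\<^esub> int (r ^ i mod m)"
          using m by (simp add: mult m1 zmod_int mod_mult_right_eq of_nat_diff)
        finally show ?thesis using generate.eng[OF generate.incl pow[of i], of "(-1) mod int m"] by simp
      qed
    qed
    then show "carrier ?U = generate ?U {(-1) mod int m, int r}"
      using U.generate_incl[OF gens] by blast
  next
    assume gen: "carrier ?U = generate ?U {(-1) mod int m, int r}"
    let ?P = "\<lambda>x. \<exists>i. [x = int r ^ i] (mod int m) \<or> [x = - (int r ^ i)] (mod int m)"
    have cop: "coprime r m" using r by (simp add: totatives_def)
    have minus1: "[(-1) mod int m = -1] (mod int m)" by simp
    have P: "?P x" if "x \<in> generate ?U {(-1) mod int m, int r}" for x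
      using that
    proof induction
      case one
      show ?case by (intro exI[of _ 0]) (simp add: one_U)
    next
      case (incl h)
      then have "h = (-1) mod int m \<or> h = int r" by simp
      then show ?case
      proof
        assume "h = (-1) mod int m"
        then show ?case using minus1 by (intro exI[of _ 0]) simp
      next
        assume "h = int r"
        then show ?case by (intro exI[of _ 1]) simp
      qed
    next
      case (inv h)
      define y where "y = inv\<^bsub>?U\<^esub> h"
      have h: "h \<in> carrier ?U" using inv gens by blast
      have "(h * y) mod int m = 1" using U.r_inv[OF h] by (simp add: mult one_U y_def)
      then have hy: "[h * y = 1] (mod int m)"
        using m by (simp add: cong_mod_def)
      \<comment> \<open>Inverting a generator does not leave the set: the inverse of r is r^(totient
        m - 1) by Euler's theorem, and -1 is its own inverse.\<close>
      have "?P y"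
      proof (cases "h = int r")
        case True
        have "[int r ^ totient m = 1] (mod int m)"
          using euler_theorem[OF cop] by (metis cong_int_iff of_nat_1 of_nat_power)
        then have "[int r ^ totient m * y = 1 * y] (mod int m)" by (intro cong_mult cong_refl)
        moreover have "int r ^ totient m * y = int r ^ (totient m - 1) * (h * y)"
          using m True by (cases "totient m") (auto simp: mult_ac)
        moreover have "[int r ^ (totient m - 1) * (h * y) = int r ^ (totient m - 1) * 1] (mod int m)"
          using hy by (intro cong_mult cong_refl)
        ultimately have "[y = int r ^ (totient m - 1)] (mod int m)"
          by (metis cong_sym cong_trans mult_1 mult.right_neutral)
        then show ?thesis by blast
      next
        case False
        then have "[h = -1] (mod int m)" using inv minus1 by auto
        then have "[h * y = -1 * y] (mod int m)" by (intro cong_mult cong_refl)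
        then have "[- y = 1] (mod int m)" using hy by (metis cong_sym cong_trans mult_minus1)
        then have "[y = - (int r ^ 0)] (mod int m)" using cong_minus_minus_iff[of y "-1" "int m"] by simp
        then show ?thesis by blast
      qed
      then show ?case by (simp add: y_def)
    next
      case (eng x y)
      then obtain i j where i: "[x = int r ^ i] (mod int m) \<or> [x = - (int r ^ i)] (mod int m)"
        and j: "[y = int r ^ j] (mod int m) \<or> [y = - (int r ^ j)] (mod int m)" by blast
      have "[x * y = int r ^ (i + j)] (mod int m) \<or> [x * y = - (int r ^ (i + j))] (mod int m)"
        using i j cong_mult[of x "int r ^ i" "int m" y "int r ^ j"]
          cong_mult[of x "int r ^ i" "int m" y "- (int r ^ j)"]
          cong_mult[of x "- (int r ^ i)" "int m" y "int r ^ j"]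
          cong_mult[of x "- (int r ^ i)" "int m" y "- (int r ^ j)"]
        by (auto simp: power_add)
      then have "[x \<otimes>\<^bsub>?U\<^esub> y = int r ^ (i + j)] (mod int m) \<or> [x \<otimes>\<^bsub>?U\<^esub> y = - (int r ^ (i + j))] (mod int m)"
        by (simp add: mult)
      then show ?case by blast
    qed
    show "units_generated m r"
      unfolding units_generated_def
    proof (intro allI impI)
      fix u assume u: "coprime u m"
      have "coprime (u mod m) m" using u m by (simp add: coprime_mod_left_iff)
      moreover from this have "u mod m \<noteq> 0" using m by (intro notI) simp
      ultimately have "int (u mod m) \<in> carrier ?U" using m by (simp add: car)
      then obtain i where i: "[int (u mod m) = int r ^ i] (mod int m) \<or> [int (u mod m) = - (int r ^ i)] (mod int m)"
        using P gen by blast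
      have "[int (u mod m) = int u] (mod int m)" by (simp add: zmod_int)
      moreover have "[- (int r ^ i) = int ((m - 1) * r ^ i)] (mod int m)"
        using m by (simp add: cong_iff_dvd_diff of_nat_diff algebra_simps)
      ultimately have "[int u = int (r ^ i)] (mod int m) \<or> [int u = int ((m - 1) * r ^ i)] (mod int m)"
        using i by (metis cong_sym cong_trans of_nat_power)
      then show "\<exists>i. [u = r ^ i] (mod m) \<or> [u = (m - 1) * r ^ i] (mod m)"
        by (auto simp only: cong_int_iff)
    qed
  qed
qed

theorem theorem6:
  fixes G :: "('a, 'b) monoid_scheme"
  assumes "group G"
    and "infinite (carrier G)"
    and "\<not> comm_group G"
    and "metacyclic G"
  shows "cut_group G \<longleftrightarrow>
    (\<exists>n \<in> {0, 2, 4, 6, 8, 12}. G \<cong> infinite_kernel_group n) \<or>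
    (\<exists>m r. m \<ge> 3 \<and> r \<in> totatives m \<and> r \<noteq> 1 \<and>
       carrier (units_of (residue_ring (int m))) =
         generate (units_of (residue_ring (int m))) {(-1) mod int m, int r} \<and>
       G \<cong> finite_kernel_group m r)"
proof -
  interpret group G by fact
  show ?thesis
  proof
    assume cut: "cut_group G"
    show "(\<exists>n \<in> {0, 2, 4, 6, 8, 12}. G \<cong> infinite_kernel_group n) \<or>
      (\<exists>m r. m \<ge> 3 \<and> r \<in> totatives m \<and> r \<noteq> 1 \<and>
         carrier (units_of (residue_ring (int m))) =
           generate (units_of (residue_ring (int m))) {(-1) mod int m, int r} \<and>
         G \<cong> finite_kernel_group m r)"
      using assms(2-4)
    proof (cases rule: infinite_metacyclic_cases)
      case (1 a b n)
      then have iso: "G \<cong> infinite_kernel_group n" by (intro iso_infinite_kernel_group)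
      \<comment> \<open>For n = 0 the list imposes no condition; the cut property is used only for n
        > 0.\<close>
      have "n \<in> {0, 2, 4, 6, 8, 12}"
      proof (cases "n = 0")
        case False
        obtain k where k: "n = 2 * k" using \<open>even n\<close> by (rule evenE)
        with False have "k > 0" by simp
        have "units_generated k 1"
          using normal_form.cut_group_infinite_kernel[OF 1(1) _ _ k \<open>k > 0\<close>] cut by simp
        then have "k \<in> {1, 2, 3, 4, 6}" using \<open>k > 0\<close> by (rule units_generated_1_imp)
        then show ?thesis using k by auto
      qed simp
      with iso show ?thesis by blast
    next
      case (2 a b m r)
      have r: "coprime r m" "m > 0" using 2 by (auto simp: totatives_def)
      have "units_generated m r"
        using normal_form.cut_group_finite_kernel[OF 2(1) _ r(2) _ r(1)] cut by simp
      then have "carrier (units_of (residue_ring (int m))) =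
          generate (units_of (residue_ring (int m))) {(-1) mod int m, int r}"
        using units_generated_iff_generate[OF 2(2,3)] by simp
      moreover have "G \<cong> finite_kernel_group m r" by (rule iso_finite_kernel_group[OF 2(1) r(1)])
      ultimately show ?thesis using 2 by blast
    qed
  next
    assume "(\<exists>n \<in> {0, 2, 4, 6, 8, 12}. G \<cong> infinite_kernel_group n) \<or>
      (\<exists>m r. m \<ge> 3 \<and> r \<in> totatives m \<and> r \<noteq> 1 \<and>
         carrier (units_of (residue_ring (int m))) =
           generate (units_of (residue_ring (int m))) {(-1) mod int m, int r} \<and>
         G \<cong> finite_kernel_group m r)"
    then show "cut_group G"
    proof (elim disjE bexE exE conjE)
      fix n assume n: "n \<in> {0, 2, 4, 6, 8, 12}" and iso: "G \<cong> infinite_kernel_group n"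
      show ?thesis
      proof (cases "n = 0")
        case True
        then show ?thesis using cut_group_iso_klein_bottle iso by simp
      next
        case False
        then have "n \<in> {2, 4, 6, 8, 12}" using n by simp
        then show ?thesis by (rule cut_group_iso_infinite_kernel[OF assms(2) iso])
      qed
    next
      fix m r assume mr: "m \<ge> 3" "r \<in> totatives m" and iso: "G \<cong> finite_kernel_group m r"
        and "carrier (units_of (residue_ring (int m))) =
           generate (units_of (residue_ring (int m))) {(-1) mod int m, int r}"
      then have "units_generated m r" using units_generated_iff_generate[OF mr] by simp
      moreover have "coprime r m" "m > 0" using mr by (auto simp: totatives_def)
      ultimately show ?thesis by (intro cut_group_iso_finite_kernel[OF assms(2) iso])
    qed
  qed
qed

end
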